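(* Let $\bar f:\overline{\mathcal M}_{p,k}\to\mathbb R$ be a (smooth) objective function satisfying $\bar f(UO,O^H\Sigma O)=\bar f(U,\Sigma)$ for all $(U,\Sigma)\in\overline{\mathcal M}_{p,k}$ and $O\in\mathcal U_k$, and let $f:\mathcal M_{p,k}\to\mathbb R$ be the induced function ($\bar f=f\circ\pi$). (1) Given $\theta=\pi(\bar\theta)\in\mathcal M_{p,k}$ with $\bar\theta=(U,\Sigma)$, the representative in $\mathcal H_{\bar\theta}$ of the Riemannian gradient of $f$ at $\theta$ is the Riemannian gradient of $\bar f$ at $\bar\theta$, which is $$\mathrm{grad}_{\overline{\mathcal M}_{p,k}}\bar f(\bar\theta)=\left(G_U-UG_U^HU,\ \frac{\Sigma\,\mathrm{herm}(G_\Sigma)\,\Sigma}{\alpha}-\frac{\beta\,\mathrm{tr}(G_\Sigma\Sigma)}{\alpha(\alpha+k\beta)}\,\Sigma\right),$$ where $(G_U,G_\Sigma)$ is the Euclidean gradient of $\bar f$ at $\bar\theta$ in $\mathbb C^{p\times k}\times\mathbb C^{k\times k}$. (2) Given $\xi=D\pi(\bar\theta)[\bar\xi]\in T_\theta\mathcal M_{p,k}$ with $\bar\xi=(\xi_U,\xi_\Sigma)\in\mathcal H_{\bar\theta}$, the representative in $\mathcal H_{\bar\theta}$ of the Riemannian Hessian $\mathrm{Hess}_{\mathcal M_{p,k}}f(\theta)[\xi]$ of $f$ at $\theta$ in direction $\xi$ is $$\overline{\mathrm{Hess}_{\mathcal M_{p,k}}f(\theta)[\xi]}=P^{\mathcal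 H}_{\bar\theta}\big(\mathrm{Hess}_{\overline{\mathcal M}_{p,k}}\bar f(\bar\theta)[\bar\xi]\big),$$ where the Riemannian Hessian of $\bar f$ at $\bar\theta$ in direction $\bar\xi$ is the pair $\mathrm{Hess}_{\overline{\mathcal M}_{p,k}}\bar f(\bar\theta)[\bar\xi]=(A_U,A_\Sigma)$ with $$A_U=H_U-UH_U^HU-U\,\mathrm{skew}(G_U^H\xi_U)-\mathrm{skew}(G_U\xi_U^H)\,U-\tfrac12(I_p-UU^H)\xi_UU^HG_U,$$ $$A_\Sigma=\frac1\alpha\Big(\Sigma\,\mathrm{herm}(H_\Sigma)\,\Sigma+\mathrm{herm}\big(\Sigma\,\mathrm{herm}(G_\Sigma)\,\xi_\Sigma\big)\Big)-\frac{\beta\,\mathrm{tr}(H_\Sigma\Sigma+G_\Sigma\xi_\Sigma)}{\alpha(\alpha+k\beta)}\,\Sigma,$$ and $(H_U,H_\Sigma)$ is the Euclidean Hessian of $\bar f$ at $\bar\theta$ in direction $\bar\xi$, i.e. the directional derivative in direction $\bar\xi$ of the Euclidean gradient of $\bar f$.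
   Context: Let $1\le k<p$ be integers. $\mathrm{St}_{p,k}=\{U\in\mathbb C^{p\times k}:U^HU=I_k\}$, $\mathcal H_k$ is the space of $k\times k$ Hermitian matrices, $\mathcal H_k^{++}$ the manifold of Hermitian positive definite $k\times k$ matrices, $\mathcal U_k$ the unitary group, $\mathrm{herm}(A)=\frac12(A+A^H)$, $\mathrm{skew}(A)=\frac12(A-A^H)$. Let $\overline{\mathcal M}_{p,k}=\mathrm{St}_{p,k}\times\mathcal H_k^{++}$, with tangent space at $\bar\theta=(U,\Sigma)$ $$T_{\bar\theta}\overline{\mathcal M}_{p,k}=\{(\xi_U,\xi_\Sigma)\in\mathbb C^{p\times k}\times\mathcal H_k:\ U^H\xi_U+\xi_U^HU=0\}.$$ For $\alpha>0$ and $\beta>-\alpha/k$, equip it with the Riemannian metric $$\langle\bar\xi,\bar\eta\rangle_{\bar\theta}=\mathrm{Re}\,\mathrm{tr}\big(\xi_U^H(I_p-\tfrac12UU^H)\eta_U\big)+\alpha\,\mathrm{tr}(\Sigma^{-1}\xi_\Sigma\Sigma^{-1}\eta_\Sigma)+\beta\,\mathrm{tr}(\Sigma^{-1}\xi_\Sigma)\,\mathrm{tr}(\Sigma^{-1}\eta_\Sigma).$$ $\mathcal U_k$ acts by isometries on $\overline{\mathcal M}_{p,k}$ via $(U,\Sigma)\mapsto(UO,O^H\Sigma O)$; $\mathcal M_{p,k}$ is the quotient manifold, $\pi:\overline{\mathcal M}_{p,k}\to\mathcal M_{p,k}$ the quotient map, and $\mathcal M_{p,k}$ carries the induced metric, i.e.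 the one making $\pi$ a Riemannian submersion. The horizontal space $\mathcal H_{\bar\theta}$ is the orthogonal complement in $T_{\bar\theta}\overline{\mathcal M}_{p,k}$ of the tangent space to the orbit of $\bar\theta$; $P^{\mathcal H}_{\bar\theta}:T_{\bar\theta}\overline{\mathcal M}_{p,k}\to\mathcal H_{\bar\theta}$ is the orthogonal projection. The representative of $\zeta\in T_\theta\mathcal M_{p,k}$, $\theta=\pi(\bar\theta)$, is the unique $\bar\zeta\in\mathcal H_{\bar\theta}$ with $D\pi(\bar\theta)[\bar\zeta]=\zeta$. The Euclidean gradient and Hessian of $\bar f$ are taken in $\mathbb C^{p\times k}\times\mathbb C^{k\times k}$ with respect to the Euclidean metric $\langle(\xi_U,\xi_\Sigma),(\eta_U,\eta_\Sigma)\rangle=\mathrm{Re}\big(\mathrm{tr}(\xi_U^H\eta_U)+\mathrm{tr}(\xi_\Sigma^H\eta_\Sigma)\big)$. The Riemannian Hessian of a function is the covariant derivative (Levi-Civita connection) of its Riemannian gradient.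
   Formalization: In A_U the term skew(G_U ξ_U^H)U is taken with + (the printed − fails for constant f̄ extended by Re tr(U^H U)), and tr(G_ΣΣ), tr(H_ΣΣ+G_Σξ_Σ) are replaced by their real parts, since G_Σ, H_Σ need not be Hermitian. *)

theory Defs
  imports "HOL-Analysis.Analysis" "HOL-Library.Function_Algebras"
begin

text \<open>
  For a finite-dimensional domain and open \<open>S\<close>, \<open>ck_on n S f\<close> says that \<open>f\<close> is of class
  \<open>C\<^sup>n\<close> on \<open>S\<close>: all directional derivatives are again of class \<open>C\<^sup>n\<^sup>-\<^sup>1\<close>.
\<close>

primrec ck_on ::
  "nat \<Rightarrow> 'a::real_normed_vector set \<Rightarrow> ('a \<Rightarrow> 'b::real_normed_vector) \<Rightarrow> bool" where
  "ck_on 0 S f \<longleftrightarrow> continuous_on S f"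
| "ck_on (Suc n) S f \<longleftrightarrow>
     (\<forall>x\<in>S. f differentiable (at x)) \<and>
     (\<forall>v. ck_on n S (\<lambda>x. frechet_derivative f (at x) v))"

definition smooth_on ::
  "'a::real_normed_vector set \<Rightarrow> ('a \<Rightarrow> 'b::real_normed_vector) \<Rightarrow> bool" where
  "smooth_on S f \<longleftrightarrow> (\<forall>n. ck_on n S f)"

definition smooth_extension ::
  "'a::real_normed_vector set \<Rightarrow> ('a \<Rightarrow> 'b::real_normed_vector) \<Rightarrow> 'a set \<Rightarrow> ('a \<Rightarrow> 'b) \<Rightarrow> bool"
  where
  "smooth_extension M u W F \<longleftrightarrow> open W \<and> smooth_on W F \<and> (\<forall>y\<in>W \<inter> M. F y = u y)"

definition smooth_fun ::
  "'a::real_normed_vector set \<Rightarrow> ('a \<Rightarrow> 'b::real_normed_vector) \<Rightarrow> bool" where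
  "smooth_fun M u \<longleftrightarrow> (\<forall>x\<in>M. \<exists>W F. x \<in> W \<and> smooth_extension M u W F)"

text \<open>
  The data of a Riemannian manifold that the notions below refer to: its points, its algebra of
  smooth real functions, its tangent spaces, the action of tangent vectors on functions as
  derivations, and its metric. Functions on the manifold are total functions whose values outside
  \<open>pts\<close> are irrelevant.
\<close>

record ('m, 't) riem =
  pts :: "'m set"
  smooth_funs :: "('m \<Rightarrow> real) set"
  tan_sp :: "'m \<Rightarrow> 't set"
  act :: "'m \<Rightarrow> 't \<Rightarrow> ('m \<Rightarrow> real) \<Rightarrow> real"
  metric :: "'m \<Rightarrow> 't \<Rightarrow> 't \<Rightarrow> real"

definition vector_fields :: "('m, 't) riem \<Rightarrow> ('m \<Rightarrow> 't) set" where
  "vector_fields R =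
     {X. (\<forall>x\<in>pts R. X x \<in> tan_sp R x) \<and>
         (\<forall>h\<in>smooth_funs R. (\<lambda>x. act R x (X x) h) \<in> smooth_funs R)}"

text \<open>\<open>nabla x \<xi> Y\<close> is the covariant derivative at \<open>x\<close> of the field \<open>Y\<close> in direction \<open>\<xi>\<close>.\<close>

definition affine_connection ::
  "('m, 't::real_vector) riem \<Rightarrow> ('m \<Rightarrow> 't \<Rightarrow> ('m \<Rightarrow> 't) \<Rightarrow> 't) \<Rightarrow> bool" where
  "affine_connection R nabla \<longleftrightarrow>
     (\<forall>x\<in>pts R. \<forall>\<xi>\<in>tan_sp R x. \<forall>Y\<in>vector_fields R. nabla x \<xi> Y \<in> tan_sp R x) \<and>
     (\<forall>X\<in>vector_fields R. \<forall>Y\<in>vector_fields R.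
        (\<lambda>x. nabla x (X x) Y) \<in> vector_fields R) \<and>
     (\<forall>x\<in>pts R. \<forall>\<xi>\<in>tan_sp R x. \<forall>\<eta>\<in>tan_sp R x. \<forall>a b. \<forall>Y\<in>vector_fields R.
        nabla x (a *\<^sub>R \<xi> + b *\<^sub>R \<eta>) Y = a *\<^sub>R nabla x \<xi> Y + b *\<^sub>R nabla x \<eta> Y) \<and>
     (\<forall>x\<in>pts R. \<forall>\<xi>\<in>tan_sp R x. \<forall>Y\<in>vector_fields R. \<forall>Z\<in>vector_fields R.
        nabla x \<xi> (\<lambda>y. Y y + Z y) = nabla x \<xi> Y + nabla x \<xi> Z) \<and>
     (\<forall>x\<in>pts R. \<forall>\<xi>\<in>tan_sp R x. \<forall>h\<in>smooth_funs R. \<forall>Y\<in>vector_fields R.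
        nabla x \<xi> (\<lambda>y. h y *\<^sub>R Y y) = act R x \<xi> h *\<^sub>R Y x + h x *\<^sub>R nabla x \<xi> Y)"

definition torsion_free ::
  "('m, 't::real_vector) riem \<Rightarrow> ('m \<Rightarrow> 't \<Rightarrow> ('m \<Rightarrow> 't) \<Rightarrow> 't) \<Rightarrow> bool" where
  "torsion_free R nabla \<longleftrightarrow>
     (\<forall>X\<in>vector_fields R. \<forall>Y\<in>vector_fields R. \<forall>x\<in>pts R. \<forall>h\<in>smooth_funs R.
        act R x (nabla x (X x) Y - nabla x (Y x) X) h =
        act R x (X x) (\<lambda>y. act R y (Y y) h) - act R x (Y x) (\<lambda>y. act R y (X y) h))"

definition metric_compatible ::
  "('m, 't::real_vector) riem \<Rightarrow> ('m \<Rightarrow> 't \<Rightarrow> ('m \<Rightarrow> 't) \<Rightarrow> 't) \<Rightarrow> bool" where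
  "metric_compatible R nabla \<longleftrightarrow>
     (\<forall>x\<in>pts R. \<forall>\<xi>\<in>tan_sp R x. \<forall>Y\<in>vector_fields R. \<forall>Z\<in>vector_fields R.
        act R x \<xi> (\<lambda>y. metric R y (Y y) (Z y)) =
        metric R x (nabla x \<xi> Y) (Z x) + metric R x (Y x) (nabla x \<xi> Z))"

definition levi_civita ::
  "('m, 't::real_vector) riem \<Rightarrow> ('m \<Rightarrow> 't \<Rightarrow> ('m \<Rightarrow> 't) \<Rightarrow> 't) \<Rightarrow> bool" where
  "levi_civita R nabla \<longleftrightarrow>
     affine_connection R nabla \<and> torsion_free R nabla \<and> metric_compatible R nabla"

definition riem_grad :: "('m, 't) riem \<Rightarrow> ('m \<Rightarrow> real) \<Rightarrow> 'm \<Rightarrow> 't" where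
  "riem_grad R u x =
     (THE v. v \<in> tan_sp R x \<and> (\<forall>w\<in>tan_sp R x. metric R x v w = act R x w u))"

definition riem_hess ::
  "('m, 't) riem \<Rightarrow> ('m \<Rightarrow> 't \<Rightarrow> ('m \<Rightarrow> 't) \<Rightarrow> 't) \<Rightarrow> ('m \<Rightarrow> real) \<Rightarrow> 'm \<Rightarrow> 't \<Rightarrow> 't" where
  "riem_hess R nabla u x \<xi> = nabla x \<xi> (riem_grad R u)"

text \<open>A \<open>p \<times> k\<close> matrix has type \<open>complex^'k^'p\<close>.\<close>

definition ctrans :: "complex^'n^'m \<Rightarrow> complex^'m^'n" where
  "ctrans A = (\<chi> i j. cnj (A $ j $ i))"

definition herm :: "complex^'n^'n \<Rightarrow> complex^'n^'n" where
  "herm A = (1/2) *\<^sub>R (A + ctrans A)"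

definition skew :: "complex^'n^'n \<Rightarrow> complex^'n^'n" where
  "skew A = (1/2) *\<^sub>R (A - ctrans A)"

definition stiefel :: "(complex^'k^'p) set" where
  "stiefel = {U. ctrans U ** U = mat 1}"

definition hermitian_mats :: "(complex^'k^'k) set" where
  "hermitian_mats = {A. ctrans A = A}"

definition hpd_mats :: "(complex^'k^'k) set" where
  "hpd_mats = {A \<in> hermitian_mats.
     \<forall>v. v \<noteq> 0 \<longrightarrow> 0 < Re (\<Sum>i\<in>UNIV. cnj (v $ i) * (A *v v) $ i)}"

definition unitary_mats :: "(complex^'k^'k) set" where
  "unitary_mats = {Q. ctrans Q ** Q = mat 1 \<and> Q ** ctrans Q = mat 1}"

type_synonym ('p, 'k) amb = "(complex^'k^'p) \<times> (complex^'k^'k)"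

definition Mbar :: "('p::finite, 'k::finite) amb set" where
  "Mbar = stiefel \<times> hpd_mats"

definition Mbar_tan :: "('p::finite, 'k::finite) amb \<Rightarrow> ('p, 'k) amb set" where
  "Mbar_tan x =
     {\<xi>. snd \<xi> \<in> hermitian_mats \<and> ctrans (fst x) ** fst \<xi> + ctrans (fst \<xi>) ** fst x = 0}"

text \<open>
  The traces in the last two terms are real at points of \<open>Mbar\<close> and for tangent vectors, so that
  taking real parts only adjusts the type.
\<close>

definition Mbar_metric ::
  "real \<Rightarrow> real \<Rightarrow> ('p::finite, 'k::finite) amb \<Rightarrow> ('p, 'k) amb \<Rightarrow> ('p, 'k) amb \<Rightarrow> real" where
  "Mbar_metric \<alpha> \<beta> x \<xi> \<eta> =
     (let U = fst x; Si = matrix_inv (snd x) in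
        Re (trace (ctrans (fst \<xi>) ** (mat 1 - (1/2) *\<^sub>R (U ** ctrans U)) ** fst \<eta>))
        + \<alpha> * Re (trace (Si ** snd \<xi> ** Si ** snd \<eta>))
        + \<beta> * Re (trace (Si ** snd \<xi>)) * Re (trace (Si ** snd \<eta>)))"

text \<open>
  The derivative of a function on \<open>Mbar\<close> is the library derivative within the set \<open>Mbar\<close>; its
  values on tangent vectors are those of the derivative of any local smooth extension.
\<close>

definition Mbar_deriv ::
  "('p::finite, 'k::finite) amb \<Rightarrow> ('p, 'k) amb \<Rightarrow> (('p, 'k) amb \<Rightarrow> real) \<Rightarrow> real" where
  "Mbar_deriv x \<xi> u = frechet_derivative u (at x within Mbar) \<xi>"

definition Mbar_riem ::
  "real \<Rightarrow> real \<Rightarrow> (('p::finite, 'k::finite) amb, ('p, 'k) amb) riem" where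
  "Mbar_riem \<alpha> \<beta> =
     \<lparr>pts = Mbar,
      smooth_funs = {u. smooth_fun Mbar u},
      tan_sp = Mbar_tan,
      act = Mbar_deriv,
      metric = Mbar_metric \<alpha> \<beta>\<rparr>"

definition uaction ::
  "('p::finite, 'k::finite) amb \<Rightarrow> complex^'k^'k \<Rightarrow> ('p, 'k) amb" where
  "uaction x Q = (fst x ** Q, ctrans Q ** snd x ** Q)"

definition orbit :: "('p::finite, 'k::finite) amb \<Rightarrow> ('p, 'k) amb set" where
  "orbit x = uaction x ` unitary_mats"

definition orbit_tan :: "('p::finite, 'k::finite) amb \<Rightarrow> ('p, 'k) amb set" where
  "orbit_tan x =
     {v. \<exists>c. c 0 = x \<and> (\<forall>t. c t \<in> orbit x) \<and> (c has_vector_derivative v) (at (0::real))}"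

definition horizontal ::
  "real \<Rightarrow> real \<Rightarrow> ('p::finite, 'k::finite) amb \<Rightarrow> ('p, 'k) amb set" where
  "horizontal \<alpha> \<beta> x =
     {\<xi> \<in> Mbar_tan x. \<forall>v\<in>orbit_tan x. Mbar_metric \<alpha> \<beta> x \<xi> v = 0}"

definition horizontal_proj ::
  "real \<Rightarrow> real \<Rightarrow> ('p::finite, 'k::finite) amb \<Rightarrow> ('p, 'k) amb \<Rightarrow> ('p, 'k) amb" where
  "horizontal_proj \<alpha> \<beta> x \<xi> =
     (THE \<eta>. \<eta> \<in> horizontal \<alpha> \<beta> x \<and>
        (\<forall>\<zeta>\<in>horizontal \<alpha> \<beta> x. Mbar_metric \<alpha> \<beta> x (\<xi> - \<eta>) \<zeta> = 0))"

text \<open>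
  Points of the quotient manifold are orbits, and the quotient map is \<open>orbit\<close>. As the quotient map
  is a surjective submersion, a function on the quotient is smooth iff its composition with the
  quotient map is, and every tangent vector is an image under the differential of the quotient map.
  A tangent vector of the quotient is represented by the derivation it induces on smooth
  functions (extended by 0 to other functions), so that tangent vectors agree iff they agree on
  smooth functions.
\<close>

definition quot :: "('p::finite, 'k::finite) amb set set" where
  "quot = orbit ` Mbar"

type_synonym ('p, 'k) qtan = "(('p, 'k) amb set \<Rightarrow> real) \<Rightarrow> real"

definition quot_smooth :: "(('p::finite, 'k::finite) amb set \<Rightarrow> real) set" where
  "quot_smooth = {h. smooth_fun Mbar (h \<circ> orbit)}"

definition Dpi :: "('p::finite, 'k::finite) amb \<Rightarrow> ('p, 'k) amb \<Rightarrow> ('p, 'k) qtan" where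
  "Dpi x \<xi> = (\<lambda>h. if h \<in> quot_smooth then Mbar_deriv x \<xi> (h \<circ> orbit) else 0)"

definition quot_tan :: "('p::finite, 'k::finite) amb set \<Rightarrow> ('p, 'k) qtan set" where
  "quot_tan \<theta> = (\<Union>x\<in>\<theta>. Dpi x ` Mbar_tan x)"

definition horizontal_rep ::
  "real \<Rightarrow> real \<Rightarrow> ('p::finite, 'k::finite) amb \<Rightarrow> ('p, 'k) qtan \<Rightarrow> ('p, 'k) amb" where
  "horizontal_rep \<alpha> \<beta> x \<zeta> = (THE \<eta>. \<eta> \<in> horizontal \<alpha> \<beta> x \<and> Dpi x \<eta> = \<zeta>)"

text \<open>
  The metric that makes the quotient map a Riemannian submersion: the differential of the quotient
  map restricted to the horizontal space is an isometry, at every point of the fibre.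
\<close>

definition quot_metric ::
  "real \<Rightarrow> real \<Rightarrow> ('p::finite, 'k::finite) amb set \<Rightarrow> ('p, 'k) qtan \<Rightarrow> ('p, 'k) qtan \<Rightarrow> real"
  where
  "quot_metric \<alpha> \<beta> \<theta> v w =
     (THE r. \<forall>x\<in>\<theta>. \<forall>\<xi>\<in>horizontal \<alpha> \<beta> x. \<forall>\<eta>\<in>horizontal \<alpha> \<beta> x.
        Dpi x \<xi> = v \<longrightarrow> Dpi x \<eta> = w \<longrightarrow> Mbar_metric \<alpha> \<beta> x \<xi> \<eta> = r)"

definition quot_riem ::
  "real \<Rightarrow> real \<Rightarrow> (('p::finite, 'k::finite) amb set, ('p, 'k) qtan) riem" where
  "quot_riem \<alpha> \<beta> =
     \<lparr>pts = quot,
      smooth_funs = quot_smooth,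
      tan_sp = quot_tan,
      act = (\<lambda>\<theta> v h. v h),
      metric = quot_metric \<alpha> \<beta>\<rparr>"

text \<open>
  Connections on the quotient add and scale tangent vectors, so derivations need their pointwise
  vector space structure.
\<close>

instantiation "fun" :: (type, scaleR) scaleR
begin

definition scaleR_fun :: "real \<Rightarrow> ('a \<Rightarrow> 'b) \<Rightarrow> 'a \<Rightarrow> 'b" where
  "scaleR_fun r f = (\<lambda>x. r *\<^sub>R f x)"

instance ..

end

instance "fun" :: (type, real_vector) real_vector
  by standard (simp_all add: scaleR_fun_def fun_eq_iff algebra_simps)

definition euclid_inner ::
  "('p::finite, 'k::finite) amb \<Rightarrow> ('p, 'k) amb \<Rightarrow> real" where
  "euclid_inner \<xi> \<eta> =
     Re (trace (ctrans (fst \<xi>) ** fst \<eta>) + trace (ctrans (snd \<xi>) ** snd \<eta>))"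

text \<open>
  These are applied to a smooth extension of a function on \<open>Mbar\<close> to an open set of pairs of
  matrices. The second component of the gradient of such an extension need not be Hermitian:
  only its Hermitian part is determined by the values at \<open>Mbar\<close>. The trace of its product with a
  Hermitian matrix may therefore fail to be real, and only the real part, which is the trace of the
  product with the Hermitian part, has intrinsic meaning.
\<close>

definition euclid_grad ::
  "(('p::finite, 'k::finite) amb \<Rightarrow> real) \<Rightarrow> ('p, 'k) amb \<Rightarrow> ('p, 'k) amb" where
  "euclid_grad F x = (THE G. (F has_derivative euclid_inner G) (at x))"

definition euclid_hess ::
  "(('p::finite, 'k::finite) amb \<Rightarrow> real) \<Rightarrow> ('p, 'k) amb \<Rightarrow> ('p, 'k) amb \<Rightarrow> ('p, 'k) amb" where
  "euclid_hess F x \<xi> = frechet_derivative (euclid_grad F) (at x) \<xi>"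

text \<open>
  A check of the sign of the term \<open>skew (GU ** ctrans \<xi>U) ** U\<close> in the Hessian formula, which is easily
  mistaken. The function \<open>F (U, S) = Re (trace (ctrans U ** U))\<close> is constant on \<open>Mbar\<close>, so its
  Riemannian Hessian there vanishes. Its Euclidean gradient is \<open>(2 U, 0)\<close> and its Euclidean Hessian
  in direction \<open>(\<xi>U, 0)\<close> is \<open>(2 \<xi>U, 0)\<close>. If \<open>ctrans U ** \<xi>U = 0\<close>, this direction is horizontal. The
  formula gives 0 with the sign \<open>+\<close>, but \<open>2 \<xi>U\<close> with the sign \<open>-\<close>.
\<close>

lemma hessian_sign_check:
  fixes U \<xi>U GU HU :: "complex^'k^'p"
  assumes U: "ctrans U ** U = mat 1" and \<xi>U: "ctrans U ** \<xi>U = 0"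
    and GU: "GU = 2 *\<^sub>R U" and HU: "HU = 2 *\<^sub>R \<xi>U"
  shows
    "HU - U ** ctrans HU ** U - U ** skew (ctrans GU ** \<xi>U)
       + skew (GU ** ctrans \<xi>U) ** U
       - (1/2) *\<^sub>R ((mat 1 - U ** ctrans U) ** \<xi>U ** ctrans U ** GU) = 0"
    "HU - U ** ctrans HU ** U - U ** skew (ctrans GU ** \<xi>U)
       - skew (GU ** ctrans \<xi>U) ** U
       - (1/2) *\<^sub>R ((mat 1 - U ** ctrans U) ** \<xi>U ** ctrans U ** GU) = 2 *\<^sub>R \<xi>U"
proof -
  have ct_mult: "ctrans (A ** B) = ctrans B ** ctrans A"
    for A :: "complex^'b^'a" and B :: "complex^'c^'b"
    by (simp add: ctrans_def matrix_matrix_mult_def vec_eq_iff mult.commute)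
  have ct_ct: "ctrans (ctrans A) = A" for A :: "complex^'b^'a"
    by (simp add: ctrans_def vec_eq_iff)
  have ct_scale: "ctrans (r *\<^sub>R A) = r *\<^sub>R ctrans A" for r and A :: "complex^'b^'a"
    by (simp add: ctrans_def vec_eq_iff)
  have ct_0: "ctrans (0 :: complex^'b^'a) = 0"
    by (simp add: ctrans_def vec_eq_iff)
  have scale_l: "(r *\<^sub>R A) ** B = r *\<^sub>R (A ** B)"
    and scale_r: "A ** (r *\<^sub>R B) = r *\<^sub>R (A ** B)"
    for r and A :: "complex^'b^'a" and B :: "complex^'c^'b"
    by (simp_all add: matrix_matrix_mult_def vec_eq_iff scaleR_sum_right)
  have diff_l: "(A - B) ** C = A ** C - B ** C"
    for A B :: "complex^'b^'a" and C :: "complex^'c^'b"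
    by (simp add: matrix_matrix_mult_def vec_eq_iff left_diff_distrib sum_subtractf)
  have \<xi>U': "ctrans \<xi>U ** U = 0"
    using \<xi>U ct_mult[of "ctrans U" \<xi>U] by (simp add: ct_ct ct_0)
  have 1: "U ** ctrans HU ** U = 0"
    by (simp add: HU ct_scale scale_l scale_r \<xi>U' flip: matrix_mul_assoc)
  have 2: "U ** skew (ctrans GU ** \<xi>U) = 0"
    by (simp add: GU skew_def ct_scale scale_l \<xi>U ct_0)
  have 3: "skew (GU ** ctrans \<xi>U) ** U = - \<xi>U"
    by (simp add: GU skew_def ct_scale ct_mult ct_ct scale_l scale_r diff_l U \<xi>U'
        scaleR_diff_right flip: matrix_mul_assoc)
  have 4: "(mat 1 - U ** ctrans U) ** \<xi>U ** ctrans U ** GU = 2 *\<^sub>R \<xi>U"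
    by (simp add: GU scale_r diff_l U \<xi>U flip: matrix_mul_assoc)
  show
    "HU - U ** ctrans HU ** U - U ** skew (ctrans GU ** \<xi>U)
       + skew (GU ** ctrans \<xi>U) ** U
       - (1/2) *\<^sub>R ((mat 1 - U ** ctrans U) ** \<xi>U ** ctrans U ** GU) = 0"
    "HU - U ** ctrans HU ** U - U ** skew (ctrans GU ** \<xi>U)
       - skew (GU ** ctrans \<xi>U) ** U
       - (1/2) *\<^sub>R ((mat 1 - U ** ctrans U) ** \<xi>U ** ctrans U ** GU) = 2 *\<^sub>R \<xi>U"
    unfolding 1 2 3 4 by (simp_all add: HU scaleR_2)
qed

end

(*
  The gradient formula is checked against the metric; positive definiteness of the latter, needed
  for uniqueness, rests on Cauchy-Schwarz for the form tr (S^-1 X S^-1 Y) on Hermitian matrices.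

  Upstairs, the connection "directional derivative plus Christoffel form" is torsion-free and
  metric, so it agrees with any Levi-Civita connection, and the Hessian is read off from it.

  Downstairs, (U, S) |-> U S U^H shows that the kernel of D pi is vertical and that gradients of
  invariant functions fill the horizontal spaces. For gradient fields the Koszul formula involves
  only inner products of gradients and their derivatives, and these agree on the quotient and
  upstairs; hence so do the Hessians, tested against horizontal vectors.
*)

theory Submission
  imports Defs
begin

subsection \<open>Matrix algebra\<close>

text \<open>No charts are available. \<open>Mbar\<close> has empty interior in the ambient space, so
  a derivative within \<open>Mbar\<close> is determined only on tangent vectors; explicit curves
  through each point (Cayley transforms and congruences) make it well defined there. On the quotient
  a tangent vector is a derivation, so every claim about it has to be tested on smooth functions of
  orbits, and the linear functionals of \<open>U S U^H\<close> are the supply of such functions.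
  Both connections are known only through their axioms. Horizontal lifts of arbitrary quotient
  fields would need a smoothness proof; the lift of a gradient is the gradient of an invariant
  function, which is smooth by the explicit formula. This is why all fields on the quotient are
  gradients. The constant \<beta> / (\<alpha> (\<alpha> + k \<beta>)) comes from inverting a
  rank-one perturbation: with Q the affine-invariant form, the metric on the second component is
  \<alpha> Q plus \<beta> times the square of Q(S, .), and Q(S, S) = k.\<close>

lemma ctrans_ctrans [simp]: "ctrans (ctrans A) = A"
  by (simp add: ctrans_def vec_eq_iff)

lemma ctrans_mult: "ctrans (A ** B) = ctrans B ** ctrans A"
  by (simp add: ctrans_def matrix_matrix_mult_def vec_eq_iff mult.commute)

lemma ctrans_add: "ctrans (A + B) = ctrans A + ctrans B"
  and ctrans_diff: "ctrans (A - B) = ctrans A - ctrans B"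
  and ctrans_minus: "ctrans (- A) = - ctrans A"
  and ctrans_scaleR: "ctrans (r *\<^sub>R A) = r *\<^sub>R ctrans A"
  and ctrans_zero [simp]: "ctrans 0 = 0"
  and ctrans_mat_1 [simp]: "ctrans (mat 1) = mat 1"
  by (auto simp: ctrans_def vec_eq_iff mat_def)

lemmas ctrans_simps = ctrans_mult ctrans_add ctrans_diff ctrans_minus ctrans_scaleR

lemma bounded_linear_ctrans: "bounded_linear (ctrans :: complex^'n^'m \<Rightarrow> complex^'m^'n)"
  by (intro linear_linear[THEN iffD2] linearI) (simp_all add: ctrans_simps)

lemma bounded_bilinear_matrix_mult:
  "bounded_bilinear (\<lambda>(A::complex^'n^'m) (B::complex^'p^'n). A ** B)"
  unfolding bilinear_conv_bounded_bilinear[symmetric]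
  by (auto simp: bilinear_def matrix_add_ldistrib matrix_matrix_mult_def vec_eq_iff
      sum.distrib algebra_simps scaleR_sum_right intro!: linearI)

text \<open>\<open>matrix_mult.FDERIV\<close> is the product rule behind every matrix derivative
  below.\<close>

interpretation matrix_mult: bounded_bilinear "\<lambda>(A::complex^'n^'m) (B::complex^'p^'n). A ** B"
  by (rule bounded_bilinear_matrix_mult)

lemmas matrix_mult_simps =
  matrix_mult.add_left matrix_mult.add_right matrix_mult.diff_left matrix_mult.diff_right
  matrix_mult.minus_left matrix_mult.minus_right matrix_mult.scaleR_left matrix_mult.scaleR_right
  matrix_mul_assoc[symmetric]

text \<open>This turns the traces of the metric into real inner products, where factors move across
  by \<open>inner_mult_left\<close> and \<open>inner_mult_left'\<close>.\<close>

lemma inner_matrix: "(A :: complex^'n^'m) \<bullet> B = Re (trace (ctrans A ** B))"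
proof -
  have "Re (trace (ctrans A ** B)) = (\<Sum>i\<in>UNIV. \<Sum>j\<in>UNIV. A $ j $ i \<bullet> B $ j $ i)"
    by (simp add: trace_def ctrans_def matrix_matrix_mult_def inner_complex_def)
  also have "\<dots> = A \<bullet> B"
    by (subst sum.swap) (simp add: inner_vec_def)
  finally show ?thesis ..
qed

lemma Re_trace_mult: "Re (trace (A ** B)) = ctrans A \<bullet> (B :: complex^'n^'m)"
  by (simp add: inner_matrix)

lemma inner_ctrans: "ctrans A \<bullet> ctrans B = A \<bullet> (B :: complex^'n^'m)"
proof -
  have "ctrans A \<bullet> ctrans B = (\<Sum>i\<in>UNIV. \<Sum>j\<in>UNIV. A $ j $ i \<bullet> B $ j $ i)"
    by (simp add: inner_vec_def ctrans_def inner_complex_def)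
  also have "\<dots> = A \<bullet> B"
    by (subst sum.swap) (simp add: inner_vec_def)
  finally show ?thesis .
qed

lemma inner_mult_left: "(A ** B) \<bullet> (C :: complex^'n^'m) = B \<bullet> (ctrans A ** C)"
  by (simp add: inner_matrix ctrans_simps matrix_mul_assoc)

lemma inner_mult_left': "(A ** B) \<bullet> (C :: complex^'n^'m) = A \<bullet> (C ** ctrans B)"
proof -
  have "(A ** B) \<bullet> C = (ctrans B ** ctrans A) \<bullet> ctrans C"
    by (metis ctrans_mult inner_ctrans)
  also have "\<dots> = ctrans A \<bullet> ctrans (C ** ctrans B)"
    by (simp add: inner_mult_left ctrans_mult)
  finally show ?thesis by (simp add: inner_ctrans)
qed

lemma inner_skew_herm:
  fixes A B :: "complex^'n^'n"
  assumes "ctrans A = - A" "ctrans B = B"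
  shows "A \<bullet> B = 0"
  using inner_ctrans[of A B] assms by simp

lemma euclid_inner_eq: "euclid_inner \<xi> \<eta> = \<xi> \<bullet> \<eta>"
  by (simp add: euclid_inner_def inner_prod_def inner_matrix)

lemma inner_complex_vec: "(v :: complex^'n) \<bullet> w = Re (\<Sum>i\<in>UNIV. cnj (v $ i) * w $ i)"
  by (simp add: inner_vec_def inner_complex_def)

lemma inner_matrix_vector: "(v :: complex^'m) \<bullet> (A *v w) = (ctrans A *v v) \<bullet> w"
proof -
  have "v \<bullet> (A *v w) = Re (\<Sum>i\<in>UNIV. \<Sum>j\<in>UNIV. cnj (v $ i) * (A $ i $ j * w $ j))"
    by (simp only: inner_complex_vec matrix_vector_mult_def vec_lambda_beta sum_distrib_left)
  also have "\<dots> = Re (\<Sum>j\<in>UNIV. \<Sum>i\<in>UNIV. cnj (v $ i) * (A $ i $ j * w $ j))"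
    by (subst sum.swap) simp
  also have "\<dots> = (ctrans A *v v) \<bullet> w"
    by (simp only: inner_complex_vec matrix_vector_mult_def ctrans_def vec_lambda_beta cnj_sum
        complex_cnj_mult complex_cnj_cnj sum_distrib_right sum_distrib_left mult_ac)
  finally show ?thesis .
qed

section \<open>Inverse matrices and their derivative\<close>

lemma matrix_inv_works:
  assumes "invertible (A :: complex^'n^'n)"
  shows "A ** matrix_inv A = mat 1" "matrix_inv A ** A = mat 1"
  using assms someI_ex[of "\<lambda>A'. A ** A' = mat 1 \<and> A' ** A = mat 1"]
  unfolding invertible_def matrix_inv_def by auto

lemma matrix_inv_unique':
  assumes "(A :: complex^'n^'n) ** B = mat 1"
  shows "invertible A" "matrix_inv A = B"
proof -
  show i: "invertible A" using assms invertible_right_inverse by blast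
  have "matrix_inv A = matrix_inv A ** (A ** B)" by (simp add: assms)
  then show "matrix_inv A = B" by (simp add: matrix_mul_assoc matrix_inv_works[OF i])
qed

lemma invertible_iff_kernel:
  "invertible (A :: complex^'n^'n) \<longleftrightarrow> (\<forall>v. A *v v = 0 \<longrightarrow> v = 0)"
  using invertible_left_inverse[of A] matrix_left_invertible_ker[of A] by simp

lemma continuous_det: "continuous_on S (det :: complex^'n^'n \<Rightarrow> complex)"
  unfolding det_def by (intro continuous_intros)

lemma open_invertible: "open {A :: complex^'n^'n. invertible A}"
proof -
  have "open (det -` (- {0}) :: (complex^'n^'n) set)"
    by (rule open_vimage) (auto intro: continuous_det)
  then show ?thesis by (simp add: invertible_det_nz vimage_def)
qed

text \<open>Column \<open>i\<close> of the inverse solves \<open>A x = e_i\<close>, so Cramer's rule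
  applies. The quotients of determinants give continuity of the inverse.\<close>

lemma matrix_inv_cramer:
  assumes "invertible (A :: complex^'n^'n)"
  shows "matrix_inv A =
    (\<chi> k i. det (\<chi> r c. if c = k then axis i 1 $ r else A $ r $ c) / det A)"
proof -
  let ?x = "\<lambda>i. \<chi> k. det (\<chi> r c. if c = k then axis i 1 $ r else A $ r $ c) / det A"
  have "det A \<noteq> 0" using assms by (simp add: invertible_det_nz)
  from cramer[OF this] have x: "A *v ?x i = axis i 1" for i by blast
  have "A ** (\<chi> k i. ?x i $ k) = mat 1"
  proof -
    have "(A ** (\<chi> k i. ?x i $ k)) $ r $ i = (A *v ?x i) $ r" for r i
      by (simp add: matrix_matrix_mult_def matrix_vector_mult_def)
    then show ?thesis unfolding x by (simp add: vec_eq_iff mat_def axis_def)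
  qed
  then have "matrix_inv A = (\<chi> k i. ?x i $ k)" by (rule matrix_inv_unique')
  then show ?thesis by simp
qed

lemma continuous_matrix_inv: "continuous_on {A :: complex^'n^'n. invertible A} matrix_inv"
proof -
  have "continuous_on {A :: complex^'n^'n. invertible A} (\<lambda>A.
    (\<chi> k i. det (\<chi> r c. if c = k then axis i 1 $ r else A $ r $ c) / det A))"
  proof (intro continuous_on_vec_lambda continuous_on_divide continuous_det
      continuous_on_compose2[OF continuous_det[of UNIV]])
    show "continuous_on {A :: complex^'n^'n. invertible A}
        (\<lambda>A. if c = k then axis i 1 $ r else A $ r $ c)" for k i r c
      by (cases "c = k") (auto intro!: continuous_intros)
  qed (auto simp: invertible_det_nz)
  then show ?thesis
    by (rule continuous_on_eq) (simp add: matrix_inv_cramer)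
qed

text \<open>Continuity of the inverse already implies differentiability, because the error of the
  linear approximation factors exactly.\<close>

lemma has_derivative_matrix_inv:
  assumes "invertible (A :: complex^'n^'n)"
  shows "(matrix_inv has_derivative (\<lambda>H. - (matrix_inv A ** H ** matrix_inv A))) (at A)"
proof (rule has_derivativeI)
  let ?I = "matrix_inv A"
  show "bounded_linear (\<lambda>H. - (?I ** H ** ?I))"
    by (intro bounded_linear_intros matrix_mult.bounded_linear_left matrix_mult.bounded_linear_right
        bounded_linear_compose[OF matrix_mult.bounded_linear_left matrix_mult.bounded_linear_right]
        bounded_linear_minus)
  obtain K where K: "\<And>(a :: complex^'n^'n) (b :: complex^'n^'n). norm (a ** b) \<le> norm a * norm b * K" "K > 0"
    using matrix_mult.pos_bounded by blast
  have lim: "(matrix_inv \<longlongrightarrow> ?I) (at A)"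
    using continuous_matrix_inv assms
    unfolding continuous_on_eq_continuous_at[OF open_invertible] isCont_def by blast
  have ev: "\<forall>\<^sub>F B in at A. invertible B"
    using eventually_at_topological open_invertible assms by blast
  \<comment> \<open>The right-hand side is \<open>B - A\<close> times a fixed matrix and a factor
    that tends to 0 as \<open>B\<close> tends to \<open>A\<close>, hence of lower order than
    \<open>B - A\<close>.\<close>
  have key: "matrix_inv B - ?I + (?I ** (B - A) ** ?I) = (?I - matrix_inv B) ** (B - A) ** ?I"
    if "invertible B" for B
  proof -
    have "matrix_inv B ** A ** ?I = matrix_inv B" "?I ** A ** ?I = ?I"
      by (simp_all add: matrix_inv_works[OF assms] flip: matrix_mul_assoc)
    then show ?thesis
      by (simp add: matrix_mult.diff_left matrix_mult.diff_right matrix_inv_works[OF that])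
  qed
  have "((\<lambda>B. norm (?I - matrix_inv B) * norm ?I * K * K) \<longlongrightarrow> norm (?I - ?I) * norm ?I * K * K) (at A)"
    by (intro tendsto_intros lim)
  then have z: "((\<lambda>B. norm (?I - matrix_inv B) * norm ?I * K * K) \<longlongrightarrow> 0) (at A)" by simp
  show "((\<lambda>B. (matrix_inv B - ?I - - (?I ** (B - A) ** ?I)) /\<^sub>R norm (B - A)) \<longlongrightarrow> 0) (at A)"
  proof (rule tendsto_norm_zero_cancel, rule tendsto_sandwich[OF _ _ tendsto_const z])
    show "\<forall>\<^sub>F B in at A. norm ((matrix_inv B - ?I - - (?I ** (B - A) ** ?I)) /\<^sub>R norm (B - A))
        \<le> norm (?I - matrix_inv B) * norm ?I * K * K"
      using ev eventually_neq_at_within[of A A UNIV]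
    proof eventually_elim
      case (elim B)
      have "norm ((?I - matrix_inv B) ** (B - A) ** ?I)
        \<le> norm ((?I - matrix_inv B) ** (B - A)) * norm ?I * K"
        using K(1)[of "(?I - matrix_inv B) ** (B - A)" ?I] by simp
      also have "\<dots> \<le> norm (?I - matrix_inv B) * norm (B - A) * K * norm ?I * K"
        by (intro mult_right_mono K) (use K in auto)
      finally have "norm ((?I - matrix_inv B) ** (B - A) ** ?I)
        \<le> (norm (?I - matrix_inv B) * norm ?I * K * K) * norm (B - A)" by (simp add: mult_ac)
      moreover have "norm (B - A) > 0" using elim by auto
      ultimately show ?case
        by (simp add: key elim divide_simps)
    qed
  qed simp
qed

subsection \<open>Smooth functions\<close>

lemma frechet_derivative_eq:
  "(f has_derivative D) (at x) \<Longrightarrow> frechet_derivative f (at x) = D"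
  by (metis frechet_derivative_at)

lemma has_derivative_transform_open:
  assumes "open S" "x \<in> S" "\<And>y. y \<in> S \<Longrightarrow> f y = g y" "(f has_derivative D) (at x)"
  shows "(g has_derivative D) (at x)"
  using has_derivative_transform_within_open[of f D x UNIV S g] assms by simp

lemma ck_on_cong:
  assumes "open S" "\<And>y. y \<in> S \<Longrightarrow> f y = g y" "ck_on n S f"
  shows "ck_on n S g"
  using assms(2,3)
proof (induction n arbitrary: f g)
  case 0
  then show ?case using continuous_on_eq by auto
next
  case (Suc n)
  have d: "(g has_derivative frechet_derivative f (at x)) (at x)" if "x \<in> S" for x
    using Suc.prems that assms(1) has_derivative_transform_open
    by (metis ck_on.simps(2) frechet_derivative_works)
  then have "frechet_derivative g (at x) = frechet_derivative f (at x)" if "x \<in> S" for x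
    using that frechet_derivative_eq by blast
  then have "ck_on n S (\<lambda>x. frechet_derivative g (at x) v)" for v
    using Suc.IH[of "\<lambda>x. frechet_derivative f (at x) v" "\<lambda>x. frechet_derivative g (at x) v"]
      Suc.prems by simp
  then show ?case using d unfolding ck_on.simps(2) differentiable_def by blast
qed

lemma ck_on_subset: "ck_on n S f \<Longrightarrow> T \<subseteq> S \<Longrightarrow> ck_on n T f"
  by (induction n arbitrary: f) (auto intro: continuous_on_subset)

lemma ck_on_continuous: "ck_on n S f \<Longrightarrow> continuous_on S f"
  by (cases n) (auto intro: continuous_at_imp_continuous_on differentiable_imp_continuous_within)

lemma ck_on_lessD: "ck_on (Suc n) S f \<Longrightarrow> ck_on n S f"
proof (induction n arbitrary: f)
  case 0
  then show ?case using ck_on_continuous[of "Suc 0"] by simp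
next
  case (Suc n)
  have "ck_on (Suc n) S (\<lambda>x. frechet_derivative f (at x) v)" for v
    using Suc.prems by simp
  from Suc.IH[OF this] show ?case using Suc.prems by simp
qed

text \<open>Any explicit derivative \<open>D\<close> may stand in for the chosen
  \<open>frechet_derivative\<close>: at points of an open set the two coincide.\<close>

lemma ck_on_SucI:
  assumes "open S" "\<And>x. x \<in> S \<Longrightarrow> (f has_derivative D x) (at x)" "\<And>v. ck_on n S (\<lambda>x. D x v)"
  shows "ck_on (Suc n) S f"
proof -
  have "ck_on n S (\<lambda>x. frechet_derivative f (at x) v)" for v
    by (rule ck_on_cong[OF assms(1) _ assms(3)]) (simp add: frechet_derivative_eq[OF assms(2)])
  then show ?thesis using assms(2) by (auto simp: differentiable_def)
qed

lemma ck_on_SucD: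
  assumes "ck_on (Suc n) S f" "x \<in> S"
  shows "(f has_derivative frechet_derivative f (at x)) (at x)"
  using assms frechet_derivative_works by auto

lemma ck_on_const: "open S \<Longrightarrow> ck_on n S (\<lambda>x. c)"
proof (induction n arbitrary: c)
  case (Suc n)
  show ?case
    by (rule ck_on_SucI[where D = "\<lambda>x v. 0"]) (use Suc in auto)
qed simp

lemma ck_on_id: "open S \<Longrightarrow> ck_on n S (\<lambda>x. x)"
proof (cases n)
  case (Suc m)
  assume "open S"
  then show ?thesis unfolding Suc
    by (intro ck_on_SucI[where D = "\<lambda>x v. v"] ck_on_const) auto
qed auto

lemma ck_on_linear:
  assumes "bounded_linear L"
  shows "open S \<Longrightarrow> ck_on n S f \<Longrightarrow> ck_on n S (\<lambda>x. L (f x))"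
proof (induction n arbitrary: f)
  case 0
  then show ?case using bounded_linear.continuous_on[OF assms] by simp
next
  case (Suc n)
  show ?case
    by (rule ck_on_SucI[OF Suc.prems(1), where D = "\<lambda>x v. L (frechet_derivative f (at x) v)"])
      (use Suc in \<open>auto intro!: bounded_linear.has_derivative[OF assms] ck_on_SucD[OF Suc.prems(2)]\<close>)
qed

lemma ck_on_add:
  "open S \<Longrightarrow> ck_on n S f \<Longrightarrow> ck_on n S g \<Longrightarrow> ck_on n S (\<lambda>x. f x + g x)"
proof (induction n arbitrary: f g)
  case 0
  then show ?case by (auto intro: continuous_intros)
next
  case (Suc n)
  show ?case
    by (rule ck_on_SucI[OF Suc.prems(1),
          where D = "\<lambda>x v. frechet_derivative f (at x) v + frechet_derivative g (at x) v"])
      (use Suc in \<open>auto intro!: has_derivative_add ck_on_SucD[OF Suc.prems(2)] ck_on_SucD[OF Suc.prems(3)]\<close>)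
qed

text \<open>The Leibniz derivative is a sum of two terms of the same bilinear shape; the
  undifferentiated factor enters one order lower, whence \<open>ck_on_lessD\<close>.\<close>

lemma ck_on_bilinear:
  assumes "bounded_bilinear h"
  shows "open S \<Longrightarrow> ck_on n S f \<Longrightarrow> ck_on n S g \<Longrightarrow> ck_on n S (\<lambda>x. h (f x) (g x))"
proof (induction n arbitrary: f g)
  case 0
  then show ?case using bounded_bilinear.continuous_on[OF assms] by simp
next
  case (Suc n)
  let ?D = "\<lambda>x v. h (f x) (frechet_derivative g (at x) v) + h (frechet_derivative f (at x) v) (g x)"
  have "ck_on n S (\<lambda>x. ?D x v)" for v
    by (intro ck_on_add Suc.IH Suc.prems(1) ck_on_lessD[OF Suc.prems(2)] ck_on_lessD[OF Suc.prems(3)])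
      (use Suc.prems in auto)
  then show ?case
    by (intro ck_on_SucI[OF Suc.prems(1), where D = ?D] bounded_bilinear.FDERIV[OF assms])
      (auto intro: ck_on_SucD[OF Suc.prems(2)] ck_on_SucD[OF Suc.prems(3)])
qed

named_theorems smooth_intros

lemma smooth_on_const [smooth_intros]: "open S \<Longrightarrow> smooth_on S (\<lambda>x. c)"
  and smooth_on_id [smooth_intros]: "open S \<Longrightarrow> smooth_on S (\<lambda>x. x)"
  and smooth_on_add [smooth_intros]:
    "open S \<Longrightarrow> smooth_on S f \<Longrightarrow> smooth_on S g \<Longrightarrow> smooth_on S (\<lambda>x. f x + g x)"
  unfolding smooth_on_def by (auto intro: ck_on_const ck_on_id ck_on_add)

lemma smooth_on_linear:
  "bounded_linear L \<Longrightarrow> open S \<Longrightarrow> smooth_on S f \<Longrightarrow> smooth_on S (\<lambda>x. L (f x))"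
  unfolding smooth_on_def using ck_on_linear by blast

lemma smooth_on_bilinear:
  "bounded_bilinear h \<Longrightarrow> open S \<Longrightarrow> smooth_on S f \<Longrightarrow> smooth_on S g \<Longrightarrow>
    smooth_on S (\<lambda>x. h (f x) (g x))"
  unfolding smooth_on_def using ck_on_bilinear by blast

lemmas smooth_on_fst [smooth_intros] = smooth_on_linear[OF bounded_linear_fst]
  and smooth_on_snd [smooth_intros] = smooth_on_linear[OF bounded_linear_snd]
  and smooth_on_ctrans [smooth_intros] = smooth_on_linear[OF bounded_linear_ctrans]
  and smooth_on_matrix_mult [smooth_intros] = smooth_on_bilinear[OF bounded_bilinear_matrix_mult]
  and smooth_on_scaleR [smooth_intros] = smooth_on_bilinear[OF bounded_bilinear_scaleR]
  and smooth_on_inner [smooth_intros] = smooth_on_bilinear[OF bounded_bilinear_inner]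

lemma smooth_on_diff [smooth_intros]:
  assumes "open S" "smooth_on S f" "smooth_on S g"
  shows "smooth_on S (\<lambda>x. f x - g x)"
  using smooth_on_add[OF assms(1,2) smooth_on_linear[OF bounded_linear_minus[OF bounded_linear_ident] assms(1,3)]]
  by simp

lemma smooth_on_mult [smooth_intros]:
  "open S \<Longrightarrow> smooth_on S f \<Longrightarrow> smooth_on S g \<Longrightarrow> smooth_on S (\<lambda>x. f x * g x :: real)"
  by (rule smooth_on_bilinear[OF bounded_bilinear_mult])

lemma smooth_on_Pair [smooth_intros]:
  assumes "open S" "smooth_on S f" "smooth_on S g"
  shows "smooth_on S (\<lambda>x. (f x, g x))"
proof -
  have "smooth_on S (\<lambda>x. (f x, 0) + (0, g x))"
    using assms by (intro smooth_on_add smooth_on_linear[of "\<lambda>v. (v, 0)"]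
        smooth_on_linear[of "\<lambda>v. (0, v)"] bounded_linear_Pair bounded_linear_ident bounded_linear_zero)
  then show ?thesis by simp
qed

lemma smooth_on_sum [smooth_intros]:
  "open S \<Longrightarrow> (\<And>i. i \<in> I \<Longrightarrow> smooth_on S (f i)) \<Longrightarrow> smooth_on S (\<lambda>x. \<Sum>i\<in>I. f i x)"
proof (induction I rule: infinite_finite_induct)
  case (insert i I)
  then show ?case by (auto intro!: smooth_on_add)
qed (auto intro: smooth_on_const)

lemma smooth_on_frechet_derivative [smooth_intros]:
  "smooth_on S f \<Longrightarrow> smooth_on S (\<lambda>x. frechet_derivative f (at x) v)"
  unfolding smooth_on_def by (metis ck_on.simps(2))

lemma smooth_on_subset: "smooth_on S f \<Longrightarrow> T \<subseteq> S \<Longrightarrow> smooth_on T f"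
  unfolding smooth_on_def using ck_on_subset by blast

lemma smooth_on_has_derivative:
  "smooth_on S f \<Longrightarrow> x \<in> S \<Longrightarrow> (f has_derivative frechet_derivative f (at x)) (at x)"
  unfolding smooth_on_def using ck_on_SucD by blast

lemma frechet_derivative_basis:
  fixes f :: "'a::euclidean_space \<Rightarrow> 'b::real_normed_vector"
  assumes "(f has_derivative D) (at x)"
  shows "D v = (\<Sum>b\<in>Basis. (v \<bullet> b) *\<^sub>R frechet_derivative f (at x) b)"
proof -
  have "D v = D (\<Sum>b\<in>Basis. (v \<bullet> b) *\<^sub>R b)" by (simp add: euclidean_representation)
  also have "\<dots> = (\<Sum>b\<in>Basis. (v \<bullet> b) *\<^sub>R D b)"
    using has_derivative_linear[OF assms] by (simp add: linear_sum linear_scale)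
  finally show ?thesis by (simp add: frechet_derivative_eq[OF assms])
qed

text \<open>\<open>ck_on\<close> controls derivatives in constant directions only. Expanding
  \<open>Y x\<close> in the basis moves the dependence on \<open>x\<close> into scalar
  coefficients.\<close>

lemma smooth_on_derivative_along:
  fixes f :: "'a::euclidean_space \<Rightarrow> 'b::real_normed_vector"
  assumes "open S" "smooth_on S f" "smooth_on S Y"
  shows "smooth_on S (\<lambda>x. frechet_derivative f (at x) (Y x))"
proof -
  have "smooth_on S (\<lambda>x. \<Sum>b\<in>Basis. (Y x \<bullet> b) *\<^sub>R frechet_derivative f (at x) b)"
    using assms by (intro smooth_intros)
  moreover have "(\<Sum>b\<in>Basis. (Y x \<bullet> b) *\<^sub>R frechet_derivative f (at x) b)
      = frechet_derivative f (at x) (Y x)" if "x \<in> S" for x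
    by (rule frechet_derivative_basis[OF smooth_on_has_derivative[OF assms(2) that], symmetric])
  ultimately show ?thesis
    unfolding smooth_on_def using ck_on_cong[OF assms(1), where g = "\<lambda>x. frechet_derivative f (at x) (Y x)"
        and f = "\<lambda>x. \<Sum>b\<in>Basis. (Y x \<bullet> b) *\<^sub>R frechet_derivative f (at x) b"] by simp
qed

section \<open>Functions on a subset with local smooth extensions\<close>

lemma smooth_funI:
  assumes "\<And>x. x \<in> M \<Longrightarrow> \<exists>W F. open W \<and> x \<in> W \<and> smooth_on W F \<and> (\<forall>y\<in>W \<inter> M. F y = u y)"
  shows "smooth_fun M u"
  using assms unfolding smooth_fun_def smooth_extension_def by blast

lemma smooth_funE:
  assumes "smooth_fun M u" "x \<in> M"
  obtains W F where "open W" "x \<in> W" "smooth_on W F" "\<And>y. y \<in> W \<Longrightarrow> y \<in> M \<Longrightarrow> F y = u y"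
proof -
  obtain W F where "x \<in> W" "smooth_extension M u W F"
    using assms unfolding smooth_fun_def by blast
  then show ?thesis using that[of W F] unfolding smooth_extension_def by simp
qed

lemma smooth_fun_cong:
  assumes "smooth_fun M u" "\<And>x. x \<in> M \<Longrightarrow> u x = v x"
  shows "smooth_fun M v"
proof (rule smooth_funI)
  fix x assume "x \<in> M"
  from assms(1) this obtain W F
    where "open W" "x \<in> W" "smooth_on W F" "\<And>y. y \<in> W \<Longrightarrow> y \<in> M \<Longrightarrow> F y = u y"
    by (rule smooth_funE) (rule that)
  then show "\<exists>W F. open W \<and> x \<in> W \<and> smooth_on W F \<and> (\<forall>y\<in>W \<inter> M. F y = v y)"
    using assms(2) by (intro exI[of _ W] exI[of _ F]) auto
qed

lemma smooth_on_imp_smooth_fun: "smooth_on UNIV F \<Longrightarrow> smooth_fun M F"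
  by (rule smooth_funI) (intro exI[of _ UNIV] exI[of _ F], simp)

lemma extension_has_derivative_within:
  assumes "open W" "x \<in> W" "x \<in> M" "(F has_derivative D) (at x)"
    "\<And>y. y \<in> W \<Longrightarrow> y \<in> M \<Longrightarrow> F y = u y"
  shows "(u has_derivative D) (at x within M)"
proof -
  obtain d where d: "d > 0" "ball x d \<subseteq> W" using assms(1,2) openE by blast
  show ?thesis
    using has_derivative_transform_within[OF has_derivative_at_withinI[OF assms(4)] d(1) assms(3), of u]
      assms(5) d(2) by (auto simp: dist_commute subset_iff)
qed

lemma smooth_fun_has_derivative:
  assumes "smooth_fun M u" "x \<in> M"
  shows "\<exists>D. (u has_derivative D) (at x within M)"
proof -
  obtain W F where W: "open W" "x \<in> W" "smooth_on W F" "\<And>y. y \<in> W \<Longrightarrow> y \<in> M \<Longrightarrow> F y = u y"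
    by (rule smooth_funE[OF assms]) (rule that)
  show ?thesis
    using extension_has_derivative_within[OF W(1,2) assms(2) smooth_on_has_derivative[OF W(3,2)] W(4)]
    by blast
qed

text \<open>Within a thin set the derivative is a choice among several. The chosen maps still
  coincide as a whole, since both are chosen by the same predicate.\<close>

lemma frechet_derivative_within_cong:
  assumes "\<And>y. y \<in> M \<Longrightarrow> u y = v y" "x \<in> M"
  shows "frechet_derivative u (at x within M) = frechet_derivative v (at x within M)"
proof -
  have "(u has_derivative D) (at x within M) \<longleftrightarrow> (v has_derivative D) (at x within M)" for D
    by (rule iffI; rule has_derivative_transform[OF assms(2)]) (simp_all add: assms(1))
  then show ?thesis unfolding frechet_derivative_def by simp
qed

subsection \<open>Positive definite matrices\<close>

definition psd :: "complex^'n^'n \<Rightarrow> bool" where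
  "psd A \<longleftrightarrow> ctrans A = A \<and> (\<forall>v. 0 \<le> v \<bullet> (A *v v))"

lemma hpd_iff: "A \<in> hpd_mats \<longleftrightarrow> ctrans A = A \<and> (\<forall>v. v \<noteq> 0 \<longrightarrow> 0 < v \<bullet> (A *v v))"
  by (simp add: hpd_mats_def hermitian_mats_def inner_complex_vec)

lemma hpd_psd: "A \<in> hpd_mats \<Longrightarrow> psd A"
  unfolding hpd_iff psd_def by (metis inner_zero_left order.refl order.strict_implies_order)

lemma hpd_invertible:
  assumes "A \<in> hpd_mats"
  shows "invertible A"
  unfolding invertible_iff_kernel
  using assms unfolding hpd_iff by (metis inner_zero_right less_irrefl)

lemma hpd_congruence:
  fixes A C :: "complex^'n^'n"
  assumes "A \<in> hpd_mats" "invertible C"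
  shows "ctrans C ** A ** C \<in> hpd_mats"
proof -
  have "v \<bullet> ((ctrans C ** A ** C) *v v) = (C *v v) \<bullet> (A *v (C *v v))" for v
    by (simp add: inner_matrix_vector[of "C *v v", symmetric] inner_matrix_vector[of v "ctrans C"]
        flip: matrix_vector_mul_assoc)
  then show ?thesis
    using assms(1) invertible_iff_kernel[THEN iffD1, OF assms(2)] unfolding hpd_iff
    by (simp add: ctrans_simps matrix_mul_assoc) blast
qed

lemma psd_congruence:
  assumes "psd A"
  shows "psd (ctrans C ** A ** C)"
proof -
  have "v \<bullet> ((ctrans C ** A ** C) *v v) = (C *v v) \<bullet> (A *v (C *v v))" for v
    by (simp add: inner_matrix_vector[of "C *v v", symmetric] inner_matrix_vector[of v "ctrans C"]
        flip: matrix_vector_mul_assoc)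
  then show ?thesis
    using assms unfolding psd_def by (auto simp: ctrans_simps matrix_mul_assoc)
qed

text \<open>Once \<open>C = matrix_inv A\<close> is known to be Hermitian,
  \<open>C^H A C = C\<close> exhibits the inverse as a congruence of \<open>A\<close>.\<close>

lemma hpd_inverse:
  assumes "A \<in> hpd_mats"
  shows "matrix_inv A \<in> hpd_mats" "ctrans (matrix_inv A) = matrix_inv A"
proof -
  note i = matrix_inv_works[OF hpd_invertible[OF assms]]
  have "ctrans (matrix_inv A) ** A = mat 1"
    using i(1) assms by (metis ctrans_mult ctrans_mat_1 hpd_iff)
  then have "A ** ctrans (matrix_inv A) = mat 1" by (simp add: matrix_left_right_inverse)
  then show c: "ctrans (matrix_inv A) = matrix_inv A" by (metis matrix_inv_unique'(2))
  have "invertible (matrix_inv A)" using i unfolding invertible_def by blast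
  from hpd_congruence[OF assms this] show "matrix_inv A \<in> hpd_mats"
    by (simp add: c i)
qed

definition matrix_unit :: "'n \<Rightarrow> complex^'n^'n" where
  "matrix_unit i = (\<chi> a b. if a = i \<and> b = i then 1 else 0)"

lemma matrix_unit_mult: "matrix_unit i ** A = (\<chi> a b. if a = i then A $ i $ b else 0)"
  by (simp add: matrix_unit_def matrix_matrix_mult_def vec_eq_iff if_distrib[of "\<lambda>x. x * _"]
      sum.delta conj_commute cong: if_cong flip: if_split_mem2)

lemma ctrans_matrix_unit: "ctrans (matrix_unit i) = matrix_unit i"
  by (auto simp: matrix_unit_def ctrans_def vec_eq_iff)

lemma trace_matrix_unit_mult: "trace (matrix_unit i ** A) = A $ i $ i"
  by (simp add: matrix_unit_mult trace_def)

lemma matrix_unit_sandwich: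
  "matrix_unit i ** A ** matrix_unit i = (\<chi> a b. if a = i \<and> b = i then A $ i $ i else 0)"
proof -
  have "(matrix_unit i ** A ** matrix_unit i) $ a $ b = (if a = i \<and> b = i then A $ i $ i else 0)" for a b
  proof (cases "b = i")
    case True
    then show ?thesis
      unfolding matrix_unit_mult
      by (simp add: matrix_matrix_mult_def matrix_unit_def if_distrib cong: if_cong)
  next
    case False
    have "(M ** matrix_unit i) $ a $ b = 0" for M
      by (simp add: matrix_matrix_mult_def matrix_unit_def False)
    then show ?thesis using False by simp
  qed
  then show ?thesis by (simp add: vec_eq_iff)
qed

section \<open>Semidefinite forms and traces of products\<close>

lemma quadratic_nonneg_imp_linear_zero:
  fixes a b :: real
  assumes "\<And>s. 0 \<le> 2 * s * a + s * s * b"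
  shows "a = 0"
proof -
  have b: "0 \<le> b" using assms[of 1] assms[of "-1"] by simp
  \<comment> \<open>The minimiser would be \<open>- a / b\<close>; adding 1 avoids dividing by 0 and
    still gives the negative value \<open>- s * s * (b + 2)\<close> unless
    \<open>s = 0\<close>.\<close>
  define s where "s = - a / (b + 1)"
  have a: "a = - s * (b + 1)" using b by (simp add: s_def)
  have "0 \<le> - (s * s * (b + 2))" using assms[of s] by (simp add: a algebra_simps)
  then have "s = 0" using b by (auto simp: mult_le_0_iff)
  then show ?thesis using a by simp
qed

text \<open>A null vector of a semidefinite form is orthogonal to everything. Nonnegativity is asked
  only along the line through \<open>v\<close> in direction \<open>w\<close>, so that forms
  nonnegative only on Hermitian matrices are covered.\<close>

lemma form_zero_imp_zero_inner:
  fixes B :: "'a::real_vector \<Rightarrow> 'a \<Rightarrow> real"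
  assumes "\<And>s. 0 \<le> B (v + s *\<^sub>R w) (v + s *\<^sub>R w)"
    "\<And>s. B (v + s *\<^sub>R w) (v + s *\<^sub>R w) = B v v + 2 * s * B v w + s * s * B w w" "B v v = 0"
  shows "B v w = 0"
  by (rule quadratic_nonneg_imp_linear_zero[of _ "B w w"]) (metis assms add.left_neutral)

lemma matrix_vector_mult_axis: "(A *v axis i 1) $ j = (A :: complex^'n^'m) $ j $ i"
  by (simp add: matrix_vector_mult_def axis_def if_distrib cong: if_cong)

lemma axis_inner_mult: "axis i 1 \<bullet> (A *v axis i 1) = Re ((A :: complex^'n^'n) $ i $ i)"
  by (simp add: inner_axis' matrix_vector_mult_axis inner_complex_def)

lemma psd_diag:
  assumes "psd A"
  shows "A $ i $ i = complex_of_real (Re (A $ i $ i))" "0 \<le> Re (A $ i $ i)"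
proof -
  have "cnj (A $ i $ i) = A $ i $ i"
    using assms unfolding psd_def ctrans_def vec_eq_iff by (metis vec_lambda_beta)
  then show "A $ i $ i = complex_of_real (Re (A $ i $ i))"
    by (metis Reals_cnj_iff of_real_Re)
  show "0 \<le> Re (A $ i $ i)"
    using assms unfolding psd_def axis_inner_mult[symmetric] by blast
qed

text \<open>The basis vector is a null vector of the form, and testing it against
  \<open>A *v axis i 1\<close> itself yields the squared norm of that vector.\<close>

lemma psd_zero_diag:
  fixes A :: "complex^'n^'n"
  assumes "psd A" "Re (A $ i $ i) = 0"
  shows "A *v axis i 1 = 0"
proof -
  let ?e = "axis i 1 :: complex^'n"
  define u where "u = A *v ?e"
  have sym: "u \<bullet> (A *v ?e) = ?e \<bullet> (A *v u)"
    using assms(1) by (simp add: psd_def u_def inner_matrix_vector[of ?e A])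
  have "?e \<bullet> (A *v u) = 0"
  proof (rule form_zero_imp_zero_inner[where B = "\<lambda>v w. v \<bullet> (A *v w)"])
    show "0 \<le> (?e + s *\<^sub>R u) \<bullet> (A *v (?e + s *\<^sub>R u))" for s
      using assms(1) unfolding psd_def by blast
    show "(?e + s *\<^sub>R u) \<bullet> (A *v (?e + s *\<^sub>R u))
        = ?e \<bullet> (A *v ?e) + 2 * s * (?e \<bullet> (A *v u)) + s * s * (u \<bullet> (A *v u))" for s
    proof -
      have "A *v (?e + s *\<^sub>R u) = A *v ?e + s *\<^sub>R (A *v u)"
        unfolding matrix_vector_right_distrib
        by (simp add: matrix_vector_mult_def[of _ "_ *\<^sub>R _"] matrix_vector_mult_def[of A u] vec_eq_iff
            scaleR_sum_right)
      then show ?thesis using sym by (simp add: inner_add_left inner_add_right algebra_simps)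
    qed
    show "?e \<bullet> (A *v ?e) = 0" unfolding axis_inner_mult by (rule assms(2))
  qed
  then have "u \<bullet> u = 0" using sym unfolding u_def[symmetric] by simp
  then show ?thesis by (simp add: u_def)
qed

text \<open>
  Induction on the number of nonzero rows of \<open>A\<close>: subtracting \<open>A E A / A $ i $ i\<close>, with \<open>E\<close> the
  matrix unit at \<open>(i, i)\<close>, is a congruence that kills row \<open>i\<close>.
\<close>

lemma psd_trace_mult:
  fixes A B :: "complex^'n^'n"
  assumes "psd A" "psd B"
  shows "0 \<le> Re (trace (A ** B))"
  using assms(1)
proof (induction "card {i. A $ i \<noteq> 0}" arbitrary: A rule: less_induct)
  case less
  show ?case
  proof (cases "A = 0")
    case True
    then show ?thesis by (simp add: trace_def)
  next
    case False
    then obtain i where i: "A $ i \<noteq> 0" by (auto simp: vec_eq_iff)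
    define p where "p = Re (A $ i $ i)"
    define E :: "complex^'n^'n" where "E = matrix_unit i"
    have herm: "ctrans A = A" using less.prems by (simp add: psd_def)
    have "p \<noteq> 0"
    proof
      assume "p = 0"
      then have z: "A *v axis i 1 = 0" using psd_zero_diag[OF less.prems] by (simp add: p_def)
      have "A $ i $ j = 0" for j
      proof -
        have "A $ j $ i = 0"
          using z matrix_vector_mult_axis[of A i j] by simp
        then show ?thesis using herm by (metis (no_types) complex_cnj_zero ctrans_def vec_lambda_beta)
      qed
      then show False using i by (simp add: vec_eq_iff)
    qed
    then have p: "p > 0" using psd_diag(2)[OF less.prems, of i] by (simp add: p_def)
    have EAE: "E ** A ** E = p *\<^sub>R E"
    proof -
      have "A $ i $ i = p *\<^sub>R 1"
        using psd_diag(1)[OF less.prems, of i] by (simp add: p_def scaleR_conv_of_real)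
      then show ?thesis
        unfolding E_def matrix_unit_sandwich by (simp add: matrix_unit_def vec_eq_iff)
    qed
    \<comment> \<open>Elimination with pivot \<open>p\<close>: by \<open>EAE\<close>, the congruence
      by \<open>C\<close> yields exactly \<open>A'\<close>.\<close>
    define C where "C = mat 1 - (1/p) *\<^sub>R (E ** A)"
    define A' where "A' = A - (1/p) *\<^sub>R (A ** E ** A)"
    have EC: "ctrans E = E" by (simp add: E_def ctrans_matrix_unit)
    have "A ** E ** A ** E ** A = p *\<^sub>R (A ** E ** A)"
    proof -
      have "A ** E ** A ** E ** A = A ** (E ** A ** E) ** A" by (simp add: matrix_mul_assoc)
      then show ?thesis
        by (simp add: EAE matrix_mult.scaleR_left matrix_mult.scaleR_right)
    qed
    then have "ctrans C ** A ** C = A'"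
      using p by (simp add: C_def A'_def ctrans_simps herm EC matrix_mult.diff_left
          matrix_mult.diff_right matrix_mult.scaleR_left matrix_mult.scaleR_right matrix_mul_assoc)
    then have psd': "psd A'" using psd_congruence[OF less.prems, of C] by simp
    have EA': "E ** A' = 0"
      using p EAE by (simp add: A'_def matrix_mult.diff_right matrix_mult.scaleR_right
          matrix_mult.scaleR_left matrix_mul_assoc)
    have row_i: "A' $ i = 0"
    proof -
      have "(E ** A') $ i = A' $ i" by (simp add: E_def matrix_unit_mult vec_eq_iff)
      then show ?thesis using EA' by simp
    qed
    \<comment> \<open>Rows that vanish in \<open>A\<close> vanish in \<open>A ** X\<close> for every
      \<open>X\<close>, so elimination creates no new nonzero row and the induction measure
      drops.\<close>
    have row: "A' $ j = 0" if "A $ j = 0" for j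
    proof -
      have "(A ** X) $ j = 0" for X :: "complex^'n^'n"
        using that by (simp add: matrix_matrix_mult_def vec_eq_iff)
      from this[of "E ** A"] show ?thesis using that by (simp add: A'_def matrix_mul_assoc)
    qed
    have "{j. A' $ j \<noteq> 0} \<subset> {j. A $ j \<noteq> 0}" using row_i row i by auto
    then have "card {j. A' $ j \<noteq> 0} < card {j. A $ j \<noteq> 0}" by (simp add: psubset_card_mono)
    from less.hyps[OF this psd'] have ge: "0 \<le> Re (trace (A' ** B))" .
    \<comment> \<open>The part removed from \<open>A\<close> contributes a diagonal entry of the
      semidefinite matrix \<open>A^H B A\<close>.\<close>
    have "trace (A ** E ** A ** B) = trace (E ** (ctrans A ** B ** A))"
      using trace_mul_sym[of A "E ** A ** B"] by (simp add: herm matrix_mul_assoc)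
    also have "\<dots> = (ctrans A ** B ** A) $ i $ i"
      unfolding E_def by (rule trace_matrix_unit_mult)
    finally have "0 \<le> Re (trace (A ** E ** A ** B))"
      using psd_diag(2)[OF psd_congruence[OF assms(2), of A], of i] by simp
    moreover have "Re (trace (A ** B)) = Re (trace (A' ** B)) + Re (trace (A ** E ** A ** B)) / p"
    proof -
      have "A ** B = A' ** B + (1/p) *\<^sub>R (A ** E ** A ** B)"
        by (simp add: A'_def matrix_mult.diff_left matrix_mult.scaleR_left)
      then show ?thesis by (simp add: trace_def sum.distrib sum_divide_distrib)
    qed
    ultimately show ?thesis using ge p by simp
  qed
qed

text \<open>By cyclicity this is the trace of the product of the semidefinite matrices
  \<open>P\<close> and \<open>X^H P X\<close>.\<close>

lemma hpd_form_nonneg: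
  assumes "P \<in> hpd_mats" "ctrans X = X"
  shows "0 \<le> X \<bullet> (P ** X ** P)"
proof -
  have "X \<bullet> (P ** X ** P) = Re (trace (P ** (ctrans X ** P ** X)))"
    using trace_mul_sym[of "X ** P ** X" P] assms(2) by (simp add: inner_matrix matrix_mul_assoc)
  then show ?thesis
    using psd_trace_mult[OF hpd_psd[OF assms(1)] psd_congruence[OF hpd_psd[OF assms(1)]]] by simp
qed

lemma hpd_form_sym:
  assumes "ctrans P = P"
  shows "X \<bullet> (P ** Y ** P) = Y \<bullet> (P ** X ** P)"
proof -
  have "(P ** X ** P) \<bullet> Y = (P ** X) \<bullet> (Y ** ctrans P)" by (rule inner_mult_left')
  also have "\<dots> = X \<bullet> (ctrans P ** (Y ** ctrans P))" by (rule inner_mult_left)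
  finally show ?thesis by (simp add: assms inner_commute matrix_mul_assoc)
qed

lemma hpd_form_pos:
  assumes "P \<in> hpd_mats" "ctrans X = X" "X \<noteq> 0"
  shows "0 < X \<bullet> (P ** X ** P)"
proof (rule ccontr)
  assume "\<not> ?thesis"
  with hpd_form_nonneg[OF assms(1,2)] have z: "X \<bullet> (P ** X ** P) = 0" by simp
  have herm: "ctrans P = P" using assms(1) by (simp add: hpd_iff)
  \<comment> \<open>Testing the null vector \<open>X\<close> against this matrix gives its own
    squared norm, so it vanishes; \<open>P\<close> being invertible, \<open>X\<close> vanishes
    too.\<close>
  let ?Y = "P ** X ** P"
  have "X \<bullet> (P ** ?Y ** P) = 0"
  proof (rule form_zero_imp_zero_inner[where B = "\<lambda>X Y. X \<bullet> (P ** Y ** P)"])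
    show "0 \<le> (X + s *\<^sub>R ?Y) \<bullet> (P ** (X + s *\<^sub>R ?Y) ** P)" for s
      by (rule hpd_form_nonneg[OF assms(1)])
        (simp add: ctrans_simps assms(2) herm matrix_mul_assoc)
    show "(X + s *\<^sub>R ?Y) \<bullet> (P ** (X + s *\<^sub>R ?Y) ** P)
        = X \<bullet> (P ** X ** P) + 2 * s * (X \<bullet> (P ** ?Y ** P)) + s * s * (?Y \<bullet> (P ** ?Y ** P))" for s
      using hpd_form_sym[OF herm, of ?Y X]
      by (simp add: matrix_mult.add_left matrix_mult.add_right matrix_mult.scaleR_left
          matrix_mult.scaleR_right inner_simps algebra_simps)
  qed fact
  then have "?Y \<bullet> ?Y = 0" using hpd_form_sym[OF herm, of X ?Y] by simp
  then have Y: "P ** X ** P = 0" by simp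
  note i = matrix_inv_works[OF hpd_invertible[OF assms(1)]]
  have "X = matrix_inv P ** (P ** X ** P) ** matrix_inv P"
    by (metis i(1) i(2) matrix_mul_assoc matrix_mul_lid matrix_mul_rid)
  then show False using assms(3) unfolding Y by simp
qed

subsection \<open>Orthogonal projection for a form that is positive definite on a subspace\<close>

text \<open>Gram-Schmidt for a form whose symmetry and positivity are available on \<open>T\<close>
  only, as for the metric on a tangent space. Each new vector \<open>b\<close> is first made
  orthogonal to the span of the earlier ones.\<close>

lemma exists_orthogonal_projection:
  fixes g :: "'a::euclidean_space \<Rightarrow> 'a \<Rightarrow> real"
  assumes T: "subspace T" and V: "V \<subseteq> T" "subspace V"
    and lin: "\<And>v w. v \<in> T \<Longrightarrow> w \<in> T \<Longrightarrow> g v w = g w v"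
      "\<And>u v w. u \<in> T \<Longrightarrow> v \<in> T \<Longrightarrow> w \<in> T \<Longrightarrow> g (u + v) w = g u w + g v w"
      "\<And>r v w. v \<in> T \<Longrightarrow> w \<in> T \<Longrightarrow> g (r *\<^sub>R v) w = r * g v w"
    and pos: "\<And>v. v \<in> T \<Longrightarrow> v \<noteq> 0 \<Longrightarrow> 0 < g v v"
    and x: "x \<in> T"
  shows "\<exists>v\<in>V. \<forall>w\<in>V. g (x - v) w = 0"
proof -
  have diff: "g (u - v) w = g u w - g v w" if "u \<in> T" "v \<in> T" "w \<in> T" for u v w
    using lin(2)[of u "- 1 *\<^sub>R v" w] lin(3)[of v w "-1"] that T
    by (simp add: subspace_neg)
  have span: "\<exists>v\<in>span B. \<forall>w\<in>span B. g (x - v) w = 0"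
    if "finite B" "B \<subseteq> T" "x \<in> T" for B x
    using that
  proof (induction B arbitrary: x rule: finite_induct)
    case empty
    have "g y 0 = 0" if "y \<in> T" for y
      using lin(3)[of 0 y 0] lin(1)[of y 0] that T by (simp add: subspace_0)
    then show ?case using empty by auto
  next
    case (insert b B)
    have BT: "span B \<subseteq> T" using insert.prems span_minimal[OF _ T] by blast
    obtain v where v: "v \<in> span B" "\<And>w. w \<in> span B \<Longrightarrow> g (b - v) w = 0"
      using insert.IH[of b] insert.prems by auto
    obtain u where u: "u \<in> span B" "\<And>w. w \<in> span B \<Longrightarrow> g (x - u) w = 0"
      using insert.IH[of x] insert.prems by auto
    define b' where "b' = b - v"
    have T': "b' \<in> T" "u \<in> T" "v \<in> T" "x \<in> T" "b \<in> T"
      using BT v(1) u(1) insert.prems T by (auto simp: b'_def subspace_diff)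
    define r where "r = g (x - u) b' / g b' b'"
    have b': "b' \<in> span (insert b B)" unfolding b'_def
      by (metis v(1) insertI1 span_base span_diff span_mono subset_insertI subsetD)
    have u': "u \<in> span (insert b B)" using u(1) span_mono[of B "insert b B"] by blast
    have "g (x - (u + r *\<^sub>R b')) w = 0" if "w \<in> span (insert b B)" for w
    proof -
      from that obtain k where "w - k *\<^sub>R b \<in> span B"
        unfolding span_breakdown_eq by blast
      then have wk: "w - k *\<^sub>R b + k *\<^sub>R v \<in> span B" using v(1) by (simp add: span_add span_scale)
      define z where "z = w - k *\<^sub>R b + k *\<^sub>R v"
      have z: "z \<in> span B" "z \<in> T" using wk BT by (auto simp: z_def)
      have w: "w = z + k *\<^sub>R b'" by (simp add: z_def b'_def algebra_simps)
      have xu: "x - u \<in> T" using T' T by (simp add: subspace_diff)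
      have 1: "g (x - u) w = k * g (x - u) b'"
        using lin(1)[of "x - u" w] lin(2)[of z "k *\<^sub>R b'" "x - u"] lin(3)[of b' "x - u" k]
          lin(1)[of z "x - u"] lin(1)[of b' "x - u"] u(2)[OF z(1)] T' z xu T
        by (simp add: w subspace_add subspace_scale)
      have 2: "g b' w = k * g b' b'"
        using lin(1)[of b' w] lin(2)[of z "k *\<^sub>R b'" b'] lin(3)[of b' b' k]
          lin(1)[of z b'] v(2)[OF z(1)] T' z T
        by (simp add: w subspace_add subspace_scale flip: b'_def)
      have wT: "w \<in> T" using w z T' T by (simp add: subspace_add subspace_scale)
      have "g (x - (u + r *\<^sub>R b')) w = g (x - u) w - r * g b' w"
        using diff[OF xu _ wT, of "r *\<^sub>R b'"] lin(3)[OF T'(1) wT, of r] T' T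
        by (simp add: diff_diff_eq subspace_scale)
      also have "\<dots> = k * (g (x - u) b' - r * g b' b')" by (simp add: 1 2 algebra_simps)
      also have "\<dots> = 0"
      \<comment> \<open>If \<open>b\<close> already lies in the span of \<open>B\<close>, then
        \<open>b' = 0\<close> and the quotient \<open>r\<close> is a division by 0; both terms
        vanish then.\<close>
      proof (cases "b' = 0")
        case True
        have "g (x - u) 0 = 0"
          using lin(3)[of 0 "x - u" 0] lin(1)[of "x - u" 0] xu T by (simp add: subspace_0)
        moreover have "g 0 0 = 0" using lin(3)[of 0 0 0] T by (simp add: subspace_0)
        ultimately show ?thesis by (simp add: True)
      next
        case False
        then have "g b' b' \<noteq> 0" using pos[OF T'(1)] by simp
        then show ?thesis by (simp add: r_def)
      qed
      finally show ?thesis .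
    qed
    moreover have "u + r *\<^sub>R b' \<in> span (insert b B)" using u' b' by (simp add: span_add span_scale)
    ultimately show ?case by blast
  qed
  obtain B where "B \<subseteq> V" "finite B" "V = span B"
    using basis_subspace_exists[OF V(2)] by metis
  then show ?thesis using span[of B x] V(1) x by auto
qed

subsection \<open>Tangent spaces and the metric\<close>

lemma MbarD:
  assumes "x \<in> Mbar"
  shows "ctrans (fst x) ** fst x = mat 1" "snd x \<in> hpd_mats" "ctrans (snd x) = snd x"
    "ctrans (matrix_inv (snd x)) = matrix_inv (snd x)"
    "snd x ** matrix_inv (snd x) = mat 1" "matrix_inv (snd x) ** snd x = mat 1"
proof -
  show 1: "ctrans (fst x) ** fst x = mat 1" "snd x \<in> hpd_mats"
    using assms by (auto simp: Mbar_def stiefel_def mem_Times_iff)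
  show "ctrans (snd x) = snd x" using 1 by (simp add: hpd_iff)
  show "ctrans (matrix_inv (snd x)) = matrix_inv (snd x)" by (rule hpd_inverse(2)[OF 1(2)])
  show "snd x ** matrix_inv (snd x) = mat 1" "matrix_inv (snd x) ** snd x = mat 1"
    using matrix_inv_works[OF hpd_invertible[OF 1(2)]] by auto
qed

lemma Mbar_tanD:
  assumes "\<xi> \<in> Mbar_tan x"
  shows "ctrans (snd \<xi>) = snd \<xi>" "ctrans (fst x) ** fst \<xi> = - (ctrans (fst \<xi>) ** fst x)"
    "ctrans (ctrans (fst x) ** fst \<xi>) = - (ctrans (fst x) ** fst \<xi>)"
  using assms by (auto simp: Mbar_tan_def hermitian_mats_def eq_neg_iff_add_eq_0 ctrans_simps add.commute)

lemma subspace_Mbar_tan: "subspace (Mbar_tan x)"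
proof (rule subspaceI)
  show "0 \<in> Mbar_tan x" by (simp add: Mbar_tan_def hermitian_mats_def)
next
  fix \<xi> \<eta> assume "\<xi> \<in> Mbar_tan x" "\<eta> \<in> Mbar_tan x"
  note d = Mbar_tanD[OF this(1)] Mbar_tanD[OF this(2)]
  show "\<xi> + \<eta> \<in> Mbar_tan x"
    by (simp add: Mbar_tan_def hermitian_mats_def ctrans_simps d matrix_mult.add_left matrix_mult.add_right)
next
  fix r \<xi> assume "\<xi> \<in> Mbar_tan x"
  note d = Mbar_tanD[OF this]
  show "r *\<^sub>R \<xi> \<in> Mbar_tan x"
    by (simp add: Mbar_tan_def hermitian_mats_def ctrans_simps d matrix_mult.scaleR_left matrix_mult.scaleR_right)
qed

lemmas Mbar_tan_add = subspace_add[OF subspace_Mbar_tan]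
  and Mbar_tan_diff = subspace_diff[OF subspace_Mbar_tan]
  and Mbar_tan_scale = subspace_scale[OF subspace_Mbar_tan]

text \<open>Asking only for a Hermitian second component of \<xi> lets this apply to derivatives of
  fields, which in general are not tangent.\<close>

lemma Mbar_metric_eq:
  assumes "x \<in> Mbar" "ctrans (snd \<xi>) = snd \<xi>"
  shows "Mbar_metric \<alpha> \<beta> x \<xi> \<eta> =
    fst \<xi> \<bullet> fst \<eta> - (ctrans (fst x) ** fst \<xi>) \<bullet> (ctrans (fst x) ** fst \<eta>) / 2
    + \<alpha> * ((matrix_inv (snd x) ** snd \<xi> ** matrix_inv (snd x)) \<bullet> snd \<eta>)
    + \<beta> * (matrix_inv (snd x) \<bullet> snd \<xi>) * (matrix_inv (snd x) \<bullet> snd \<eta>)"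
proof -
  have "Re (trace (ctrans (fst \<xi>) ** (mat 1 - (1/2) *\<^sub>R (fst x ** ctrans (fst x))) ** fst \<eta>))
    = fst \<xi> \<bullet> fst \<eta> - (ctrans (fst x) ** fst \<xi>) \<bullet> (ctrans (fst x) ** fst \<eta>) / 2"
  proof -
    have "Re (trace (ctrans (fst \<xi>) ** (mat 1 - (1/2) *\<^sub>R (fst x ** ctrans (fst x))) ** fst \<eta>))
      = fst \<xi> \<bullet> (fst \<eta> - (1/2) *\<^sub>R (fst x ** (ctrans (fst x) ** fst \<eta>)))"
      unfolding inner_matrix by (simp add: matrix_mult_simps)
    then show ?thesis by (simp add: inner_diff_right inner_mult_left[of "ctrans (fst x)"])
  qed
  then show ?thesis
    unfolding Mbar_metric_def Let_def Re_trace_mult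
    by (simp add: ctrans_simps MbarD[OF assms(1)] assms(2) matrix_mul_assoc)
qed

lemma Mbar_metric_sym:
  assumes "x \<in> Mbar" "\<xi> \<in> Mbar_tan x" "\<eta> \<in> Mbar_tan x"
  shows "Mbar_metric \<alpha> \<beta> x \<xi> \<eta> = Mbar_metric \<alpha> \<beta> x \<eta> \<xi>"
  using hpd_form_sym[OF MbarD(4)[OF assms(1)], of "snd \<xi>" "snd \<eta>"]
  by (simp add: Mbar_metric_eq[OF assms(1)] Mbar_tanD[OF assms(2)] Mbar_tanD[OF assms(3)] inner_commute)

lemma Mbar_metric_add_left:
  "Mbar_metric \<alpha> \<beta> x (\<xi> + \<xi>') \<eta> = Mbar_metric \<alpha> \<beta> x \<xi> \<eta> + Mbar_metric \<alpha> \<beta> x \<xi>' \<eta>"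
  by (simp add: Mbar_metric_def Let_def ctrans_simps matrix_mult.add_left matrix_mult.add_right
      trace_add algebra_simps)

lemma trace_scaleR: "trace (r *\<^sub>R A :: complex^'n^'n) = r *\<^sub>R trace A"
  by (simp add: trace_def scaleR_sum_right)

lemma Mbar_metric_scaleR_left:
  "Mbar_metric \<alpha> \<beta> x (r *\<^sub>R \<xi>) \<eta> = r * Mbar_metric \<alpha> \<beta> x \<xi> \<eta>"
  by (simp add: Mbar_metric_def Let_def ctrans_simps matrix_mult.scaleR_left matrix_mult.scaleR_right
      trace_scaleR algebra_simps)

lemma Mbar_metric_diff_left:
  "Mbar_metric \<alpha> \<beta> x (\<xi> - \<xi>') \<eta> = Mbar_metric \<alpha> \<beta> x \<xi> \<eta> - Mbar_metric \<alpha> \<beta> x \<xi>' \<eta>"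
  using Mbar_metric_add_left[of \<alpha> \<beta> x \<xi> "- 1 *\<^sub>R \<xi>'" \<eta>] Mbar_metric_scaleR_left[of \<alpha> \<beta> x "-1" \<xi>' \<eta>]
  by simp

lemma inner_mat_1: "(mat 1 :: complex^'n^'n) \<bullet> mat 1 = real CARD('n)"
  by (simp add: inner_matrix trace_I)

text \<open>Cauchy-Schwarz against the second component itself bounds the squared trace.\<close>

lemma Mbar_metric_pos:
  fixes x :: "('p::finite, 'k::finite) amb"
  assumes "\<alpha> > 0" "\<beta> > - \<alpha> / real CARD('k)" "x \<in> Mbar" "\<xi> \<in> Mbar_tan x" "\<xi> \<noteq> 0"
  shows "0 < Mbar_metric \<alpha> \<beta> x \<xi> \<xi>"
proof -
  note d = MbarD[OF assms(3)] and t = Mbar_tanD[OF assms(4)]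
  define U S P X Z where "U = fst x" and "S = snd x" and "P = matrix_inv S" and "X = fst \<xi>" and "Z = snd \<xi>"
  define q where "q = (P ** Z ** P) \<bullet> Z"
  define t where "t = P \<bullet> Z"
  define k where "k = real CARD('k)"
  have k: "k > 0" by (simp add: k_def)
  have P: "P \<in> hpd_mats" "ctrans P = P" "P ** S = mat 1" "S ** P = mat 1" and Z: "ctrans Z = Z"
    using hpd_inverse(1)[OF d(2)] d t by (auto simp: P_def S_def Z_def)
  have q: "0 \<le> q" "Z \<noteq> 0 \<Longrightarrow> 0 < q"
    using hpd_form_nonneg[OF P(1) Z] hpd_form_pos[OF P(1) Z] by (auto simp: q_def inner_commute)
  have "t\<^sup>2 \<le> k * q"
  proof -
    \<comment> \<open>Here \<open>S\<close> has squared length \<open>k\<close> and product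
      \<open>t\<close> with \<open>Z\<close>, so \<open>(t/k) S\<close> is the projection of
      \<open>Z\<close> to the line of \<open>S\<close>.\<close>
    have "0 \<le> (Z - (t/k) *\<^sub>R S) \<bullet> (P ** (Z - (t/k) *\<^sub>R S) ** P)"
      by (rule hpd_form_nonneg[OF P(1)]) (simp add: ctrans_simps Z d(3) S_def)
    also have "P ** (Z - (t/k) *\<^sub>R S) ** P = P ** Z ** P - (t/k) *\<^sub>R P"
      by (simp add: matrix_mult.diff_left matrix_mult.diff_right matrix_mult.scaleR_left
          matrix_mult.scaleR_right P)
    also have "(Z - (t/k) *\<^sub>R S) \<bullet> (P ** Z ** P - (t/k) *\<^sub>R P)
        = q - (t/k) * t - (t/k) * (S \<bullet> (P ** Z ** P)) + (t/k) * (t/k) * (S \<bullet> P)"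
      by (simp add: inner_diff_left inner_diff_right q_def t_def inner_commute algebra_simps)
    also have "S \<bullet> (P ** Z ** P) = t"
      using hpd_form_sym[OF P(2), of S Z] by (simp add: P t_def inner_commute)
    also have "S \<bullet> P = k"
      using inner_mat_1[where 'n = 'k] inner_mult_left[of P S "mat 1"] P by (simp add: k_def)
    finally show ?thesis using k by (simp add: field_simps power2_eq_square)
  qed
  have "0 \<le> \<alpha> * q + \<beta> * t\<^sup>2 \<and> (Z \<noteq> 0 \<longrightarrow> 0 < \<alpha> * q + \<beta> * t\<^sup>2)"
  proof (cases "\<beta> \<ge> 0")
    case True
    then show ?thesis using q assms(1) by (auto intro: add_nonneg_nonneg add_pos_nonneg)
  next
    \<comment> \<open>For negative \<beta> the trace term is bounded by
      \<open>t^2 \<le> k q\<close>; what remains is positive exactly because \<alpha> + k \<beta> >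
      0.\<close>
    case False
    have ab: "\<alpha> + \<beta> * k > 0" using assms(2) k by (simp add: field_simps k_def)
    have "\<beta> * t\<^sup>2 \<ge> \<beta> * (k * q)" using \<open>t\<^sup>2 \<le> k * q\<close> False by (simp add: mult_left_mono_neg)
    then have "\<alpha> * q + \<beta> * t\<^sup>2 \<ge> (\<alpha> + \<beta> * k) * q" by (simp add: algebra_simps)
    moreover have "(\<alpha> + \<beta> * k) * q \<ge> 0" "Z \<noteq> 0 \<Longrightarrow> (\<alpha> + \<beta> * k) * q > 0" using ab q by auto
    ultimately show ?thesis by auto
  qed
  \<comment> \<open>\<open>N\<close> is the component of \<open>X\<close> normal to the range of
    \<open>U\<close>. The factor 1/2 in the metric halves the remaining component, which keeps the
    form positive.\<close>
  moreover define N where "N = X - U ** (ctrans U ** X)"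
  have "X \<bullet> X = N \<bullet> N + (ctrans U ** X) \<bullet> (ctrans U ** X)"
  proof -
    have U: "ctrans U ** U = mat 1" using d by (simp add: U_def)
    have "(U ** (ctrans U ** X)) \<bullet> (U ** (ctrans U ** X)) = (ctrans U ** X) \<bullet> (ctrans U ** X)"
      unfolding inner_mult_left[of U] by (simp add: U matrix_mul_assoc)
    moreover have "X \<bullet> (U ** (ctrans U ** X)) = (ctrans U ** X) \<bullet> (ctrans U ** X)"
      by (simp add: inner_mult_left[of "ctrans U"])
    ultimately show ?thesis by (simp add: N_def inner_diff_left inner_diff_right inner_commute)
  qed
  then have "X \<bullet> X - (ctrans U ** X) \<bullet> (ctrans U ** X) / 2
      = N \<bullet> N + (ctrans U ** X) \<bullet> (ctrans U ** X) / 2" by simp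
  moreover have "N \<noteq> 0 \<or> ctrans U ** X \<noteq> 0 \<or> Z \<noteq> 0"
    using assms(5) by (auto simp: N_def X_def Z_def prod_eq_iff)
  then have "0 < N \<bullet> N \<or> 0 < (ctrans U ** X) \<bullet> (ctrans U ** X) \<or> Z \<noteq> 0" by simp
  moreover have "Mbar_metric \<alpha> \<beta> x \<xi> \<xi> = X \<bullet> X - (ctrans U ** X) \<bullet> (ctrans U ** X) / 2 + (\<alpha> * q + \<beta> * t\<^sup>2)"
    using Mbar_metric_eq[OF assms(3), of \<xi> \<alpha> \<beta> \<xi>] Z
    by (simp add: U_def X_def q_def t_def P_def S_def Z_def power2_eq_square)
  ultimately show ?thesis
    using inner_ge_zero[of N] inner_ge_zero[of "ctrans U ** X"] by (auto simp: add_pos_nonneg add_nonneg_pos)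
qed

lemma Mbar_projection:
  fixes x :: "('p::finite, 'k::finite) amb"
  assumes "\<alpha> > 0" "\<beta> > - \<alpha> / real CARD('k)" "x \<in> Mbar" "\<xi> \<in> Mbar_tan x"
    "V \<subseteq> Mbar_tan x" "subspace V"
  shows "\<exists>v\<in>V. \<forall>w\<in>V. Mbar_metric \<alpha> \<beta> x (\<xi> - v) w = 0"
  by (rule exists_orthogonal_projection[OF subspace_Mbar_tan assms(5,6)])
    (simp_all add: Mbar_metric_sym[OF assms(3)] Mbar_metric_add_left Mbar_metric_scaleR_left
      Mbar_metric_pos[OF assms(1-3)] assms(4))

text \<open>Nondegeneracy on a subspace; it serves both for the whole tangent space and for the
  horizontal space.\<close>

lemma Mbar_metric_eqI:
  fixes x :: "('p::finite, 'k::finite) amb"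
  assumes "\<alpha> > 0" "\<beta> > - \<alpha> / real CARD('k)" "x \<in> Mbar" "v \<in> V" "w \<in> V"
    "V \<subseteq> Mbar_tan x" "subspace V"
    "\<And>\<zeta>. \<zeta> \<in> V \<Longrightarrow> Mbar_metric \<alpha> \<beta> x v \<zeta> = Mbar_metric \<alpha> \<beta> x w \<zeta>"
  shows "v = w"
proof (rule ccontr)
  assume "v \<noteq> w"
  moreover have "v - w \<in> V" using assms(4,5,7) by (simp add: subspace_diff)
  moreover from this assms(8)[of "v - w"] have "Mbar_metric \<alpha> \<beta> x (v - w) (v - w) = 0"
    by (simp add: Mbar_metric_diff_left)
  ultimately show False using Mbar_metric_pos[OF assms(1-3), of "v - w"] assms(6) by force
qed

subsection \<open>Curves and derivatives\<close>

text \<open>The Cayley transform \<open>(1 - tA/2)^-1 (1 + tA/2)\<close> is unitary for all real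
  \<open>t\<close> and has velocity \<open>A\<close> at 0.\<close>

lemma cayley_curve:
  fixes A :: "complex^'n^'n"
  assumes "ctrans A = - A"
  obtains Q where "\<And>t. Q t \<in> unitary_mats" "Q 0 = mat 1" "(Q has_vector_derivative A) (at 0)"
proof -
  define M where "M t = mat 1 - (t/2) *\<^sub>R A" for t :: real
  define N where "N t = mat 1 + (t/2) *\<^sub>R A" for t :: real
  have MN: "ctrans (M t) = N t" "ctrans (N t) = M t" "M t ** N t = N t ** M t" for t
  proof -
    show "ctrans (M t) = N t" "ctrans (N t) = M t" by (simp_all add: M_def N_def ctrans_simps assms)
    have "(mat 1 - B) ** (mat 1 + B) = (mat 1 + B) ** (mat 1 - B)" for B :: "complex^'n^'n"
      by (simp add: matrix_mult.diff_left matrix_mult.diff_right matrix_mult.add_left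
          matrix_mult.add_right)
    then show "M t ** N t = N t ** M t" unfolding M_def N_def .
  qed
  \<comment> \<open>A skew-Hermitian matrix has zero real quadratic form, so a kernel vector
    \<open>v = (t/2) A v\<close> satisfies \<open>v \<bullet> v = 0\<close>.\<close>
  have inv: "invertible (M t)" for t
    unfolding invertible_iff_kernel
  proof (intro allI impI)
    fix v assume "M t *v v = 0"
    then have v: "v = ((t/2) *\<^sub>R A) *v v" by (simp add: M_def matrix_vector_mult_diff_rdistrib)
    have "v \<bullet> (((t/2) *\<^sub>R A) *v v) = (ctrans ((t/2) *\<^sub>R A) *v v) \<bullet> v"
      by (rule inner_matrix_vector)
    also have "ctrans ((t/2) *\<^sub>R A) *v v = - (((t/2) *\<^sub>R A) *v v)"
      by (simp add: ctrans_simps assms matrix_vector_mult_def vec_eq_iff sum_negf)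
    finally have "v \<bullet> v = - (v \<bullet> v)" by (simp flip: v)
    then show "v = 0" by simp
  qed
  define Q where "Q t = matrix_inv (M t) ** N t" for t
  have "Q t \<in> unitary_mats" for t
  proof -
    let ?I = "matrix_inv (M t)" and ?J = "ctrans (matrix_inv (M t))"
    note i = matrix_inv_works[OF inv, of t]
    have J: "?J ** N t = mat 1" "N t ** ?J = mat 1"
      using arg_cong[OF i(1), of ctrans] arg_cong[OF i(2), of ctrans] by (simp_all add: ctrans_simps MN)
    \<comment> \<open>\<open>?J\<close> is the inverse of \<open>N t\<close> and therefore commutes
      with \<open>M t\<close>, as \<open>N t\<close> does.\<close>
    have "?J ** M t = ?J ** (M t ** N t) ** ?J" by (simp add: J flip: matrix_mul_assoc)
    also have "\<dots> = M t ** ?J" by (simp add: MN(3) J matrix_mul_assoc)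
    finally have c: "?J ** M t = M t ** ?J" .
    have "ctrans (Q t) ** Q t = (M t ** ?J) ** ?I ** N t"
      by (simp add: Q_def ctrans_simps MN matrix_mul_assoc)
    also have "\<dots> = ?J ** (M t ** ?I) ** N t" unfolding c[symmetric] by (simp add: matrix_mul_assoc)
    also have "\<dots> = mat 1" by (simp add: i J)
    finally have 1: "ctrans (Q t) ** Q t = mat 1" .
    then show ?thesis by (simp add: unitary_mats_def matrix_left_right_inverse[of "ctrans (Q t)"])
  qed
  moreover have I0: "matrix_inv (mat 1 :: complex^'n^'n) = mat 1" by (simp add: matrix_inv_unique'(2))
  then have "Q 0 = mat 1" by (simp add: Q_def M_def N_def)
  moreover have "(Q has_vector_derivative A) (at 0)"
  proof -
    have M': "(M has_derivative (\<lambda>t. - (t/2) *\<^sub>R A)) (at 0)" and N': "(N has_derivative (\<lambda>t. (t/2) *\<^sub>R A)) (at 0)"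
      unfolding M_def N_def by (auto intro!: derivative_eq_intros)
    have "((\<lambda>t. matrix_inv (M t)) has_derivative (\<lambda>t. (t/2) *\<^sub>R A)) (at 0)"
      using has_derivative_compose[OF M' has_derivative_matrix_inv[OF inv]]
      by (simp add: M_def I0 matrix_mult.scaleR_left matrix_mult.scaleR_right)
    from matrix_mult.FDERIV[OF this N']
    have "(Q has_derivative (\<lambda>t. matrix_inv (M 0) ** ((t/2) *\<^sub>R A) + ((t/2) *\<^sub>R A) ** N 0)) (at 0)"
      unfolding Q_def[abs_def] .
    moreover have "matrix_inv (M 0) ** ((t/2) *\<^sub>R A) + ((t/2) *\<^sub>R A) ** N 0 = t *\<^sub>R A" for t
      using scaleR_add_left[of "t/2" "t/2" A] by (simp add: M_def N_def I0 del: scaleR_add_left)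
    ultimately show ?thesis by (simp add: has_vector_derivative_def)
  qed
  ultimately show ?thesis by (rule that)
qed

lemma unitary_mult_left:
  assumes "Q \<in> unitary_mats"
  shows "ctrans Q ** (Q ** A) = A" "Q ** (ctrans Q ** A) = A"
  using assms by (simp_all add: unitary_mats_def matrix_mul_assoc)

text \<open>The first component is moved by unitary matrices acting from the left, the second by
  congruences. Congruence stays positive definite only while \<open>R t\<close> is invertible, so
  membership holds near 0.\<close>

lemma Mbar_curve:
  fixes x :: "('p::finite, 'k::finite) amb"
  assumes x: "x \<in> Mbar" and \<xi>: "\<xi> \<in> Mbar_tan x"
  obtains c where "c 0 = x" "\<forall>\<^sub>F t in nhds 0. c t \<in> Mbar" "(c has_vector_derivative \<xi>) (at 0)"
proof -
  note d = MbarD[OF x] and t = Mbar_tanD[OF \<xi>]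
  define U S X Z where "U = fst x" and "S = snd x" and "X = fst \<xi>" and "Z = snd \<xi>"
  note d' = d[folded U_def S_def] and t' = t[folded U_def X_def Z_def]
  \<comment> \<open>A skew-Hermitian matrix with \<open>W U = X\<close>: the last summand cancels
    \<open>U X^H U\<close>, and its own skewness partner comes from tangency of
    \<open>X\<close>.\<close>
  define W where "W = X ** ctrans U - U ** ctrans X + U ** ctrans X ** U ** ctrans U"
  have "ctrans W = - W"
  proof -
    have "U ** ctrans U ** X ** ctrans U = - (U ** ctrans X ** U ** ctrans U)"
      using arg_cong[OF t'(2), of "\<lambda>A. U ** A ** ctrans U"]
      by (simp add: matrix_mul_assoc matrix_mult.minus_left matrix_mult.minus_right)
    then show ?thesis by (simp add: W_def ctrans_simps matrix_mul_assoc)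
  qed
  then obtain Q where Q: "\<And>t. Q t \<in> unitary_mats" "Q 0 = mat 1" "(Q has_vector_derivative W) (at 0)"
    by (rule cayley_curve) (rule that)
  have WU: "W ** U = X"
    using d'(1) by (simp add: W_def matrix_mult.diff_left matrix_mult.add_left flip: matrix_mul_assoc)
  \<comment> \<open>Chosen so that \<open>S B\<close> and \<open>B^H S\<close> are both half of
    \<open>Z\<close>, whence the congruence has velocity \<open>Z\<close>.\<close>
  define B where "B = (1/2) *\<^sub>R (matrix_inv S ** Z)"
  define R where "R t = mat 1 + t *\<^sub>R B" for t :: real
  define c where "c t = (Q t ** U, ctrans (R t) ** S ** R t)" for t
  have R': "(R has_derivative (\<lambda>t. t *\<^sub>R B)) (at 0)"
    unfolding R_def by (auto intro!: derivative_eq_intros)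
  have "open (R -` {A. invertible A})"
    by (rule open_vimage[OF open_invertible]) (auto simp: R_def intro!: continuous_intros)
  moreover have "0 \<in> R -` {A. invertible A}"
    by (simp add: R_def matrix_inv_unique'(1)[of _ "mat 1"])
  ultimately have "\<forall>\<^sub>F t in nhds 0. t \<in> R -` {A. invertible A}" by (rule eventually_nhds_in_open)
  then have "\<forall>\<^sub>F t in nhds 0. c t \<in> Mbar"
  proof eventually_elim
    case (elim t)
    have "ctrans (Q t ** U) ** (Q t ** U) = mat 1"
      using unitary_mult_left[OF Q(1), of t U] d'(1)
      by (simp add: ctrans_simps flip: matrix_mul_assoc)
    moreover have "ctrans (R t) ** S ** R t \<in> hpd_mats"
      using hpd_congruence[OF d'(2)] elim by simp
    ultimately show ?case by (simp add: c_def Mbar_def stiefel_def)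
  qed
  moreover have "c 0 = x" by (simp add: c_def Q R_def U_def S_def)
  moreover have "(c has_vector_derivative \<xi>) (at 0)"
  proof -
    have "((\<lambda>t. Q t ** U) has_vector_derivative X) (at 0)"
      using bounded_linear.has_vector_derivative[OF matrix_mult.bounded_linear_left Q(3), of U] WU by simp
    moreover have "((\<lambda>t. ctrans (R t) ** S ** R t) has_vector_derivative Z) (at 0)"
    proof -
      have "((\<lambda>t. ctrans (R t)) has_derivative (\<lambda>t. t *\<^sub>R ctrans B)) (at 0)"
        using bounded_linear.has_derivative[OF bounded_linear_ctrans R'] by (simp add: ctrans_simps)
      from matrix_mult.FDERIV[OF bounded_linear.has_derivative[OF matrix_mult.bounded_linear_left this, of S] R']
      have 1: "((\<lambda>t. ctrans (R t) ** S ** R t) has_derivative (\<lambda>t. t *\<^sub>R (S ** B + ctrans B ** S))) (at 0)"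
        by (simp add: R_def matrix_mult.scaleR_left matrix_mult.scaleR_right scaleR_add_right)
      have "S ** B = (1/2) *\<^sub>R Z" "ctrans B ** S = (1/2) *\<^sub>R Z"
        using d' t'(1) by (simp_all add: B_def ctrans_simps matrix_mult.scaleR_left matrix_mult.scaleR_right
            matrix_mul_assoc) (simp add: d' flip: matrix_mul_assoc)
      then have "S ** B + ctrans B ** S = Z"
        using scaleR_add_left[of "1/2" "1/2" Z] by simp
      with 1 show ?thesis by (simp add: has_vector_derivative_def)
    qed
    ultimately have "(c has_vector_derivative (X, Z)) (at 0)"
      unfolding c_def[abs_def] by (rule has_vector_derivative_Pair)
    then show ?thesis by (simp add: X_def Z_def)
  qed
  ultimately show ?thesis using that[of c] by simp
qed

lemma has_vector_derivative_along_curve: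
  assumes "(u has_derivative D) (at x within M)" "c 0 = x" "\<forall>\<^sub>F t in nhds 0. c t \<in> M"
    "(c has_vector_derivative \<xi>) (at (0::real))"
  shows "((\<lambda>t. u (c t)) has_vector_derivative D \<xi>) (at 0)"
proof -
  obtain T where T: "open T" "0 \<in> T" "\<And>t. t \<in> T \<Longrightarrow> c t \<in> M"
    using assms(3) unfolding eventually_nhds by blast
  have "(u has_derivative D) (at (c 0) within c ` T)"
    using assms(1,2) T(3) by (auto intro: has_derivative_subset)
  with assms(4) have "((u \<circ> c) has_derivative D \<circ> (\<lambda>t. t *\<^sub>R \<xi>)) (at 0 within T)"
    unfolding has_vector_derivative_def
    by (intro diff_chain_within) (auto intro: has_derivative_at_withinI)
  then have "((u \<circ> c) has_derivative D \<circ> (\<lambda>t. t *\<^sub>R \<xi>)) (at 0)"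
    using at_within_open[OF T(2,1)] by simp
  moreover have "D (t *\<^sub>R \<xi>) = t *\<^sub>R D \<xi>" for t
    using has_derivative_linear[OF assms(1)] by (simp add: linear_scale)
  ultimately show ?thesis by (simp add: has_vector_derivative_def comp_def)
qed

text \<open>Two derivatives within \<open>Mbar\<close> may differ on normal vectors. On a tangent
  vector both are the velocity of \<open>u\<close> along one curve in \<open>Mbar\<close>.\<close>

lemma has_derivative_within_Mbar_unique:
  assumes "x \<in> Mbar" "\<xi> \<in> Mbar_tan x"
    "(u has_derivative D) (at x within Mbar)" "(u has_derivative D') (at x within Mbar)"
  shows "D \<xi> = D' \<xi>"
proof -
  obtain c where c: "c 0 = x" "\<forall>\<^sub>F t in nhds 0. c t \<in> Mbar" "(c has_vector_derivative \<xi>) (at 0)"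
    by (rule Mbar_curve[OF assms(1,2)]) (rule that)
  show ?thesis
    using has_vector_derivative_along_curve[OF assms(3) c] has_vector_derivative_along_curve[OF assms(4) c]
    by (rule vector_derivative_unique_at)
qed

lemma Mbar_deriv_eq:
  assumes "x \<in> Mbar" "\<xi> \<in> Mbar_tan x" "(u has_derivative D) (at x within Mbar)"
  shows "Mbar_deriv x \<xi> u = D \<xi>"
  unfolding Mbar_deriv_def
  by (rule has_derivative_within_Mbar_unique[OF assms(1,2) _ assms(3)])
    (use assms(3) in \<open>simp flip: frechet_derivative_works add: differentiable_def, blast\<close>)

lemma Mbar_deriv_cong:
  "x \<in> Mbar \<Longrightarrow> (\<And>y. y \<in> Mbar \<Longrightarrow> u y = v y) \<Longrightarrow> Mbar_deriv x \<xi> u = Mbar_deriv x \<xi> v"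
  unfolding Mbar_deriv_def using frechet_derivative_within_cong[of Mbar u v x] by simp

subsection \<open>Smooth tangent fields\<close>

lemma Mbar_riem_simps [simp]:
  "pts (Mbar_riem \<alpha> \<beta>) = Mbar" "smooth_funs (Mbar_riem \<alpha> \<beta>) = {u. smooth_fun Mbar u}"
  "tan_sp (Mbar_riem \<alpha> \<beta>) = Mbar_tan" "act (Mbar_riem \<alpha> \<beta>) = Mbar_deriv"
  "metric (Mbar_riem \<alpha> \<beta>) = Mbar_metric \<alpha> \<beta>"
  by (simp_all add: Mbar_riem_def)

text \<open>Smoothness is meant as an ambient-valued map, so that a field can be differentiated.
  \<open>vector_fields\<close> speaks only of the action on functions;
  \<open>tangent_field_vector_field\<close> connects the two.\<close>

definition tangent_field :: "(('p::finite, 'k::finite) amb \<Rightarrow> ('p, 'k) amb) \<Rightarrow> bool" where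
  "tangent_field Y \<longleftrightarrow> smooth_fun Mbar Y \<and> (\<forall>x\<in>Mbar. Y x \<in> Mbar_tan x)"

lemma smooth_fun_has_derivative_Mbar:
  assumes "smooth_fun Mbar u" "x \<in> Mbar"
  shows "(u has_derivative frechet_derivative u (at x within Mbar)) (at x within Mbar)"
  using smooth_fun_has_derivative[OF assms] unfolding frechet_derivative_def by (rule someI_ex)

lemma Mbar_deriv_extension:
  assumes "open W" "x \<in> W" "smooth_on W F" "\<And>y. y \<in> W \<Longrightarrow> y \<in> Mbar \<Longrightarrow> F y = u y"
    "x \<in> Mbar" "\<xi> \<in> Mbar_tan x"
  shows "Mbar_deriv x \<xi> u = frechet_derivative F (at x) \<xi>"
  by (rule Mbar_deriv_eq[OF assms(5,6)
        extension_has_derivative_within[OF assms(1,2,5) smooth_on_has_derivative[OF assms(3,2)] assms(4)]])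

lemma smooth_fun_Mbar_deriv:
  fixes Y :: "('p::finite, 'k::finite) amb \<Rightarrow> ('p, 'k) amb"
  assumes "tangent_field Y" "smooth_fun Mbar u"
  shows "smooth_fun Mbar (\<lambda>x. Mbar_deriv x (Y x) u)"
proof (rule smooth_funI)
  fix x :: "('p, 'k) amb" assume x: "x \<in> Mbar"
  obtain W F where W: "open W" "x \<in> W" "smooth_on W F" "\<And>y. y \<in> W \<Longrightarrow> y \<in> Mbar \<Longrightarrow> F y = u y"
    by (rule smooth_funE[OF assms(2) x]) (rule that)
  have "smooth_fun Mbar Y" using assms(1) by (simp add: tangent_field_def)
  then obtain V G where V: "open V" "x \<in> V" "smooth_on V G" "\<And>y. y \<in> V \<Longrightarrow> y \<in> Mbar \<Longrightarrow> G y = Y y"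
    by (rule smooth_funE[OF _ x]) (rule that)
  have "smooth_on (W \<inter> V) (\<lambda>y. frechet_derivative F (at y) (G y))"
    by (rule smooth_on_derivative_along)
      (use W V in \<open>auto intro: smooth_on_subset[of W] smooth_on_subset[of V]\<close>)
  moreover have "frechet_derivative F (at y) (G y) = Mbar_deriv y (Y y) u" if "y \<in> (W \<inter> V) \<inter> Mbar" for y
    using Mbar_deriv_extension[of W y F u "Y y"] W V(4)[of y] that assms(1)
    by (simp add: tangent_field_def)
  ultimately show "\<exists>W F. open W \<and> x \<in> W \<and> smooth_on W F \<and> (\<forall>y\<in>W \<inter> Mbar. F y = Mbar_deriv y (Y y) u)"
    using W(1,2) V(1,2) by (intro exI[of _ "W \<inter> V"] exI[of _ "\<lambda>y. frechet_derivative F (at y) (G y)"]) auto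
qed

lemma tangent_field_vector_field: "tangent_field Y \<Longrightarrow> Y \<in> vector_fields (Mbar_riem \<alpha> \<beta>)"
  by (auto simp: vector_fields_def smooth_fun_Mbar_deriv) (simp add: tangent_field_def)

text \<open>A projection of the fixed vector \<zeta> onto the tangent space at the varying point
  \<open>y\<close>; it extends a tangent vector to a global smooth field.\<close>

definition tan_proj :: "('p::finite, 'k::finite) amb \<Rightarrow> ('p, 'k) amb \<Rightarrow> ('p, 'k) amb" where
  "tan_proj \<zeta> y = (fst \<zeta> - fst y ** herm (ctrans (fst y) ** fst \<zeta>), herm (snd \<zeta>))"

lemma herm_add_self: "herm A + herm A = A + ctrans A"
  by (simp add: herm_def flip: scaleR_add_left)

lemma ctrans_herm [simp]: "ctrans (herm A) = herm A"
  by (simp add: herm_def ctrans_simps add.commute)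

lemma herm_id: "ctrans A = A \<Longrightarrow> herm A = A"
  unfolding herm_def by (simp flip: scaleR_2)

lemma herm_skew: "ctrans A = - A \<Longrightarrow> herm A = 0"
  by (simp add: herm_def)

lemma tan_proj_id: "\<zeta> \<in> Mbar_tan x \<Longrightarrow> tan_proj \<zeta> x = \<zeta>"
  using Mbar_tanD(1,3)[of \<zeta> x] by (simp add: tan_proj_def herm_id herm_skew)

lemma tangent_field_tan_proj: "tangent_field (tan_proj \<zeta>)"
proof -
  have "smooth_on UNIV (tan_proj \<zeta>)"
    unfolding tan_proj_def[abs_def] herm_def by (intro smooth_intros open_UNIV)
  moreover have "tan_proj \<zeta> y \<in> Mbar_tan y" if "y \<in> Mbar" for y
  proof -
    let ?K = "ctrans (fst y) ** fst \<zeta>"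
    have e: "ctrans (fst y) ** fst (tan_proj \<zeta> y) = ?K - herm ?K"
      by (simp add: tan_proj_def matrix_mult.diff_right matrix_mul_assoc MbarD[OF that])
    have "ctrans (fst (tan_proj \<zeta> y)) ** fst y = ctrans ?K - herm ?K"
      using arg_cong[OF e, of ctrans] by (simp add: ctrans_mult ctrans_diff)
    with e have "ctrans (fst y) ** fst (tan_proj \<zeta> y) + ctrans (fst (tan_proj \<zeta> y)) ** fst y
        = (?K + ctrans ?K) - (herm ?K + herm ?K)"
      by (simp only: algebra_simps)
    then have "ctrans (fst y) ** fst (tan_proj \<zeta> y) + ctrans (fst (tan_proj \<zeta> y)) ** fst y = 0"
      by (simp only: herm_add_self diff_self)
    moreover have "ctrans (snd (tan_proj \<zeta> y)) = snd (tan_proj \<zeta> y)" by (simp add: tan_proj_def)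
    ultimately show ?thesis by (simp add: Mbar_tan_def hermitian_mats_def)
  qed
  ultimately show ?thesis by (simp add: tangent_field_def smooth_on_imp_smooth_fun)
qed

subsection \<open>The gradient\<close>

text \<open>The expansion over the basis is what makes the gradient of a smooth function
  smooth.\<close>

lemma euclid_grad_works:
  assumes "(F has_derivative D) (at x)"
  shows "D = (\<lambda>v. euclid_grad F x \<bullet> v)" "euclid_grad F x = (\<Sum>b\<in>Basis. frechet_derivative F (at x) b *\<^sub>R b)"
proof -
  let ?G = "\<Sum>b\<in>Basis. frechet_derivative F (at x) b *\<^sub>R b"
  have D: "D v = ?G \<bullet> v" for v
    unfolding frechet_derivative_basis[OF assms, of v]
    by (simp add: inner_sum_left inner_commute[of v] mult.commute)
  have "euclid_grad F x = ?G"
    unfolding euclid_grad_def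
  proof (rule the_equality)
    show "(F has_derivative euclid_inner ?G) (at x)"
      using assms D by (metis (no_types, lifting) euclid_inner_eq ext)
    fix G assume "(F has_derivative euclid_inner G) (at x)"
    from has_derivative_unique[OF this assms] have "euclid_inner G = D" .
    then have "G \<bullet> v = ?G \<bullet> v" for v using D[of v] by (metis euclid_inner_eq)
    then show "G = ?G" using vector_eq_rdot by blast
  qed
  then show "D = (\<lambda>v. euclid_grad F x \<bullet> v)" "euclid_grad F x = ?G" using D by auto
qed

lemma smooth_on_cong:
  assumes "open S" "\<And>y. y \<in> S \<Longrightarrow> f y = g y" "smooth_on S f"
  shows "smooth_on S g"
  using assms ck_on_cong unfolding smooth_on_def by blast

lemma smooth_on_euclid_grad:
  assumes "open W" "smooth_on W F"
  shows "smooth_on W (euclid_grad F)"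
proof (rule smooth_on_cong[OF assms(1)])
  show "smooth_on W (\<lambda>x. \<Sum>b\<in>Basis. frechet_derivative F (at x) b *\<^sub>R b)"
    using assms by (intro smooth_intros)
qed (simp add: euclid_grad_works(2)[OF smooth_on_has_derivative[OF assms(2)]])

text \<open>The vector that represents the functional \<open>G \<bullet> _\<close> in the metric,
  kept separate from any function so that it can be differentiated in \<open>x\<close> and
  \<open>G\<close>.\<close>

definition tan_grad ::
  "real \<Rightarrow> real \<Rightarrow> ('p::finite, 'k::finite) amb \<Rightarrow> ('p, 'k) amb \<Rightarrow> ('p, 'k) amb" where
  "tan_grad \<alpha> \<beta> x G =
    (fst G - fst x ** ctrans (fst G) ** fst x,
     (1 / \<alpha>) *\<^sub>R (snd x ** herm (snd G) ** snd x)
     - (\<beta> * Re (trace (snd G ** snd x)) / (\<alpha> * (\<alpha> + real CARD('k) * \<beta>))) *\<^sub>R snd x)"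

lemma tan_grad_eq:
  "tan_grad \<alpha> \<beta> x G =
    (fst G - fst x ** ctrans (fst G) ** fst x,
     (1 / \<alpha>) *\<^sub>R (snd x ** herm (snd G) ** snd x)
     - (\<beta> / (\<alpha> * (\<alpha> + real CARD('k) * \<beta>)) * (ctrans (snd G) \<bullet> snd x)) *\<^sub>R snd (x :: ('p::finite, 'k::finite) amb))"
  by (simp add: tan_grad_def Re_trace_mult)

lemma smooth_on_tan_grad:
  assumes "open W" "smooth_on W G"
  shows "smooth_on W (\<lambda>x. tan_grad \<alpha> \<beta> x (G x))"
  unfolding tan_grad_eq herm_def using assms by (intro smooth_intros)

lemma tan_grad_tangent:
  assumes "x \<in> Mbar"
  shows "tan_grad \<alpha> \<beta> x G \<in> Mbar_tan x"
  by (simp add: Mbar_tan_def hermitian_mats_def tan_grad_def ctrans_simps matrix_mult.diff_left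
      matrix_mult.diff_right MbarD[OF assms] matrix_mul_assoc)
    (simp add: MbarD[OF assms] flip: matrix_mul_assoc)

lemma inner_herm: "ctrans B = B \<Longrightarrow> herm A \<bullet> B = A \<bullet> B"
  using inner_ctrans[of A B] by (simp add: herm_def inner_add_left)

lemma tan_grad_metric:
  fixes x :: "('p::finite, 'k::finite) amb"
  assumes "\<alpha> > 0" "\<beta> > - \<alpha> / real CARD('k)" "x \<in> Mbar" "\<zeta> \<in> Mbar_tan x"
  shows "Mbar_metric \<alpha> \<beta> x (tan_grad \<alpha> \<beta> x G) \<zeta> = G \<bullet> \<zeta>"
proof -
  note d = MbarD[OF assms(3)] and t = Mbar_tanD[OF assms(4)]
  define U S P X Z where "U = fst x" and "S = snd x" and "P = matrix_inv S" and "X = fst \<zeta>" and "Z = snd \<zeta>"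
  define A B where "A = fst G" and "B = snd G"
  define k where "k = real CARD('k)"
  note d' = d[folded U_def S_def, folded P_def] and t' = t[folded U_def X_def Z_def]
  have den: "\<alpha> + k * \<beta> > 0" "k > 0" using assms(2) by (simp_all add: k_def field_simps)
  define c where "c = \<beta> / (\<alpha> * (\<alpha> + k * \<beta>)) * (B \<bullet> S)"
  define Y where "Y = (1/\<alpha>) *\<^sub>R (S ** herm B ** S) - c *\<^sub>R S"
  have BS: "ctrans B \<bullet> S = B \<bullet> S" using inner_ctrans[of B S] d'(3) by simp
  have grad: "tan_grad \<alpha> \<beta> x G = (A - U ** ctrans A ** U, Y)"
    by (simp add: tan_grad_eq A_def B_def U_def S_def Y_def c_def k_def BS[unfolded B_def S_def])
  \<comment> \<open>With \<open>K = U^H A\<close> and the skew matrix \<open>T = U^H X\<close>, the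
    correction \<open>U A^H U\<close> contributes \<open>K \<bullet> T\<close>, which the term with
    factor 1/2 removes again.\<close>
  have st: "(A - U ** ctrans A ** U) \<bullet> X
      - (ctrans U ** (A - U ** ctrans A ** U)) \<bullet> (ctrans U ** X) / 2 = A \<bullet> X"
  proof -
    define K T where "K = ctrans U ** A" and "T = ctrans U ** X"
    have T: "ctrans T = - T" using t' by (simp add: T_def)
    have KT: "ctrans K \<bullet> T = - (K \<bullet> T)" using inner_ctrans[of K T] T by simp
    have "(U ** ctrans A ** U) \<bullet> X = ctrans K \<bullet> T"
      unfolding K_def T_def by (simp add: ctrans_simps inner_mult_left[of U] flip: matrix_mul_assoc)
    moreover have "ctrans U ** (A - U ** ctrans A ** U) = K - ctrans K"
      by (simp add: K_def ctrans_simps matrix_mult.diff_right matrix_mul_assoc d')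
    ultimately show ?thesis by (simp add: inner_diff_left KT flip: T_def)
  qed
  have PYP: "P ** Y ** P = (1/\<alpha>) *\<^sub>R herm B - c *\<^sub>R P"
  proof -
    have "P ** (S ** herm B ** S) ** P = herm B"
      by (simp add: matrix_mul_assoc d') (simp add: d' flip: matrix_mul_assoc)
    then show ?thesis
      by (simp add: Y_def matrix_mult.diff_left matrix_mult.diff_right matrix_mult.scaleR_left
          matrix_mult.scaleR_right d')
  qed
  have PY: "P \<bullet> Y = (B \<bullet> S) / \<alpha> - c * k"
  proof -
    have "P \<bullet> (S ** herm B ** S) = (herm B ** S) \<bullet> (S ** P)"
      using inner_mult_left[of S "herm B ** S" P] d' by (simp add: inner_commute matrix_mul_assoc)
    also have "\<dots> = B \<bullet> S"
      using inner_mult_left'[of "herm B" S "mat 1"] inner_herm[OF d'(3), of B] d' by simp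
    finally have "P \<bullet> (S ** herm B ** S) = B \<bullet> S" .
    moreover have "P \<bullet> S = k"
      using inner_mult_left[of S P "mat 1"] inner_mat_1[where 'n = 'k] d'
      by (simp add: k_def inner_commute)
    ultimately show ?thesis by (simp add: Y_def inner_diff_right)
  qed
  have Yh: "ctrans Y = Y" by (simp add: Y_def ctrans_simps d' matrix_mul_assoc)
  \<comment> \<open>This identity determines \<open>c\<close>: the multiples of \<open>P\<close>
    produced by the \<alpha>-term and by the \<beta>-term cancel.\<close>
  have "\<beta> * ((B \<bullet> S) / \<alpha> - c * k) = \<alpha> * c"
  proof -
    have "c * (\<alpha> * (\<alpha> + k * \<beta>)) = \<beta> * (B \<bullet> S)"
      using den assms(1) by (simp add: c_def)
    then show ?thesis using assms(1) by (simp add: field_simps)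
  qed
  then have "\<alpha> * ((P ** Y ** P) \<bullet> Z) + \<beta> * (P \<bullet> Y) * (P \<bullet> Z) = herm B \<bullet> Z"
    using assms(1) unfolding PYP PY by (simp add: inner_diff_left algebra_simps)
  also have "\<dots> = B \<bullet> Z" by (rule inner_herm[OF t'(1)])
  finally have sg: "\<alpha> * ((P ** Y ** P) \<bullet> Z) + \<beta> * (P \<bullet> Y) * (P \<bullet> Z) = B \<bullet> Z" .
  have "Mbar_metric \<alpha> \<beta> x (tan_grad \<alpha> \<beta> x G) \<zeta> = A \<bullet> X + B \<bullet> Z"
    using Mbar_metric_eq[OF assms(3), of "tan_grad \<alpha> \<beta> x G" \<alpha> \<beta> \<zeta>] st sg Yh
    unfolding grad by (simp flip: U_def S_def X_def Z_def P_def)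
  then show ?thesis by (simp add: inner_prod_def A_def B_def X_def Z_def)
qed

context
  fixes \<alpha> \<beta> :: real and k :: "'k::finite itself"
  assumes \<alpha>: "\<alpha> > 0" and \<beta>: "\<beta> > - \<alpha> / real CARD('k)"
begin

lemma riem_grad_Mbar_eqI:
  fixes x :: "('p::finite, 'k) amb"
  assumes "x \<in> Mbar" "v \<in> Mbar_tan x" "\<And>w. w \<in> Mbar_tan x \<Longrightarrow> Mbar_metric \<alpha> \<beta> x v w = Mbar_deriv x w u"
  shows "riem_grad (Mbar_riem \<alpha> \<beta>) u x = v"
  unfolding riem_grad_def Mbar_riem_simps
  by (rule the_equality)
    (use assms in \<open>auto intro!: Mbar_metric_eqI[OF \<alpha> \<beta> assms(1) _ assms(2) order.refl subspace_Mbar_tan]\<close>)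

text \<open>Extensions may differ in their Euclidean gradients, but not in their derivatives along
  tangent vectors. Nondegeneracy then makes the resulting tangent vector the same for all of
  them.\<close>

lemma tan_grad_extension:
  fixes x :: "('p::finite, 'k) amb"
  assumes "smooth_extension Mbar u W F" "x \<in> W" "x \<in> Mbar"
  shows "w \<in> Mbar_tan x \<Longrightarrow> Mbar_metric \<alpha> \<beta> x (tan_grad \<alpha> \<beta> x (euclid_grad F x)) w = Mbar_deriv x w u"
    and "riem_grad (Mbar_riem \<alpha> \<beta>) u x = tan_grad \<alpha> \<beta> x (euclid_grad F x)"
proof -
  have W: "open W" "smooth_on W F" "\<And>y. y \<in> W \<Longrightarrow> y \<in> Mbar \<Longrightarrow> F y = u y"
    using assms(1) by (auto simp: smooth_extension_def)
  note der = smooth_on_has_derivative[OF W(2) assms(2)]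
  show 1: "Mbar_metric \<alpha> \<beta> x (tan_grad \<alpha> \<beta> x (euclid_grad F x)) w = Mbar_deriv x w u"
    if "w \<in> Mbar_tan x" for w
    using Mbar_deriv_extension[OF W(1) assms(2) W(2,3) assms(3) that]
      tan_grad_metric[OF \<alpha> \<beta> assms(3) that, of "euclid_grad F x"]
    by (simp add: euclid_grad_works(1)[OF der])
  show "riem_grad (Mbar_riem \<alpha> \<beta>) u x = tan_grad \<alpha> \<beta> x (euclid_grad F x)"
    by (rule riem_grad_Mbar_eqI[OF assms(3) tan_grad_tangent[OF assms(3)] 1])
qed

lemma riem_grad_Mbar:
  fixes x :: "('p::finite, 'k) amb"
  assumes "smooth_fun Mbar u" "x \<in> Mbar"
  shows "riem_grad (Mbar_riem \<alpha> \<beta>) u x \<in> Mbar_tan x"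
    and "w \<in> Mbar_tan x \<Longrightarrow> Mbar_metric \<alpha> \<beta> x (riem_grad (Mbar_riem \<alpha> \<beta>) u x) w = Mbar_deriv x w u"
proof -
  obtain W F where W: "x \<in> W" "smooth_extension Mbar u W F"
    using assms unfolding smooth_fun_def by blast
  show "riem_grad (Mbar_riem \<alpha> \<beta>) u x \<in> Mbar_tan x"
    "w \<in> Mbar_tan x \<Longrightarrow> Mbar_metric \<alpha> \<beta> x (riem_grad (Mbar_riem \<alpha> \<beta>) u x) w = Mbar_deriv x w u"
    unfolding tan_grad_extension(2)[OF W(2,1) assms(2)]
    by (rule tan_grad_tangent[OF assms(2)]) (rule tan_grad_extension(1)[OF W(2,1) assms(2)])
qed

lemma tangent_field_riem_grad:
  assumes "smooth_fun Mbar (u :: ('p::finite, 'k) amb \<Rightarrow> real)"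
  shows "tangent_field (riem_grad (Mbar_riem \<alpha> \<beta>) u)"
proof -
  have "smooth_fun Mbar (riem_grad (Mbar_riem \<alpha> \<beta>) u)"
  proof (rule smooth_funI)
    fix x :: "('p, 'k) amb" assume x: "x \<in> Mbar"
    obtain W F where W: "x \<in> W" "smooth_extension Mbar u W F"
      using assms x unfolding smooth_fun_def by blast
    then have "open W" "smooth_on W F" by (auto simp: smooth_extension_def)
    then have "smooth_on W (\<lambda>x. tan_grad \<alpha> \<beta> x (euclid_grad F x))"
      by (intro smooth_on_tan_grad smooth_on_euclid_grad)
    moreover have "\<forall>y\<in>W \<inter> Mbar. tan_grad \<alpha> \<beta> y (euclid_grad F y) = riem_grad (Mbar_riem \<alpha> \<beta>) u y"
      using tan_grad_extension(2)[OF W(2)] by simp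
    ultimately show "\<exists>W F. open W \<and> x \<in> W \<and> smooth_on W F \<and>
        (\<forall>y\<in>W \<inter> Mbar. F y = riem_grad (Mbar_riem \<alpha> \<beta>) u y)"
      using W(1) \<open>open W\<close> by (intro exI[of _ W] exI[of _ "\<lambda>x. tan_grad \<alpha> \<beta> x (euclid_grad F x)"]) simp
  qed
  then show ?thesis using riem_grad_Mbar(1)[OF assms] by (simp add: tangent_field_def)
qed

end

subsection \<open>The Levi-Civita connection and the Hessian\<close>

text \<open>
  The Christoffel form of the canonical metric on the Stiefel manifold and of the affine-invariant
  metric on positive definite matrices; the latter is unchanged by the \<open>\<beta>\<close>-term, as the form
  \<open>tr (S\<inverse> \<xi>)\<close> is the differential of \<open>ln det S\<close> and parallel.
\<close>

definition christoffel ::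
  "('p::finite, 'k::finite) amb \<Rightarrow> ('p, 'k) amb \<Rightarrow> ('p, 'k) amb \<Rightarrow> ('p, 'k) amb" where
  "christoffel x \<xi> \<eta> =
    (let U = fst x; P = matrix_inv (snd x); X = fst \<xi>; Y = fst \<eta>; N = mat 1 - U ** ctrans U in
      ((1/2) *\<^sub>R (X ** ctrans Y ** U + Y ** ctrans X ** U
        + U ** (ctrans X ** N ** Y + ctrans Y ** N ** X)),
       - ((1/2) *\<^sub>R (snd \<xi> ** P ** snd \<eta> + snd \<eta> ** P ** snd \<xi>))))"

lemma christoffel_sym: "christoffel x \<xi> \<eta> = christoffel x \<eta> \<xi>"
  by (simp add: christoffel_def Let_def add.commute)

text \<open>Tangent vectors are split as \<open>U A + X\<close> with \<open>A\<close> skew-Hermitian and \<open>U\<^sup>H X = 0\<close>.\<close>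

lemma stiefel_christoffel_split:
  fixes U X Y :: "complex^'k^'p" and A B :: "complex^'k^'k"
  assumes U: "ctrans U ** U = mat 1" and A: "ctrans A = - A" and B: "ctrans B = - B"
    and X: "ctrans U ** X = 0" and Y: "ctrans U ** Y = 0"
    and V: "V = U ** A + X" and W: "W = U ** B + Y"
  defines "K \<equiv> ctrans X ** Y + ctrans Y ** X - A ** B - B ** A"
  shows "V ** ctrans W ** U + W ** ctrans V ** U
      + U ** (ctrans V ** (mat 1 - U ** ctrans U) ** W + ctrans W ** (mat 1 - U ** ctrans U) ** V)
    = U ** K - X ** B - Y ** A"
proof -
  have U': "ctrans U ** (U ** M) = M" for M :: "complex^'k^'k" by (simp add: U matrix_mul_assoc)
  have XU: "ctrans X ** U = 0" "ctrans Y ** U = 0"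
    using arg_cong[OF X, of ctrans] arg_cong[OF Y, of ctrans] by (simp_all add: ctrans_simps)
  have W': "ctrans W ** U = - B" "ctrans V ** U = - A"
    unfolding V W by (simp_all add: ctrans_simps A B XU U matrix_mult.add_left matrix_mult.diff_left matrix_mult.minus_left
        flip: matrix_mul_assoc)
  have N: "(mat 1 - U ** ctrans U) ** W = Y" "(mat 1 - U ** ctrans U) ** V = X"
    unfolding V W by (simp_all add: matrix_mult.diff_left matrix_mult.add_right X Y U'
        flip: matrix_mul_assoc)
  have c: "ctrans V ** Y = ctrans X ** Y" "ctrans W ** X = ctrans Y ** X"
    unfolding V W by (simp_all add: ctrans_simps matrix_mult.add_left X Y flip: matrix_mul_assoc)
  have "V ** ctrans W ** U + W ** ctrans V ** U
      + U ** (ctrans V ** (mat 1 - U ** ctrans U) ** W + ctrans W ** (mat 1 - U ** ctrans U) ** V)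
    = U ** (ctrans X ** Y + ctrans Y ** X) - V ** B - W ** A"
    unfolding matrix_mul_assoc[symmetric] W' N c by (simp add: matrix_mult.minus_right)
  then show ?thesis
    unfolding V W K_def
    by (simp add: matrix_mult.add_left matrix_mult.add_right matrix_mult.diff_right algebra_simps
        flip: matrix_mul_assoc)
qed

lemma stiefel_split:
  fixes U V :: "complex^'k^'p"
  assumes "ctrans U ** U = mat 1" "ctrans (ctrans U ** V) = - (ctrans U ** V)"
  obtains A X where "V = U ** A + X" "ctrans A = - A" "ctrans U ** X = 0" "ctrans U ** V = A"
proof
  show "V = U ** (ctrans U ** V) + (V - U ** (ctrans U ** V))" by simp
  show "ctrans U ** (V - U ** (ctrans U ** V)) = 0"
    by (simp add: matrix_mult.diff_right matrix_mul_assoc assms(1))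
qed (use assms in auto)

text \<open>\<open>G\<close> is the Stiefel part of the Christoffel form after splitting. Its
  component \<open>U ** K\<close> has Hermitian \<open>K\<close>, which is orthogonal to the skew
  \<open>C\<close>, so only the pairing with the normal part \<open>Z\<close> survives.\<close>

lemma stiefel_compat_aux:
  fixes U X Y Z :: "complex^'k^'p" and A B C :: "complex^'k^'k"
  assumes U: "ctrans U ** U = mat 1" and A: "ctrans A = - A" and B: "ctrans B = - B"
    and C: "ctrans C = - C"
    and X: "ctrans U ** X = 0" and Y: "ctrans U ** Y = 0" and Z: "ctrans U ** Z = 0"
  defines "G \<equiv> (1/2) *\<^sub>R (U ** (ctrans X ** Y + ctrans Y ** X - A ** B - B ** A) - X ** B - Y ** A)"
  shows "G \<bullet> (U ** C + Z) - (ctrans U ** G) \<bullet> C / 2 = - ((X ** B + Y ** A) \<bullet> Z) / 2"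
proof -
  define K where "K = ctrans X ** Y + ctrans Y ** X - A ** B - B ** A"
  have "ctrans K = K" by (simp add: K_def ctrans_simps A B matrix_mult.minus_left matrix_mult.minus_right)
  then have KC: "K \<bullet> C = 0" using inner_skew_herm[OF C, of K] by (simp add: inner_commute)
  have UG: "ctrans U ** G = (1/2) *\<^sub>R K"
    unfolding G_def K_def[symmetric]
    by (simp add: matrix_mult.scaleR_right matrix_mult.diff_right matrix_mul_assoc U X Y)
  have "G \<bullet> (U ** C) = (ctrans U ** G) \<bullet> C"
    by (metis inner_commute inner_mult_left)
  then have 1: "G \<bullet> (U ** C) = 0" using KC UG by simp
  have "(U ** K) \<bullet> Z = 0" by (simp add: inner_mult_left Z)
  then have "G \<bullet> Z = - ((X ** B + Y ** A) \<bullet> Z) / 2"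
    unfolding G_def K_def[symmetric] by (simp add: inner_diff_left inner_add_left)
  with 1 show ?thesis using KC UG by (simp add: inner_add_right)
qed

text \<open>The left side is the derivative in direction \<open>V\<close>, with \<open>W\<close> and
  \<open>Z\<close> frozen, of the only part of the Stiefel metric that depends on \<open>U\<close>.
  The identity is metric compatibility of the Christoffel form.\<close>

lemma stiefel_compat:
  fixes U V W Z :: "complex^'k^'p"
  assumes U: "ctrans U ** U = mat 1" and t: "ctrans (ctrans U ** V) = - (ctrans U ** V)"
    "ctrans (ctrans U ** W) = - (ctrans U ** W)" "ctrans (ctrans U ** Z) = - (ctrans U ** Z)"
  defines "\<Gamma> \<equiv> \<lambda>V W. (1/2) *\<^sub>R (V ** ctrans W ** U + W ** ctrans V ** U
      + U ** (ctrans V ** (mat 1 - U ** ctrans U) ** W + ctrans W ** (mat 1 - U ** ctrans U) ** V))"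
  shows "- (((ctrans V ** W) \<bullet> (ctrans U ** Z) + (ctrans U ** W) \<bullet> (ctrans V ** Z)) / 2)
    = (\<Gamma> V W \<bullet> Z - (ctrans U ** \<Gamma> V W) \<bullet> (ctrans U ** Z) / 2)
      + (\<Gamma> V Z \<bullet> W - (ctrans U ** \<Gamma> V Z) \<bullet> (ctrans U ** W) / 2)"
proof -
  obtain A X where V: "V = U ** A + X" "ctrans A = - A" "ctrans U ** X = 0" "ctrans U ** V = A"
    using stiefel_split[OF U t(1)] .
  obtain B Y where W: "W = U ** B + Y" "ctrans B = - B" "ctrans U ** Y = 0" "ctrans U ** W = B"
    using stiefel_split[OF U t(2)] .
  obtain C Q where Z: "Z = U ** C + Q" "ctrans C = - C" "ctrans U ** Q = 0" "ctrans U ** Z = C"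
    using stiefel_split[OF U t(3)] .
  have VW: "ctrans V ** W = ctrans X ** Y - A ** B"
    and VZ: "ctrans V ** Z = ctrans X ** Q - A ** C"
  proof -
    have XU: "ctrans X ** U = 0" using arg_cong[OF V(3), of ctrans] by (simp add: ctrans_simps)
    have "ctrans V ** (U ** M + N) = ctrans X ** N - A ** M" if "ctrans U ** N = 0"
      for M :: "complex^'k^'k" and N :: "complex^'k^'p"
      unfolding V(1) using that
      by (simp add: ctrans_simps matrix_mult.add_left matrix_mult.diff_left matrix_mult.add_right V(2)
          matrix_mult.minus_left matrix_mul_assoc XU) (simp add: that U flip: matrix_mul_assoc)
    then show "ctrans V ** W = ctrans X ** Y - A ** B" "ctrans V ** Z = ctrans X ** Q - A ** C"
      unfolding W(1) Z(1) using W(3) Z(3) by auto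
  qed
  have 1: "\<Gamma> V W \<bullet> Z - (ctrans U ** \<Gamma> V W) \<bullet> (ctrans U ** Z) / 2 = - ((X ** B + Y ** A) \<bullet> Q) / 2"
    using stiefel_compat_aux[OF U V(2) W(2) Z(2) V(3) W(3) Z(3)]
      stiefel_christoffel_split[OF U V(2) W(2) V(3) W(3) V(1) W(1)]
    unfolding \<Gamma>_def Z(4) by (simp add: Z(1))
  have 2: "\<Gamma> V Z \<bullet> W - (ctrans U ** \<Gamma> V Z) \<bullet> (ctrans U ** W) / 2 = - ((X ** C + Q ** A) \<bullet> Y) / 2"
    using stiefel_compat_aux[OF U V(2) Z(2) W(2) V(3) Z(3) W(3)]
      stiefel_christoffel_split[OF U V(2) Z(2) V(3) Z(3) V(1) Z(1)]
    unfolding \<Gamma>_def W(4) by (simp add: W(1))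
  have a: "(A ** B) \<bullet> C = - (B \<bullet> (A ** C))"
    using inner_mult_left[of A B C] V(2) by (simp add: matrix_mult.minus_left)
  have b: "(ctrans X ** Y) \<bullet> C = (X ** C) \<bullet> Y"
    using inner_mult_left[of X C Y] by (simp add: inner_commute)
  have c: "B \<bullet> (ctrans X ** Q) = (X ** B) \<bullet> Q"
    by (simp add: inner_mult_left)
  have d: "(Q ** A) \<bullet> Y = - ((Y ** A) \<bullet> Q)"
    using inner_mult_left'[of Q A Y] V(2) by (simp add: matrix_mult.minus_right inner_commute)
  show ?thesis
    unfolding 1 2 unfolding VW VZ W(4) Z(4)
    by (simp add: inner_diff_left inner_diff_right inner_add_left a b c d field_simps)
qed

text \<open>Along \<open>X\<close> the inverse \<open>P\<close> has derivative
  \<open>- P X P\<close>. The first claim is compatibility with the affine-invariant form, the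
  second says that the one-form \<open>P \<bullet> _\<close> is parallel, which handles the
  \<beta>-term.\<close>

lemma affine_invariant_compat:
  fixes P X Y Z :: "complex^'k^'k"
  assumes P: "ctrans P = P" and h: "ctrans X = X" "ctrans Y = Y" "ctrans Z = Z"
  defines "\<Gamma> \<equiv> \<lambda>X Y. - ((1/2) *\<^sub>R (X ** P ** Y + Y ** P ** X))"
  shows "- ((P ** X ** P ** Y ** P + P ** Y ** P ** X ** P) \<bullet> Z)
      = (P ** \<Gamma> X Y ** P) \<bullet> Z + (P ** \<Gamma> X Z ** P) \<bullet> Y"
    and "P \<bullet> \<Gamma> X Y = - ((P ** X ** P) \<bullet> Y)"
proof -
  have e: "P ** \<Gamma> X Y ** P = - ((1/2) *\<^sub>R (P ** X ** P ** Y ** P + P ** Y ** P ** X ** P))" for Y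
    by (simp add: \<Gamma>_def matrix_mult.minus_left matrix_mult.minus_right matrix_mult.scaleR_left
        matrix_mult.scaleR_right matrix_mult.add_left matrix_mult.add_right matrix_mul_assoc)
  have s1: "(P ** X ** P ** Z ** P) \<bullet> Y = (P ** X ** P ** Y ** P) \<bullet> Z"
  proof -
    have "(P ** X ** P ** Z ** P) \<bullet> Y = (P ** X ** P ** Z) \<bullet> (Y ** P)"
      using inner_mult_left'[of "P ** X ** P ** Z" P Y] P by simp
    also have "\<dots> = Z \<bullet> (P ** X ** P ** Y ** P)"
      using inner_mult_left[of "P ** X ** P" Z "Y ** P"] P h by (simp add: ctrans_simps matrix_mul_assoc)
    finally show ?thesis by (simp add: inner_commute)
  qed
  have s2: "(P ** Z ** P ** X ** P) \<bullet> Y = (P ** Y ** P ** X ** P) \<bullet> Z"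
  proof -
    have "(P ** Z ** P ** X ** P) \<bullet> Y = (P ** Z) \<bullet> (Y ** P ** X ** P)"
      using inner_mult_left'[of "P ** Z" "P ** X ** P" Y] P h by (simp add: ctrans_simps matrix_mul_assoc)
    also have "\<dots> = Z \<bullet> (P ** Y ** P ** X ** P)"
      using inner_mult_left[of P Z "Y ** P ** X ** P"] P h by (simp add: matrix_mul_assoc)
    finally show ?thesis by (simp add: inner_commute)
  qed
  show "- ((P ** X ** P ** Y ** P + P ** Y ** P ** X ** P) \<bullet> Z)
      = (P ** \<Gamma> X Y ** P) \<bullet> Z + (P ** \<Gamma> X Z ** P) \<bullet> Y"
    unfolding e by (simp add: inner_add_left s1 s2)
  have "P \<bullet> (X ** P ** Y) = (P ** X ** P) \<bullet> Y"
    using inner_mult_left[of "X ** P" Y P] P h by (simp add: ctrans_simps inner_commute matrix_mul_assoc)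
  moreover have "P \<bullet> (Y ** P ** X) = (P ** X ** P) \<bullet> Y"
    using inner_mult_left'[of Y "P ** X" P] P h by (simp add: ctrans_simps inner_commute matrix_mul_assoc)
  ultimately show "P \<bullet> \<Gamma> X Y = - ((P ** X ** P) \<bullet> Y)"
    unfolding \<Gamma>_def by (simp add: inner_add_right)
qed

lemma christoffel_snd_herm:
  assumes "x \<in> Mbar" "\<xi> \<in> Mbar_tan x" "\<eta> \<in> Mbar_tan x"
  shows "ctrans (snd (christoffel x \<xi> \<eta>)) = snd (christoffel x \<xi> \<eta>)"
  using MbarD(4)[OF assms(1)] Mbar_tanD(1)[OF assms(2)] Mbar_tanD(1)[OF assms(3)]
  by (simp add: christoffel_def Let_def ctrans_simps matrix_mul_assoc add.commute)

text \<open>The left side is the derivative of the metric coefficients in direction \<xi> with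
  \<eta> and \<zeta> frozen.\<close>

lemma christoffel_compat:
  fixes x :: "('p::finite, 'k::finite) amb"
  assumes x: "x \<in> Mbar" and t: "\<xi> \<in> Mbar_tan x" "\<eta> \<in> Mbar_tan x" "\<zeta> \<in> Mbar_tan x"
  defines "P \<equiv> matrix_inv (snd x)"
  shows "- (((ctrans (fst \<xi>) ** fst \<eta>) \<bullet> (ctrans (fst x) ** fst \<zeta>)
        + (ctrans (fst x) ** fst \<eta>) \<bullet> (ctrans (fst \<xi>) ** fst \<zeta>)) / 2)
      - \<alpha> * ((P ** snd \<xi> ** P ** snd \<eta> ** P + P ** snd \<eta> ** P ** snd \<xi> ** P) \<bullet> snd \<zeta>)
      - \<beta> * (((P ** snd \<xi> ** P) \<bullet> snd \<eta>) * (P \<bullet> snd \<zeta>) + (P \<bullet> snd \<eta>) * ((P ** snd \<xi> ** P) \<bullet> snd \<zeta>))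
    = Mbar_metric \<alpha> \<beta> x (christoffel x \<xi> \<eta>) \<zeta> + Mbar_metric \<alpha> \<beta> x (christoffel x \<xi> \<zeta>) \<eta>"
proof -
  note d = MbarD[OF x] and tt = Mbar_tanD[OF t(1)] Mbar_tanD[OF t(2)] Mbar_tanD[OF t(3)]
  note st = stiefel_compat[OF d(1) tt(3,6,9)]
  have P: "ctrans P = P" using d by (simp add: P_def)
  note af = affine_invariant_compat[OF P tt(1) tt(4) tt(7)] affine_invariant_compat(2)[OF P tt(1) tt(7) tt(7)]
  have \<alpha>: "\<alpha> * - a = \<alpha> * (b + c)" if "- a = b + c" for a b c using that by simp
  show ?thesis
    unfolding Mbar_metric_eq[OF x christoffel_snd_herm[OF x t(1,2)]]
      Mbar_metric_eq[OF x christoffel_snd_herm[OF x t(1,3)]]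
    using st \<alpha>[OF af(1)] unfolding christoffel_def Let_def fst_conv snd_conv P_def[symmetric] af(2,3)
    by (simp only: ring_distribs mult_minus_left mult_minus_right mult.assoc mult.commute mult.left_commute)
qed

lemma Mbar_metric_has_derivative:
  fixes x :: "('p::finite, 'k::finite) amb"
  assumes x: "x \<in> Mbar" and "tangent_field Y" "tangent_field Z"
    and Y: "(Y has_derivative DY) (at x within Mbar)" and Z: "(Z has_derivative DZ) (at x within Mbar)"
    and \<xi>: "\<xi> \<in> Mbar_tan x"
  defines "P \<equiv> matrix_inv (snd x)"
  shows "Mbar_deriv x \<xi> (\<lambda>y. Mbar_metric \<alpha> \<beta> y (Y y) (Z y)) =
    fst (DY \<xi>) \<bullet> fst (Z x) + fst (Y x) \<bullet> fst (DZ \<xi>)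
    - ((ctrans (fst \<xi>) ** fst (Y x) + ctrans (fst x) ** fst (DY \<xi>)) \<bullet> (ctrans (fst x) ** fst (Z x))
      + (ctrans (fst x) ** fst (Y x)) \<bullet> (ctrans (fst \<xi>) ** fst (Z x) + ctrans (fst x) ** fst (DZ \<xi>))) / 2
    + \<alpha> * ((P ** snd (DY \<xi>) ** P - (P ** snd \<xi> ** P ** snd (Y x) ** P + P ** snd (Y x) ** P ** snd \<xi> ** P)) \<bullet> snd (Z x)
      + (P ** snd (Y x) ** P) \<bullet> snd (DZ \<xi>))
    + \<beta> * ((P \<bullet> snd (DY \<xi>) - (P ** snd \<xi> ** P) \<bullet> snd (Y x)) * (P \<bullet> snd (Z x))
      + (P \<bullet> snd (Y x)) * (P \<bullet> snd (DZ \<xi>) - (P ** snd \<xi> ** P) \<bullet> snd (Z x)))"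
proof -
  let ?F = "at x within Mbar"
  have fs: "((\<lambda>y. fst (Y y)) has_derivative (\<lambda>v. fst (DY v))) ?F" "((\<lambda>y. fst (Z y)) has_derivative (\<lambda>v. fst (DZ v))) ?F"
    "((\<lambda>y. snd (Y y)) has_derivative (\<lambda>v. snd (DY v))) ?F" "((\<lambda>y. snd (Z y)) has_derivative (\<lambda>v. snd (DZ v))) ?F"
    using Y Z by (auto intro: has_derivative_fst has_derivative_snd)
  have c: "((\<lambda>y. ctrans (fst y)) has_derivative (\<lambda>v. ctrans (fst v))) ?F"
    by (intro bounded_linear.has_derivative[OF bounded_linear_ctrans] has_derivative_fst has_derivative_ident)
  have i: "((\<lambda>y. matrix_inv (snd y)) has_derivative (\<lambda>v. - (P ** snd v ** P))) ?F"
    unfolding P_def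
    by (rule has_derivative_compose[OF has_derivative_snd[OF has_derivative_ident]
          has_derivative_matrix_inv[OF hpd_invertible[OF MbarD(2)[OF x]]]])
  note cY = matrix_mult.FDERIV[OF c fs(1)] and cZ = matrix_mult.FDERIV[OF c fs(2)]
  note PY = matrix_mult.FDERIV[OF matrix_mult.FDERIV[OF i fs(3)] i]
  note full = has_derivative_add[OF has_derivative_add[OF has_derivative_diff[OF has_derivative_inner[OF fs(1,2)]
      bounded_linear.has_derivative[OF bounded_linear_divide[of 2] has_derivative_inner[OF cY cZ]]]
      bounded_linear.has_derivative[OF bounded_linear_mult_right[of \<alpha>] has_derivative_inner[OF PY fs(4)]]]
      has_derivative_mult[OF bounded_linear.has_derivative[OF bounded_linear_mult_right[of \<beta>]
        has_derivative_inner[OF i fs(3)]] has_derivative_inner[OF i fs(4)]]]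
  have eq: "Mbar_metric \<alpha> \<beta> y (Y y) (Z y) = fst (Y y) \<bullet> fst (Z y)
      - (ctrans (fst y) ** fst (Y y)) \<bullet> (ctrans (fst y) ** fst (Z y)) / 2
    + \<alpha> * ((matrix_inv (snd y) ** snd (Y y) ** matrix_inv (snd y)) \<bullet> snd (Z y))
    + \<beta> * (matrix_inv (snd y) \<bullet> snd (Y y)) * (matrix_inv (snd y) \<bullet> snd (Z y))" if "y \<in> Mbar" for y
    using assms(2) that Mbar_tanD(1)[of "Y y" y] by (intro Mbar_metric_eq) (auto simp: tangent_field_def)
  have "Mbar_deriv x \<xi> (\<lambda>y. Mbar_metric \<alpha> \<beta> y (Y y) (Z y)) =
    Mbar_deriv x \<xi> (\<lambda>y. fst (Y y) \<bullet> fst (Z y)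
      - (ctrans (fst y) ** fst (Y y)) \<bullet> (ctrans (fst y) ** fst (Z y)) / 2
    + \<alpha> * ((matrix_inv (snd y) ** snd (Y y) ** matrix_inv (snd y)) \<bullet> snd (Z y))
    + \<beta> * (matrix_inv (snd y) \<bullet> snd (Y y)) * (matrix_inv (snd y) \<bullet> snd (Z y)))"
    by (rule Mbar_deriv_cong[OF x eq])
  also note Mbar_deriv_eq[OF x \<xi> full]
  finally show ?thesis
    by (simp add: P_def[symmetric] matrix_mult.add_left matrix_mult.diff_left matrix_mult.minus_left matrix_mult.minus_right
        matrix_mul_assoc inner_add_left inner_add_right inner_diff_left algebra_simps)
qed

text \<open>\<open>DY \<xi>\<close> alone need not be tangent, so symmetry of the metric is not at
  hand for it. Both derivatives therefore stand in the first slot, where a Hermitian second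
  component is enough for \<open>Mbar_metric_eq\<close>.\<close>

lemma Mbar_metric_compat:
  fixes x :: "('p::finite, 'k::finite) amb"
  assumes x: "x \<in> Mbar" and f: "tangent_field Y" "tangent_field Z"
    and Y: "(Y has_derivative DY) (at x within Mbar)" and Z: "(Z has_derivative DZ) (at x within Mbar)"
    and \<xi>: "\<xi> \<in> Mbar_tan x" and snd: "ctrans (snd (DY \<xi>)) = snd (DY \<xi>)" "ctrans (snd (DZ \<xi>)) = snd (DZ \<xi>)"
  shows "Mbar_deriv x \<xi> (\<lambda>y. Mbar_metric \<alpha> \<beta> y (Y y) (Z y)) =
    Mbar_metric \<alpha> \<beta> x (DY \<xi> + christoffel x \<xi> (Y x)) (Z x)
    + Mbar_metric \<alpha> \<beta> x (DZ \<xi> + christoffel x \<xi> (Z x)) (Y x)"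
proof -
  have t: "Y x \<in> Mbar_tan x" "Z x \<in> Mbar_tan x" using f x by (auto simp: tangent_field_def)
  show ?thesis
    unfolding Mbar_metric_has_derivative[OF x f Y Z \<xi>] Mbar_metric_add_left
      Mbar_metric_eq[OF x snd(1)] Mbar_metric_eq[OF x snd(2)]
    using christoffel_compat[OF x \<xi> t, of \<alpha> \<beta>]
      hpd_form_sym[OF MbarD(4)[OF x], of "snd (Y x)" "snd (DZ \<xi>)"]
    by (simp add: inner_add_left inner_add_right inner_diff_left inner_commute algebra_simps add_divide_distrib)
qed

text \<open>Differentiating the tangency constraint of \<open>Y\<close> along \<xi> shows by how
  much \<open>DY \<xi>\<close> fails to be tangent; the Christoffel form has precisely the opposite
  defect.\<close>

lemma tangent_field_derivative_tangent:
  fixes x :: "('p::finite, 'k::finite) amb"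
  assumes x: "x \<in> Mbar" and f: "tangent_field Y" and Y: "(Y has_derivative DY) (at x within Mbar)"
    and \<xi>: "\<xi> \<in> Mbar_tan x"
  shows "ctrans (snd (DY \<xi>)) = snd (DY \<xi>)" "DY \<xi> + christoffel x \<xi> (Y x) \<in> Mbar_tan x"
proof -
  let ?F = "at x within (Mbar :: ('p, 'k) amb set)"
  have t: "Y y \<in> Mbar_tan y" if "y \<in> Mbar" for y using f that by (simp add: tangent_field_def)
  note c = bounded_linear.has_derivative[OF bounded_linear_ctrans]
  have c1: "((\<lambda>y. ctrans (fst y)) has_derivative (\<lambda>v. ctrans (fst v))) ?F"
    by (intro c has_derivative_fst has_derivative_ident)
  have zero: "D \<xi> = 0" if "(g has_derivative D) ?F" "\<And>y. y \<in> Mbar \<Longrightarrow> g y = 0"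
    for g :: "('p, 'k) amb \<Rightarrow> complex^'k^'k" and D
  proof -
    have "(g has_derivative (\<lambda>_. 0)) ?F"
      by (rule has_derivative_transform[OF x _ has_derivative_const[of 0]]) (simp add: that(2))
    from has_derivative_within_Mbar_unique[OF x \<xi> that(1) this] show ?thesis .
  qed
  have "ctrans (snd (DY \<xi>)) - snd (DY \<xi>) = 0"
    by (rule zero[OF has_derivative_diff[OF c[OF has_derivative_snd[OF Y]] has_derivative_snd[OF Y]]])
      (use Mbar_tanD(1)[OF t] in simp)
  then show s: "ctrans (snd (DY \<xi>)) = snd (DY \<xi>)" by simp
  define U X W D where "U = fst x" and "X = fst \<xi>" and "W = fst (Y x)" and "D = fst (DY \<xi>)"
  have U: "ctrans U ** U = mat 1" using MbarD(1)[OF x] by (simp add: U_def)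
  have X: "ctrans (ctrans U ** X) = - (ctrans U ** X)" and W: "ctrans (ctrans U ** W) = - (ctrans U ** W)"
    using Mbar_tanD(3)[OF \<xi>] Mbar_tanD(3)[OF t[OF x]] by (simp_all add: U_def X_def W_def)
  have "(ctrans (fst x) ** fst (DY \<xi>) + ctrans (fst \<xi>) ** fst (Y x))
      + (ctrans (fst (Y x)) ** fst \<xi> + ctrans (fst (DY \<xi>)) ** fst x) = 0"
    by (rule zero[OF has_derivative_add[OF matrix_mult.FDERIV[OF c1 has_derivative_fst[OF Y]]
          matrix_mult.FDERIV[OF c[OF has_derivative_fst[OF Y]] has_derivative_fst[OF has_derivative_ident]]]])
      (use Mbar_tanD(2)[OF t] in simp)
  then have D: "ctrans U ** D + ctrans D ** U = - (ctrans X ** W + ctrans W ** X)"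
    unfolding U_def X_def W_def D_def eq_neg_iff_add_eq_0 by (simp add: algebra_simps)
  define G where "G = fst (christoffel x \<xi> (Y x))"
  have G: "ctrans U ** G + ctrans G ** U = ctrans X ** W + ctrans W ** X"
  proof -
    obtain A X' where V: "X = U ** A + X'" "ctrans A = - A" "ctrans U ** X' = 0" "ctrans U ** X = A"
      using stiefel_split[OF U X] .
    obtain B Y' where W': "W = U ** B + Y'" "ctrans B = - B" "ctrans U ** Y' = 0" "ctrans U ** W = B"
      using stiefel_split[OF U W] .
    let ?K = "ctrans X' ** Y' + ctrans Y' ** X' - A ** B - B ** A"
    have "G = (1/2) *\<^sub>R (U ** ?K - X' ** B - Y' ** A)"
      using stiefel_christoffel_split[OF U V(2) W'(2) V(3) W'(3) V(1) W'(1)]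
      by (simp add: G_def christoffel_def Let_def U_def X_def W_def)
    then have UG: "ctrans U ** G = (1/2) *\<^sub>R ?K"
      by (simp add: matrix_mult.scaleR_right matrix_mult.diff_right matrix_mul_assoc U V(3) W'(3))
    have K: "ctrans ?K = ?K"
      by (simp add: ctrans_simps V(2) W'(2) matrix_mult.minus_left matrix_mult.minus_right)
    have GU: "ctrans G ** U = (1/2) *\<^sub>R ?K"
      using arg_cong[OF UG, of ctrans] K by (simp add: ctrans_mult ctrans_scaleR)
    have "ctrans U ** G + ctrans G ** U = ?K"
      unfolding UG GU by (metis scaleR_add_right scaleR_half_double)
    moreover have "ctrans X ** W = ctrans X' ** Y' - A ** B" "ctrans W ** X = ctrans Y' ** X' - B ** A"
    proof -
      have XU: "ctrans X' ** U = 0" "ctrans Y' ** U = 0"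
        using arg_cong[OF V(3), of ctrans] arg_cong[OF W'(3), of ctrans] by (simp_all add: ctrans_simps)
      show "ctrans X ** W = ctrans X' ** Y' - A ** B" "ctrans W ** X = ctrans Y' ** X' - B ** A"
        unfolding V(1) W'(1)
        by (simp_all add: ctrans_simps matrix_mult.add_left matrix_mult.diff_left matrix_mult.add_right V(2)
            W'(2) matrix_mult.minus_left matrix_mul_assoc XU)
          (simp_all add: V(3) W'(3) U flip: matrix_mul_assoc)
    qed
    ultimately show ?thesis by (simp only:) (simp add: algebra_simps)
  qed
  have "ctrans U ** (D + G) + ctrans (D + G) ** U
      = (ctrans U ** D + ctrans D ** U) + (ctrans U ** G + ctrans G ** U)"
    by (simp add: matrix_mult.add_left matrix_mult.add_right ctrans_add)
  also have "\<dots> = 0" by (simp only: D G left_minus)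
  finally have "ctrans U ** (D + G) + ctrans (D + G) ** U = 0" .
  then show "DY \<xi> + christoffel x \<xi> (Y x) \<in> Mbar_tan x"
    using s christoffel_snd_herm[OF x \<xi> t[OF x]]
    by (simp add: Mbar_tan_def hermitian_mats_def ctrans_add U_def D_def G_def)
qed

text \<open>Linear functions separate tangent vectors, so the torsion identity, stated through
  derivations, becomes one between vectors.\<close>

lemma smooth_fun_inner: "smooth_fun Mbar (\<lambda>y. e \<bullet> y)"
  by (intro smooth_on_imp_smooth_fun smooth_intros open_UNIV)

lemma Mbar_deriv_inner:
  assumes "x \<in> Mbar" "v \<in> Mbar_tan x" "(Y has_derivative D) (at x within Mbar)"
  shows "Mbar_deriv x v (\<lambda>y. e \<bullet> Y y) = e \<bullet> D v"
  by (rule Mbar_deriv_eq[OF assms(1,2) has_derivative_inner_right[OF assms(3)]])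

text \<open>
  The difference tensor of two torsion-free metric connections is symmetric in its first two and
  skew in its last two arguments, hence vanishes.
\<close>

lemma levi_civita_Mbar_unique:
  fixes x :: "('p::finite, 'k::finite) amb"
  assumes \<alpha>: "\<alpha> > 0" and \<beta>: "\<beta> > - \<alpha> / real CARD('k)"
    and LC: "levi_civita (Mbar_riem \<alpha> \<beta>) nabla" and x: "x \<in> Mbar" and \<xi>: "\<xi> \<in> Mbar_tan x"
    and f: "tangent_field Y" and Y: "(Y has_derivative DY) (at x within Mbar)"
  shows "nabla x \<xi> Y = DY \<xi> + christoffel x \<xi> (Y x)"
proof -
  define d where "d Y = frechet_derivative Y (at x within Mbar)" for Y :: "('p, 'k) amb \<Rightarrow> ('p, 'k) amb"
  have d: "(Y has_derivative d Y) (at x within Mbar)" if "tangent_field Y" for Y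
    unfolding d_def by (rule smooth_fun_has_derivative_Mbar[OF _ x]) (use that in \<open>simp add: tangent_field_def\<close>)
  have tan: "A x \<in> Mbar_tan x" if "tangent_field A" for A
    using that x by (simp add: tangent_field_def)
  \<comment> \<open>The difference of \<open>nabla\<close> and the explicit connection, evaluated on
    fields at the single point \<open>x\<close>.\<close>
  define T where "T A B = nabla x (A x) B - (d B (A x) + christoffel x (A x) (B x))" for A B
  have nt: "nabla x (A x) B \<in> Mbar_tan x" if "tangent_field A" "tangent_field B" for A B
    using LC tan[OF that(1)] x tangent_field_vector_field[OF that(2), of \<alpha> \<beta>]
    unfolding levi_civita_def affine_connection_def Mbar_riem_simps by blast
  have Tt: "T A B \<in> Mbar_tan x" if "tangent_field A" "tangent_field B" for A B
    unfolding T_def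
    by (intro Mbar_tan_diff nt that tangent_field_derivative_tangent(2)[OF x that(2) d] tan)
  have sym: "T A B = T B A" if A: "tangent_field A" and B: "tangent_field B" for A B
  proof -
    have "e \<bullet> (nabla x (A x) B - nabla x (B x) A) = e \<bullet> (d B (A x) - d A (B x))" for e
    proof -
      have act: "Mbar_deriv y v (\<lambda>y. e \<bullet> y) = e \<bullet> v" if "y \<in> Mbar" "v \<in> Mbar_tan y" for y v
        using Mbar_deriv_inner[OF that has_derivative_ident] .
      have "torsion_free (Mbar_riem \<alpha> \<beta>) nabla" using LC by (simp add: levi_civita_def)
      then have "Mbar_deriv x (nabla x (A x) B - nabla x (B x) A) (\<lambda>y. e \<bullet> y) =
          Mbar_deriv x (A x) (\<lambda>y. Mbar_deriv y (B y) (\<lambda>y. e \<bullet> y))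
          - Mbar_deriv x (B x) (\<lambda>y. Mbar_deriv y (A y) (\<lambda>y. e \<bullet> y))"
        using tangent_field_vector_field[OF A, of \<alpha> \<beta>] tangent_field_vector_field[OF B, of \<alpha> \<beta>] x
          smooth_fun_inner[of e]
        unfolding torsion_free_def Mbar_riem_simps by simp
      moreover have "Mbar_deriv x (A x) (\<lambda>y. Mbar_deriv y (B y) (\<lambda>y. e \<bullet> y)) = e \<bullet> d B (A x)"
        if A: "tangent_field A" and B: "tangent_field B" for A B
      proof -
        have "Mbar_deriv x (A x) (\<lambda>y. Mbar_deriv y (B y) (\<lambda>y. e \<bullet> y)) = Mbar_deriv x (A x) (\<lambda>y. e \<bullet> B y)"
          by (rule Mbar_deriv_cong[OF x act]) (use B in \<open>auto simp: tangent_field_def\<close>)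
        then show ?thesis using Mbar_deriv_inner[OF x tan[OF A] d[OF B]] by simp
      qed
      ultimately show ?thesis
        using act[OF x Mbar_tan_diff[OF nt[OF A B] nt[OF B A]]] A B by (simp add: inner_diff_right)
    qed
    then have "nabla x (A x) B - nabla x (B x) A = d B (A x) - d A (B x)" using vector_eq_ldot by blast
    then show ?thesis
      unfolding T_def christoffel_sym[of x "B x"] by (simp add: algebra_simps)
  qed
  let ?g = "Mbar_metric \<alpha> \<beta> x"
  have skew: "?g (T A B) (C x) = - ?g (T A C) (B x)"
    if A: "tangent_field A" and B: "tangent_field B" and C: "tangent_field C" for A B C
  proof -
    have "metric_compatible (Mbar_riem \<alpha> \<beta>) nabla" using LC by (simp add: levi_civita_def)
    then have "Mbar_deriv x (A x) (\<lambda>y. Mbar_metric \<alpha> \<beta> y (B y) (C y))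
        = ?g (nabla x (A x) B) (C x) + ?g (B x) (nabla x (A x) C)"
      using tangent_field_vector_field[OF B, of \<alpha> \<beta>] tangent_field_vector_field[OF C, of \<alpha> \<beta>] x tan[OF A]
      unfolding metric_compatible_def Mbar_riem_simps by blast
    also have "?g (B x) (nabla x (A x) C) = ?g (nabla x (A x) C) (B x)"
      by (rule Mbar_metric_sym[OF x tan[OF B] nt[OF A C]])
    finally show ?thesis
      using Mbar_metric_compat[OF x B C d[OF B] d[OF C] tan[OF A]
          tangent_field_derivative_tangent(1)[OF x B d[OF B] tan[OF A]]
          tangent_field_derivative_tangent(1)[OF x C d[OF C] tan[OF A]], of \<alpha> \<beta>]
      unfolding T_def Mbar_metric_diff_left by simp
  qed
  \<comment> \<open>Alternating the skewness and the symmetry of \<open>T\<close> three times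
    returns to the same expression with the opposite sign.\<close>
  have zero: "?g (T A B) (C x) = 0"
    if A: "tangent_field A" and B: "tangent_field B" and C: "tangent_field C" for A B C
    using skew[OF A B C] skew[OF C A B] skew[OF B C A] sym[OF A B] sym[OF A C] sym[OF B C] by simp
  \<comment> \<open>The symmetry argument needs fields in every slot, so \<xi> is extended to
    one.\<close>
  define A where "A = tan_proj \<xi>"
  have A: "tangent_field A" "A x = \<xi>" by (simp_all add: A_def tangent_field_tan_proj tan_proj_id[OF \<xi>])
  have "T A Y = 0"
  proof (rule Mbar_metric_eqI[OF \<alpha> \<beta> x Tt[OF A(1) f] _ order.refl subspace_Mbar_tan])
    show "0 \<in> Mbar_tan x" using subspace_Mbar_tan by (rule subspace_0)
    fix \<zeta> assume "\<zeta> \<in> Mbar_tan x"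
    then show "?g (T A Y) \<zeta> = ?g 0 \<zeta>"
      using zero[OF A(1) f tangent_field_tan_proj[of \<zeta>]] Mbar_metric_scaleR_left[of \<alpha> \<beta> x 0 0 \<zeta>]
      by (simp add: tan_proj_id)
  qed
  moreover have "d Y \<xi> = DY \<xi>" by (rule has_derivative_within_Mbar_unique[OF x \<xi> d[OF f] Y])
  ultimately show ?thesis by (simp add: T_def A(2))
qed

section \<open>The derivative of the gradient and the Hessian on \<open>Mbar\<close>\<close>

lemma tan_grad_has_derivative:
  fixes x :: "('p::finite, 'k::finite) amb"
  assumes E: "(E has_derivative DE) (at x within M)"
  shows "((\<lambda>y. tan_grad \<alpha> \<beta> y (E y)) has_derivative (\<lambda>v.
    (fst (DE v) - (fst v ** ctrans (fst (E x)) ** fst x + fst x ** ctrans (fst (DE v)) ** fst x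
        + fst x ** ctrans (fst (E x)) ** fst v),
     (1 / \<alpha>) *\<^sub>R (snd v ** herm (snd (E x)) ** snd x + snd x ** herm (snd (DE v)) ** snd x
        + snd x ** herm (snd (E x)) ** snd v)
     - ((\<beta> * Re (trace (snd (DE v) ** snd x + snd (E x) ** snd v)) / (\<alpha> * (\<alpha> + real CARD('k) * \<beta>))) *\<^sub>R snd x
        + (\<beta> * Re (trace (snd (E x) ** snd x)) / (\<alpha> * (\<alpha> + real CARD('k) * \<beta>))) *\<^sub>R snd v)))) (at x within M)"
proof -
  let ?F = "at x within M"
  have h: "bounded_linear (herm :: complex^'k^'k \<Rightarrow> _)"
    unfolding herm_def[abs_def]
    by (intro bounded_linear_scaleR_right[THEN bounded_linear_compose] bounded_linear_add
        bounded_linear_ident bounded_linear_ctrans)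
  have f: "(fst has_derivative fst) ?F" and s: "(snd has_derivative snd) ?F"
    by (intro has_derivative_fst has_derivative_snd has_derivative_ident)+
  note fE = has_derivative_fst[OF E] and sE = has_derivative_snd[OF E]
  note c = bounded_linear.has_derivative[OF bounded_linear_ctrans]
  note 1 = has_derivative_diff[OF fE matrix_mult.FDERIV[OF matrix_mult.FDERIV[OF f c[OF fE]] f]]
  note 2 = bounded_linear.has_derivative[OF bounded_linear_scaleR_right[of "1/\<alpha>"]
      matrix_mult.FDERIV[OF matrix_mult.FDERIV[OF s bounded_linear.has_derivative[OF h sE]] s]]
  note 3 = has_derivative_scaleR[OF bounded_linear.has_derivative[OF
        bounded_linear_mult_right[of "\<beta> / (\<alpha> * (\<alpha> + real CARD('k) * \<beta>))"] has_derivative_inner[OF c[OF sE] s]] s]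
  show ?thesis
    unfolding tan_grad_eq
    by (rule has_derivative_eq_rhs[OF has_derivative_Pair[OF 1 has_derivative_diff[OF 2 3]]])
      (simp add: fun_eq_iff trace_add Re_trace_mult matrix_mult.add_left algebra_simps add_divide_distrib
        scaleR_add_left)
qed

text \<open>The product rule for the gradient \<open>Y\<close> plus the Christoffel form, with
  \<open>H\<close> the derivative of the Euclidean gradient \<open>A\<close>. The identity is linear
  in \<open>A\<close> and \<open>H\<close> and uses only \<open>U^H U = 1\<close> and skewness of
  \<open>U^H X\<close>.\<close>

lemma stiefel_hessian:
  fixes U X A H :: "complex^'k^'p"
  assumes U: "ctrans U ** U = mat 1" and X: "ctrans (ctrans U ** X) = - (ctrans U ** X)"
  defines "Y \<equiv> A - U ** ctrans A ** U"
  shows "H - (X ** ctrans A ** U + U ** ctrans H ** U + U ** ctrans A ** X)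
      + (1/2) *\<^sub>R (X ** ctrans Y ** U + Y ** ctrans X ** U
        + U ** (ctrans X ** (mat 1 - U ** ctrans U) ** Y + ctrans Y ** (mat 1 - U ** ctrans U) ** X))
    = H - U ** ctrans H ** U - U ** skew (ctrans A ** X) + skew (A ** ctrans X) ** U
      - (1/2) *\<^sub>R ((mat 1 - U ** ctrans U) ** X ** ctrans U ** A)"
proof -
  have XU: "ctrans X ** U = - (ctrans U ** X)" using X by (simp add: ctrans_simps)
  \<comment> \<open>These rules give a normal form: each \<open>X^H U\<close> becomes
    \<open>- U^H X\<close>, also inside longer products.\<close>
  have r: "ctrans X ** (U ** M) = - (ctrans U ** (X ** M))" "ctrans U ** (U ** M) = M"
    for M :: "complex^'b^'k"
    using arg_cong[OF XU, of "\<lambda>N. N ** M"] by (simp_all add: matrix_mult.minus_left U matrix_mul_assoc)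
  have "2 *\<^sub>R (H - (X ** ctrans A ** U + U ** ctrans H ** U + U ** ctrans A ** X))
      + (X ** ctrans Y ** U + Y ** ctrans X ** U
        + U ** (ctrans X ** (mat 1 - U ** ctrans U) ** Y + ctrans Y ** (mat 1 - U ** ctrans U) ** X))
    = 2 *\<^sub>R (H - U ** ctrans H ** U) - U ** (ctrans A ** X - ctrans X ** A) + (A ** ctrans X - X ** ctrans A) ** U
      - (mat 1 - U ** ctrans U) ** X ** ctrans U ** A" (is "?l = ?r")
    unfolding Y_def
    by (simp add: ctrans_simps matrix_mult_simps XU r U scaleR_2 scaleR_diff_right scaleR_add_right)
  then have "(1/2) *\<^sub>R ?l = (1/2) *\<^sub>R ?r" by simp
  then show ?thesis
    unfolding skew_def
    by (simp add: ctrans_simps matrix_mult.scaleR_left matrix_mult.scaleR_right matrix_mult.diff_left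
        matrix_mult.diff_right scaleR_diff_right scaleR_add_right)
qed

lemma hessian_Mbar:
  fixes U X A HU :: "complex^'k::finite^'p::finite" and S Z B HS :: "complex^'k^'k"
  assumes \<alpha>: "\<alpha> > 0" and \<beta>: "\<beta> > - \<alpha> / real CARD('k)"
    and LC: "levi_civita (Mbar_riem \<alpha> \<beta>) nabla" and x: "(U, S) \<in> Mbar" and \<xi>: "(X, Z) \<in> Mbar_tan (U, S)"
    and u: "smooth_fun Mbar u" and ext: "smooth_extension Mbar u W F" "(U, S) \<in> W"
    and G: "euclid_grad F (U, S) = (A, B)" and H: "euclid_hess F (U, S) (X, Z) = (HU, HS)"
  shows "riem_hess (Mbar_riem \<alpha> \<beta>) nabla u (U, S) (X, Z) =
    (HU - U ** ctrans HU ** U - U ** skew (ctrans A ** X) + skew (A ** ctrans X) ** U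
       - (1/2) *\<^sub>R ((mat 1 - U ** ctrans U) ** X ** ctrans U ** A),
     (1 / \<alpha>) *\<^sub>R (S ** herm HS ** S + herm (S ** herm B ** Z))
       - (\<beta> * Re (trace (HS ** S + B ** Z)) / (\<alpha> * (\<alpha> + real CARD('k) * \<beta>))) *\<^sub>R S)"
proof -
  let ?x = "(U, S)" and ?Y = "riem_grad (Mbar_riem \<alpha> \<beta>) u"
  let ?c = "\<beta> * Re (trace (B ** S)) / (\<alpha> * (\<alpha> + real CARD('k) * \<beta>))"
  let ?c' = "\<beta> * Re (trace (HS ** S + B ** Z)) / (\<alpha> * (\<alpha> + real CARD('k) * \<beta>))"
  have W: "open W" "smooth_on W F" using ext(1) by (auto simp: smooth_extension_def)
  have E: "(euclid_grad F has_derivative euclid_hess F ?x) (at ?x)"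
    unfolding euclid_hess_def[abs_def]
    using smooth_on_has_derivative[OF smooth_on_euclid_grad[OF W] ext(2)] by simp
  have eq: "tan_grad \<alpha> \<beta> y (euclid_grad F y) = ?Y y" if "y \<in> W" "y \<in> Mbar" for y
    using tan_grad_extension(2)[OF \<alpha> \<beta> ext(1) that] by simp
  note D = extension_has_derivative_within[OF W(1) ext(2) x tan_grad_has_derivative[OF E, of \<alpha> \<beta>] eq]
  note d = MbarD[OF x, simplified] and t = Mbar_tanD[OF \<xi>, simplified]
  have Yx: "?Y ?x = (A - U ** ctrans A ** U, (1 / \<alpha>) *\<^sub>R (S ** herm B ** S) - ?c *\<^sub>R S)"
    using tan_grad_extension(2)[OF \<alpha> \<beta> ext(1) ext(2) x] by (simp add: tan_grad_def G)
  let ?P = "matrix_inv S"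
  have PS: "?P ** (S ** M) = M" for M :: "complex^'k^'k" using d by (simp add: matrix_mul_assoc)
  have SP: "S ** (?P ** M) = M" for M :: "complex^'k^'k" using d by (simp add: matrix_mul_assoc)
  \<comment> \<open>The part \<open>- ?c S\<close> of the gradient yields \<open>- ?c Z\<close> in
    both products, so the Christoffel form contributes \<open>+ ?c Z\<close>, which cancels the
    \<open>- ?c Z\<close> from differentiating the factor \<open>S\<close>.\<close>
  have chr: "snd (christoffel ?x (X, Z) (?Y ?x)) =
      - ((1/2) *\<^sub>R ((1/\<alpha>) *\<^sub>R (Z ** herm B ** S + S ** herm B ** Z) - (2 * ?c) *\<^sub>R Z))"
  proof -
    have "Z ** ?P ** snd (?Y ?x) = (1/\<alpha>) *\<^sub>R (Z ** herm B ** S) - ?c *\<^sub>R Z"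
      "snd (?Y ?x) ** ?P ** Z = (1/\<alpha>) *\<^sub>R (S ** herm B ** Z) - ?c *\<^sub>R Z"
      unfolding Yx by (simp_all add: matrix_mult_simps PS SP d)
    moreover have "a - c + (b - c) = a + b - 2 *\<^sub>R c" for a b c :: "complex^'k^'k"
      by (simp add: scaleR_2)
    ultimately show ?thesis
      unfolding christoffel_def Let_def fst_conv snd_conv by (simp only: scaleR_add_right scaleR_scaleR)
  qed
  have hh: "herm (S ** herm B ** Z) = (1/2) *\<^sub>R (S ** herm B ** Z + Z ** herm B ** S)"
    by (simp add: herm_def[of "_ ** Z"] ctrans_mult d t matrix_mul_assoc)
  have "nabla ?x (X, Z) ?Y = (HU - (X ** ctrans A ** U + U ** ctrans HU ** U + U ** ctrans A ** X),
     (1 / \<alpha>) *\<^sub>R (Z ** herm B ** S + S ** herm HS ** S + S ** herm B ** Z) - (?c' *\<^sub>R S + ?c *\<^sub>R Z))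
     + christoffel ?x (X, Z) (?Y ?x)"
    using levi_civita_Mbar_unique[OF \<alpha> \<beta> LC x \<xi> tangent_field_riem_grad[OF \<alpha> \<beta> u] D] by (simp add: G H)
  also have "\<dots> = (HU - U ** ctrans HU ** U - U ** skew (ctrans A ** X) + skew (A ** ctrans X) ** U
       - (1/2) *\<^sub>R ((mat 1 - U ** ctrans U) ** X ** ctrans U ** A),
     (1 / \<alpha>) *\<^sub>R (S ** herm HS ** S + herm (S ** herm B ** Z)) - ?c' *\<^sub>R S)"
  proof (rule prod_eqI, goal_cases)
    case 1
    show ?case
      using stiefel_hessian[OF d(1) t(3), of HU A] by (simp add: christoffel_def Let_def Yx)
  next
    case 2
    \<comment> \<open>Subtracting half of \<open>a + b\<close> leaves the other half, which is the
      Hermitian part \<open>hh\<close>; the terms in \<open>c\<close> disappear.\<close>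
    have e: "a + h + b - (p + c) + - ((1/2) *\<^sub>R (a + b - 2 *\<^sub>R c)) = h + (1/2) *\<^sub>R (b + a) - p"
      for a b c h p :: "complex^'k^'k"
      by (simp add: vec_eq_iff complex_eq_iff field_simps)
    show ?case
      unfolding snd_add chr hh snd_conv
      using e[of "(1/\<alpha>) *\<^sub>R (Z ** herm B ** S)" "(1/\<alpha>) *\<^sub>R (S ** herm HS ** S)" "(1/\<alpha>) *\<^sub>R (S ** herm B ** Z)"
          "?c' *\<^sub>R S" "?c *\<^sub>R Z"]
      by (simp add: scaleR_add_right mult.commute)
  qed
  finally show ?thesis by (simp add: riem_hess_def)
qed

subsection \<open>A Koszul formula for gradient fields\<close>

text \<open>
  For gradient fields the Koszul formula needs no Lie brackets, because
  \<open>g (nabla\<^sub>A B) C\<close> is the Hessian of \<open>b\<close> and therefore symmetric in \<open>A\<close> and \<open>C\<close>.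
\<close>

lemma koszul_gradients:
  fixes R :: "('m, 't::real_vector) riem"
  assumes LC: "levi_civita R nabla"
    and sym: "\<And>y v w. y \<in> pts R \<Longrightarrow> v \<in> tan_sp R y \<Longrightarrow> w \<in> tan_sp R y \<Longrightarrow> metric R y v w = metric R y w v"
    and act_diff: "\<And>y v w h. y \<in> pts R \<Longrightarrow> v \<in> tan_sp R y \<Longrightarrow> w \<in> tan_sp R y \<Longrightarrow> h \<in> smooth_funs R \<Longrightarrow>
      act R y (v - w) h = act R y v h - act R y w h"
    and act_cong: "\<And>y v g h. y \<in> pts R \<Longrightarrow> v \<in> tan_sp R y \<Longrightarrow> (\<And>z. z \<in> pts R \<Longrightarrow> g z = h z) \<Longrightarrow>
      act R y v g = act R y v h"
    and x: "x \<in> pts R"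
    and A: "A \<in> vector_fields R" "a \<in> smooth_funs R"
      "\<And>y w. y \<in> pts R \<Longrightarrow> w \<in> tan_sp R y \<Longrightarrow> metric R y (A y) w = act R y w a"
    and B: "B \<in> vector_fields R" "b \<in> smooth_funs R"
      "\<And>y w. y \<in> pts R \<Longrightarrow> w \<in> tan_sp R y \<Longrightarrow> metric R y (B y) w = act R y w b"
    and C: "C \<in> vector_fields R" "c \<in> smooth_funs R"
      "\<And>y w. y \<in> pts R \<Longrightarrow> w \<in> tan_sp R y \<Longrightarrow> metric R y (C y) w = act R y w c"
  shows "2 * metric R x (nabla x (A x) B) (C x) =
    act R x (A x) (\<lambda>y. metric R y (B y) (C y)) + act R x (C x) (\<lambda>y. metric R y (A y) (B y))
    - act R x (B x) (\<lambda>y. metric R y (A y) (C y))"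
proof -
  \<comment> \<open>\<open>X\<close> is the gradient field of \<open>u\<close>. Bundling the three
    facts lets the roles of \<open>A\<close>, \<open>B\<close> and \<open>C\<close> be permuted
    freely.\<close>
  define good where "good X u \<longleftrightarrow> X \<in> vector_fields R \<and> u \<in> smooth_funs R \<and>
    (\<forall>y\<in>pts R. \<forall>w\<in>tan_sp R y. metric R y (X y) w = act R y w u)" for X u
  have tan: "X y \<in> tan_sp R y" if "good X u" "y \<in> pts R" for X u y
    using that by (simp add: good_def vector_fields_def)
  have nt: "nabla x (X x) Y \<in> tan_sp R x" if "good X u" "good Y v" for X Y u v
    using LC[unfolded levi_civita_def affine_connection_def, THEN conjunct1, THEN conjunct1] x tan[OF that(1) x] that(2)
    unfolding good_def by simp
  define H where "H X Y Z = metric R x (nabla x (X x) Y) (Z x)" for X Y Z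
  have compat: "act R x (X x) (\<lambda>y. metric R y (Y y) (Z y)) = H X Y Z + H X Z Y"
    if g: "good X u" "good Y v" "good Z w" for X Y Z u v w
  proof -
    have "metric_compatible R nabla" using LC by (simp add: levi_civita_def)
    then have "act R x (X x) (\<lambda>y. metric R y (Y y) (Z y))
      = metric R x (nabla x (X x) Y) (Z x) + metric R x (Y x) (nabla x (X x) Z)"
      using x tan[OF g(1) x] g(2,3) unfolding metric_compatible_def good_def by blast
    then show ?thesis unfolding H_def using sym[OF x tan[OF g(2) x] nt[OF g(1,3)]] by simp
  qed
  have swap: "act R x (X x) (\<lambda>y. metric R y (Y y) (Z y)) = act R x (X x) (\<lambda>y. metric R y (Z y) (Y y))"
    if g: "good X u" "good Y v" "good Z w" for X Y Z u v w
    by (rule act_cong[OF x tan[OF g(1) x]]) (rule sym[OF _ tan[OF g(2)] tan[OF g(3)]])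
  \<comment> \<open>Torsion-freeness applied to the function \<open>v\<close> expresses
    \<open>H X Z Y - H Z X Y\<close> by derivatives of inner products. Expanding these by
    compatibility cancels the same two terms and leaves the symmetry of the Hessian of
    \<open>v\<close>.\<close>
  have H_sym: "H X Y Z = H Z Y X" if g: "good X u" "good Y v" "good Z w" for X Y Z u v w
  proof -
    have "torsion_free R nabla" using LC by (simp add: levi_civita_def)
    then have "act R x (nabla x (X x) Z - nabla x (Z x) X) v =
        act R x (X x) (\<lambda>y. act R y (Z y) v) - act R x (Z x) (\<lambda>y. act R y (X y) v)"
      using x g unfolding torsion_free_def good_def by blast
    moreover have "act R x (X' x) (\<lambda>y. act R y (Z' y) v) = act R x (X' x) (\<lambda>y. metric R y (Y y) (Z' y))"
      if "good X' u'" "good Z' w'" for X' Z' u' w'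
      by (rule act_cong[OF x tan[OF that(1) x]]) (use g(2) tan[OF that(2)] in \<open>simp add: good_def\<close>)
    moreover have "act R x (nabla x (X x) Z - nabla x (Z x) X) v = H X Z Y - H Z X Y"
    proof -
      have "v \<in> smooth_funs R" using g(2) by (simp add: good_def)
      then have "act R x (nabla x (X x) Z - nabla x (Z x) X) v
        = act R x (nabla x (X x) Z) v - act R x (nabla x (Z x) X) v"
        by (rule act_diff[OF x nt[OF g(1,3)] nt[OF g(3,1)]])
      also have "\<dots> = metric R x (Y x) (nabla x (X x) Z) - metric R x (Y x) (nabla x (Z x) X)"
        using g(2) x nt[OF g(1,3)] nt[OF g(3,1)] by (simp add: good_def)
      finally show ?thesis
        unfolding H_def using sym[OF x tan[OF g(2) x] nt[OF g(1,3)]] sym[OF x tan[OF g(2) x] nt[OF g(3,1)]]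
        by simp
    qed
    ultimately have "H X Z Y - H Z X Y = act R x (X x) (\<lambda>y. metric R y (Y y) (Z y))
        - act R x (Z x) (\<lambda>y. metric R y (Y y) (X y))"
      using g(1,3) by simp
    then show ?thesis using compat[OF g] compat[OF g(3,2,1)] by simp
  qed
  have g: "good A a" "good B b" "good C c" using A B C by (auto simp: good_def)
  show ?thesis
    \<comment> \<open>Of the six Hessian terms, symmetry cancels two pairs with opposite signs and
      identifies the remaining two.\<close>
    using compat[OF g] compat[OF g(3,1,2)] compat[OF g(2,1,3)] H_sym[OF g(1,2,3)] H_sym[OF g(3,1,2)]
      H_sym[OF g(1,3,2)]
    by (simp add: H_def)
qed

subsection \<open>The unitary action\<close>

lemma unitary_ctrans: "Q \<in> unitary_mats \<Longrightarrow> ctrans Q \<in> unitary_mats"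
  by (auto simp: unitary_mats_def)

lemma unitary_mult: "Q \<in> unitary_mats \<Longrightarrow> R \<in> unitary_mats \<Longrightarrow> Q ** R \<in> unitary_mats"
  using unitary_mult_left[of Q R] unitary_mult_left[of R "ctrans Q"] unitary_mult_left[of Q "mat 1"]
  by (auto simp: unitary_mats_def ctrans_simps matrix_mul_assoc[symmetric])

lemma unitary_one: "mat 1 \<in> unitary_mats"
  by (simp add: unitary_mats_def)

lemma uaction_one [simp]: "uaction x (mat 1) = x"
  by (simp add: uaction_def)

lemma uaction_uaction: "uaction (uaction x Q) R = uaction x (Q ** R)"
  by (simp add: uaction_def ctrans_mult matrix_mul_assoc)

lemma orbit_self: "x \<in> orbit x"
  unfolding orbit_def by (rule image_eqI[OF _ unitary_one]) simp

lemma orbit_uaction: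
  fixes x :: "('p::finite, 'k::finite) amb"
  assumes "Q \<in> unitary_mats"
  shows "orbit (uaction x Q) = orbit x"
proof -
  have "orbit (uaction y R) \<subseteq> orbit y" if "R \<in> unitary_mats" for y :: "('p, 'k) amb" and R
    unfolding orbit_def using that unitary_mult by (auto simp: uaction_uaction)
  from this[OF assms, of x] this[OF unitary_ctrans[OF assms], of "uaction x Q"] show ?thesis
    using assms by (simp add: uaction_uaction unitary_mats_def)
qed

lemma orbit_eq:
  assumes "y \<in> orbit x"
  shows "orbit y = orbit x"
proof -
  obtain Q where "Q \<in> unitary_mats" "y = uaction x Q" using assms unfolding orbit_def by blast
  then show ?thesis by (simp add: orbit_uaction)
qed

lemma uaction_Mbar:
  fixes x :: "('p::finite, 'k::finite) amb"
  assumes "x \<in> Mbar" "Q \<in> unitary_mats"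
  shows "uaction x Q \<in> Mbar"
proof -
  have "invertible Q" using assms(2) unfolding unitary_mats_def invertible_def by blast
  then have "ctrans Q ** snd x ** Q \<in> hpd_mats" by (rule hpd_congruence[OF MbarD(2)[OF assms(1)]])
  moreover have "ctrans (fst x ** Q) ** (fst x ** Q) = ctrans Q ** (ctrans (fst x) ** fst x) ** Q"
    by (simp add: ctrans_simps matrix_mul_assoc)
  ultimately show ?thesis
    using assms(2) MbarD(1)[OF assms(1)] by (simp add: uaction_def Mbar_def stiefel_def unitary_mats_def)
qed

lemma orbit_Mbar: "x \<in> Mbar \<Longrightarrow> y \<in> orbit x \<Longrightarrow> y \<in> Mbar"
  unfolding orbit_def by (elim imageE) (simp add: uaction_Mbar)

lemma bounded_linear_uaction: "bounded_linear (\<lambda>x. uaction x Q)"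
  unfolding uaction_def
  by (intro bounded_linear_Pair matrix_mult.bounded_linear_left[THEN bounded_linear_compose]
      matrix_mult.bounded_linear_right[THEN bounded_linear_compose] bounded_linear_fst bounded_linear_snd)

lemma uaction_tangent:
  fixes x :: "('p::finite, 'k::finite) amb"
  assumes "\<xi> \<in> Mbar_tan x"
  shows "uaction \<xi> Q \<in> Mbar_tan (uaction x Q)"
proof -
  have "ctrans (fst x ** Q) ** (fst \<xi> ** Q) + ctrans (fst \<xi> ** Q) ** (fst x ** Q)
    = ctrans Q ** (ctrans (fst x) ** fst \<xi> + ctrans (fst \<xi>) ** fst x) ** Q"
    by (simp add: ctrans_simps matrix_mult.add_left matrix_mult.add_right matrix_mul_assoc)
  then show ?thesis
    using assms by (simp add: uaction_def Mbar_tan_def hermitian_mats_def ctrans_simps matrix_mul_assoc)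
qed

text \<open>The inverse transforms to \<open>Q^H P Q\<close>, so every inner product in the metric
  is conjugated or multiplied by unitary matrices.\<close>

lemma uaction_metric:
  fixes x :: "('p::finite, 'k::finite) amb"
  assumes x: "x \<in> Mbar" and Q: "Q \<in> unitary_mats" and \<xi>: "\<xi> \<in> Mbar_tan x" and \<eta>: "\<eta> \<in> Mbar_tan x"
  shows "Mbar_metric \<alpha> \<beta> (uaction x Q) (uaction \<xi> Q) (uaction \<eta> Q) = Mbar_metric \<alpha> \<beta> x \<xi> \<eta>"
proof -
  note q = unitary_mult_left[OF Q]
  have qq: "ctrans Q ** Q = mat 1" "Q ** ctrans Q = mat 1" using Q by (auto simp: unitary_mats_def)
  let ?P = "matrix_inv (snd x)"
  have "(ctrans Q ** snd x ** Q) ** (ctrans Q ** ?P ** Q) = mat 1"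
    by (simp add: matrix_mult_simps q qq MbarD[OF x] matrix_mul_assoc[of "snd x" ?P])
  then have P: "matrix_inv (snd (uaction x Q)) = ctrans Q ** ?P ** Q"
    by (simp add: uaction_def matrix_inv_unique'(2))
  have i1: "(A ** Q) \<bullet> (B ** Q) = A \<bullet> B" for A :: "complex^'k^'c" and B :: "complex^'k^'c"
    using inner_mult_left'[of A Q "B ** Q"] qq by (simp flip: matrix_mul_assoc)
  have i2: "(ctrans Q ** A) \<bullet> (ctrans Q ** B) = A \<bullet> B" for A :: "complex^'k^'k" and B
    using inner_mult_left[of "ctrans Q" A "ctrans Q ** B"] by (simp add: q)
  have tr: "ctrans (fst (uaction x Q)) ** fst (uaction \<xi> Q) = ctrans Q ** (ctrans (fst x) ** fst \<xi>) ** Q" for \<xi>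
    by (simp add: uaction_def ctrans_mult matrix_mul_assoc)
  have pr: "ctrans Q ** ?P ** Q ** snd (uaction \<xi> Q) ** (ctrans Q ** ?P ** Q) = ctrans Q ** (?P ** snd \<xi> ** ?P) ** Q"
    by (simp add: uaction_def matrix_mult_simps q)
  show ?thesis
    using Mbar_metric_eq[OF uaction_Mbar[OF x Q] Mbar_tanD(1)[OF uaction_tangent[OF \<xi>, of Q]], of \<alpha> \<beta> "uaction \<eta> Q"]
      Mbar_metric_eq[OF x Mbar_tanD(1)[OF \<xi>], of \<alpha> \<beta> \<eta>]
    unfolding P tr pr by (simp add: uaction_def i1 i2)
qed

subsection \<open>Vertical and horizontal vectors\<close>

text \<open>An invariant map whose differential has exactly the vertical vectors as its kernel.\<close>

definition quot_embed :: "('p::finite, 'k::finite) amb \<Rightarrow> complex^'p^'p" where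
  "quot_embed x = fst x ** snd x ** ctrans (fst x)"

definition dquot_embed :: "('p::finite, 'k::finite) amb \<Rightarrow> ('p, 'k) amb \<Rightarrow> complex^'p^'p" where
  "dquot_embed x v = fst v ** snd x ** ctrans (fst x) + fst x ** snd v ** ctrans (fst x)
    + fst x ** snd x ** ctrans (fst v)"

lemma quot_embed_uaction: "Q \<in> unitary_mats \<Longrightarrow> quot_embed (uaction x Q) = quot_embed x"
  by (simp add: quot_embed_def uaction_def ctrans_simps unitary_mult_left flip: matrix_mul_assoc)

lemma quot_embed_has_derivative: "(quot_embed has_derivative dquot_embed x) (at x)"
proof -
  have f: "(fst has_derivative fst) (at x)" "(snd has_derivative snd) (at x)"
    by (intro has_derivative_fst has_derivative_snd has_derivative_ident)+
  note c = bounded_linear.has_derivative[OF bounded_linear_ctrans f(1)]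
  show ?thesis
    unfolding quot_embed_def[abs_def]
    by (rule has_derivative_eq_rhs[OF matrix_mult.FDERIV[OF matrix_mult.FDERIV[OF f] c]])
      (simp add: fun_eq_iff dquot_embed_def matrix_mult.add_left algebra_simps)
qed

text \<open>The generator is \<open>A = U^H V\<close>. Multiplying the kernel equation by
  \<open>U\<close> from the right and then by \<open>U^H\<close> from the left determines the second
  component; cancelling the invertible \<open>S\<close> then gives \<open>V = U A\<close>.\<close>

lemma dquot_embed_kernel:
  fixes x :: "('p::finite, 'k::finite) amb"
  assumes x: "x \<in> Mbar" and v: "v \<in> Mbar_tan x" and z: "dquot_embed x v = 0"
  obtains A where "ctrans A = - A" "v = (fst x ** A, snd x ** A - A ** snd x)"
proof
  define U S V Z A where "U = fst x" and "S = snd x" and "V = fst v" and "Z = snd v" and "A = ctrans U ** V"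
  have U: "ctrans U ** U = mat 1" using MbarD(1)[OF x] by (simp add: U_def)
  show A: "ctrans (ctrans (fst x) ** fst v) = - (ctrans (fst x) ** fst v)" by (rule Mbar_tanD(3)[OF v])
  have VU: "ctrans V ** U = - A" using A by (simp add: A_def U_def V_def ctrans_simps)
  have "(V ** S ** ctrans U + U ** Z ** ctrans U + U ** S ** ctrans V) ** U = 0"
    using z by (simp add: dquot_embed_def U_def S_def V_def Z_def)
  then have e: "V ** S + U ** Z - U ** (S ** A) = 0"
    by (simp add: matrix_mult_simps U VU)
  have "ctrans U ** (V ** S + U ** Z - U ** (S ** A)) = A ** S + Z - S ** A"
    by (simp add: A_def matrix_mult.add_right matrix_mult.diff_right matrix_mul_assoc U)
  then have Z: "Z = S ** A - A ** S" using e by (simp add: algebra_simps)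
  have VS: "V ** S = U ** A ** S"
    using e unfolding Z by (simp add: matrix_mult.diff_right matrix_mul_assoc)
  have SP: "S ** matrix_inv S = mat 1" using MbarD(5)[OF x] by (simp add: S_def)
  have "V = U ** A"
    using arg_cong[OF VS, of "\<lambda>M. M ** matrix_inv S"] by (simp add: SP flip: matrix_mul_assoc)
  then show "v = (fst x ** (ctrans (fst x) ** fst v), snd x ** (ctrans (fst x) ** fst v) - ctrans (fst x) ** fst v ** snd x)"
    using Z by (simp add: prod_eq_iff U_def V_def A_def Z_def S_def)
qed

lemma curve_tangent:
  fixes c :: "real \<Rightarrow> ('p::finite, 'k::finite) amb"
  assumes "\<And>t. c t \<in> Mbar" "(c has_vector_derivative v) (at 0)"
  shows "v \<in> Mbar_tan (c 0)"
proof -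
  have d: "(c has_derivative (\<lambda>t. t *\<^sub>R v)) (at 0)" using assms(2) by (simp add: has_vector_derivative_def)
  note f = has_derivative_fst[OF d] and s = has_derivative_snd[OF d]
  note ct = bounded_linear.has_derivative[OF bounded_linear_ctrans]
  have "((\<lambda>t. mat 1) has_derivative (\<lambda>t. ctrans (fst (c 0)) ** fst (t *\<^sub>R v) + ctrans (fst (t *\<^sub>R v)) ** fst (c 0))) (at 0)"
    using matrix_mult.FDERIV[OF ct[OF f] f] by (simp add: MbarD[OF assms(1)])
  from fun_cong[OF has_derivative_unique[OF this has_derivative_const], of 1]
  have 1: "ctrans (fst (c 0)) ** fst v + ctrans (fst v) ** fst (c 0) = 0" by simp
  have "((\<lambda>t. 0) has_derivative (\<lambda>t. ctrans (snd (t *\<^sub>R v)) - snd (t *\<^sub>R v))) (at 0)"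
    using has_derivative_diff[OF ct[OF s] s] by (simp add: MbarD[OF assms(1)])
  from fun_cong[OF has_derivative_unique[OF this has_derivative_const], of 1]
  have "ctrans (snd v) - snd v = 0" by simp
  with 1 show ?thesis by (simp add: Mbar_tan_def hermitian_mats_def)
qed

text \<open>A cycle of inclusions: orbit curves lie in a level set of \<open>quot_embed\<close>,
  kernel vectors have generators, and a generator is realised by a Cayley curve. The kernel form
  shows that velocities make up a subspace, the generator form shows equivariance.\<close>

lemma orbit_tan_eq:
  fixes x :: "('p::finite, 'k::finite) amb"
  assumes x: "x \<in> Mbar"
  shows "orbit_tan x = {v \<in> Mbar_tan x. dquot_embed x v = 0}"
    and "orbit_tan x = {(fst x ** A, snd x ** A - A ** snd x) | A. ctrans A = - A}"
proof -
  have 1: "orbit_tan x \<subseteq> {v \<in> Mbar_tan x. dquot_embed x v = 0}"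
  proof
    fix v assume "v \<in> orbit_tan x"
    then obtain c where c: "c 0 = x" "\<And>t. c t \<in> orbit x" "(c has_vector_derivative v) (at (0::real))"
      unfolding orbit_tan_def by blast
    have "v \<in> Mbar_tan x" using curve_tangent[of c v] orbit_Mbar[OF x c(2)] c by simp
    moreover have "((\<lambda>t. quot_embed (c t)) has_vector_derivative dquot_embed x v) (at 0)"
      by (rule has_vector_derivative_along_curve[OF quot_embed_has_derivative c(1) _ c(3)]) simp
    moreover have "quot_embed (c t) = quot_embed x" for t
      using c(2)[of t] by (auto simp: orbit_def quot_embed_uaction)
    ultimately show "v \<in> {v \<in> Mbar_tan x. dquot_embed x v = 0}"
      using vector_derivative_unique_at[OF _ has_vector_derivative_const] by auto
  qed
  have 2: "{v \<in> Mbar_tan x. dquot_embed x v = 0} \<subseteq> {(fst x ** A, snd x ** A - A ** snd x) | A. ctrans A = - A}"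
    using dquot_embed_kernel[OF x] by blast
  have 3: "{(fst x ** A, snd x ** A - A ** snd x) | A. ctrans A = - A} \<subseteq> orbit_tan x"
  proof clarify
    fix A :: "complex^'k^'k" assume "ctrans A = - A"
    then obtain Q where Q: "\<And>t. Q t \<in> unitary_mats" "Q 0 = mat 1" "(Q has_vector_derivative A) (at (0::real))"
      by (rule cayley_curve) (rule that)
    have d: "(Q has_derivative (\<lambda>t. t *\<^sub>R A)) (at 0)" using Q(3) by (simp add: has_vector_derivative_def)
    note 1 = bounded_linear.has_derivative[OF matrix_mult.bounded_linear_right[of "fst x"] d]
    note 2 = matrix_mult.FDERIV[OF bounded_linear.has_derivative[OF matrix_mult.bounded_linear_left[of "snd x"]
          bounded_linear.has_derivative[OF bounded_linear_ctrans d]] d]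
    have "((\<lambda>t. uaction x (Q t)) has_vector_derivative (fst x ** A, snd x ** A - A ** snd x)) (at 0)"
      unfolding uaction_def has_vector_derivative_def
      by (rule has_derivative_eq_rhs[OF has_derivative_Pair[OF 1 2]])
        (simp add: fun_eq_iff Q(2) ctrans_simps \<open>ctrans A = - A\<close> matrix_mult.scaleR_left matrix_mult.scaleR_right
          matrix_mult.minus_left scaleR_diff_right)
    then show "(fst x ** A, snd x ** A - A ** snd x) \<in> orbit_tan x"
      unfolding orbit_tan_def orbit_def using Q by (intro CollectI exI[of _ "\<lambda>t. uaction x (Q t)"]) auto
  qed
  show "orbit_tan x = {v \<in> Mbar_tan x. dquot_embed x v = 0}"
    "orbit_tan x = {(fst x ** A, snd x ** A - A ** snd x) | A. ctrans A = - A}"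
    using 1 2 3 by blast+
qed

lemma subspace_orbit_tan:
  fixes x :: "('p::finite, 'k::finite) amb"
  assumes "x \<in> Mbar"
  shows "subspace (orbit_tan x)" "orbit_tan x \<subseteq> Mbar_tan x"
proof -
  have "linear (dquot_embed x)" using quot_embed_has_derivative has_derivative_linear by blast
  then have "subspace {v. dquot_embed x v = 0}" by (auto simp: subspace_def linear_0 linear_add linear_scale)
  then have "subspace (Mbar_tan x \<inter> {v. dquot_embed x v = 0})" by (rule subspace_inter[OF subspace_Mbar_tan])
  then show "subspace (orbit_tan x)" "orbit_tan x \<subseteq> Mbar_tan x"
    unfolding orbit_tan_eq(1)[OF assms] by (auto simp: Int_def)
qed

lemma subspace_horizontal: "subspace (horizontal \<alpha> \<beta> x)"
  unfolding subspace_def horizontal_def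
  using subspace_Mbar_tan[of x] Mbar_metric_scaleR_left[of \<alpha> \<beta> x 0 0]
  by (auto simp: subspace_0 subspace_add subspace_scale Mbar_metric_add_left Mbar_metric_scaleR_left)

lemma horizontal_tan: "horizontal \<alpha> \<beta> x \<subseteq> Mbar_tan x"
  by (auto simp: horizontal_def)

lemma uaction_horizontal:
  fixes x :: "('p::finite, 'k::finite) amb"
  assumes x: "x \<in> Mbar" and Q: "Q \<in> unitary_mats" and \<xi>: "\<xi> \<in> horizontal \<alpha> \<beta> x"
  shows "uaction \<xi> Q \<in> horizontal \<alpha> \<beta> (uaction x Q)"
proof -
  note q = unitary_mult_left[OF Q]
  have t: "\<xi> \<in> Mbar_tan x" using \<xi> horizontal_tan by blast
  have "Mbar_metric \<alpha> \<beta> (uaction x Q) (uaction \<xi> Q) v = 0" if v: "v \<in> orbit_tan (uaction x Q)" for v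
  proof -
    obtain A where A: "ctrans A = - A"
      "v = (fst (uaction x Q) ** A, snd (uaction x Q) ** A - A ** snd (uaction x Q))"
      using v unfolding orbit_tan_eq(2)[OF uaction_Mbar[OF x Q]] by blast
    \<comment> \<open>The generator at \<open>x\<close> whose vertical vector is carried to
      \<open>v\<close> by \<open>Q\<close>.\<close>
    define B where "B = Q ** A ** ctrans Q"
    have "ctrans B = - B" by (simp add: B_def ctrans_simps A(1) matrix_mult_simps)
    then have w: "(fst x ** B, snd x ** B - B ** snd x) \<in> orbit_tan x"
      unfolding orbit_tan_eq(2)[OF x] by blast
    have qq: "ctrans Q ** Q = mat 1" using Q by (simp add: unitary_mats_def)
    have "v = uaction (fst x ** B, snd x ** B - B ** snd x) Q"
      by (simp add: A(2) uaction_def B_def matrix_mult_simps q qq)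
    then show ?thesis
      using uaction_metric[OF x Q t, of "(fst x ** B, snd x ** B - B ** snd x)"] w \<xi>
        subspace_orbit_tan(2)[OF x] by (auto simp: horizontal_def)
  qed
  then show ?thesis using uaction_tangent[OF t] by (simp add: horizontal_def)
qed

lemma Mbar_deriv_linear:
  assumes "x \<in> Mbar" "\<xi> \<in> Mbar_tan x" "\<eta> \<in> Mbar_tan x" "smooth_fun Mbar u"
  shows "Mbar_deriv x (\<xi> - \<eta>) u = Mbar_deriv x \<xi> u - Mbar_deriv x \<eta> u"
  using has_derivative_linear[OF smooth_fun_has_derivative_Mbar[OF assms(4,1)]]
  unfolding Mbar_deriv_def by (rule linear_diff)

lemma quot_smooth_iff: "h \<in> quot_smooth \<longleftrightarrow> smooth_fun Mbar (h \<circ> orbit)"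
  by (simp add: quot_smooth_def)

lemma Dpi_diff:
  assumes "x \<in> Mbar" "\<xi> \<in> Mbar_tan x" "\<eta> \<in> Mbar_tan x"
  shows "Dpi x (\<xi> - \<eta>) = Dpi x \<xi> - Dpi x \<eta>"
  using Mbar_deriv_linear[OF assms] by (auto simp: Dpi_def fun_eq_iff quot_smooth_iff)

lemma Dpi_vertical:
  fixes x :: "('p::finite, 'k::finite) amb"
  assumes x: "x \<in> Mbar" and v: "v \<in> orbit_tan x"
  shows "Dpi x v = 0"
proof -
  obtain c where c: "c 0 = x" "\<And>t. c t \<in> orbit x" "(c has_vector_derivative v) (at (0::real))"
    using v unfolding orbit_tan_def by blast
  have "Mbar_deriv x v (h \<circ> orbit) = 0" if h: "h \<in> quot_smooth" for h
  proof -
    have "smooth_fun Mbar (h \<circ> orbit)" using h by (simp add: quot_smooth_iff)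
    from has_vector_derivative_along_curve[OF smooth_fun_has_derivative_Mbar[OF this x] c(1) _ c(3)]
    have "((\<lambda>t. (h \<circ> orbit) (c t)) has_vector_derivative Mbar_deriv x v (h \<circ> orbit)) (at 0)"
      using orbit_Mbar[OF x c(2)] by (simp add: Mbar_deriv_def)
    moreover have "(h \<circ> orbit) (c t) = h (orbit x)" for t using orbit_eq[OF c(2)] by simp
    ultimately show ?thesis
      using vector_derivative_unique_at[OF _ has_vector_derivative_const] by simp
  qed
  then show ?thesis by (auto simp: Dpi_def fun_eq_iff)
qed

text \<open>Functions of orbits are unchanged under the action, which is linear in the point; the
  chain rule gives the claim.\<close>

lemma Dpi_uaction:
  fixes x :: "('p::finite, 'k::finite) amb"
  assumes x: "x \<in> Mbar" and Q: "Q \<in> unitary_mats" and \<xi>: "\<xi> \<in> Mbar_tan x"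
  shows "Dpi (uaction x Q) (uaction \<xi> Q) = Dpi x \<xi>"
proof -
  have "Mbar_deriv (uaction x Q) (uaction \<xi> Q) u = Mbar_deriv x \<xi> u"
    if h: "h \<in> quot_smooth" and u: "u = h \<circ> orbit" for h u
  proof -
    have s: "smooth_fun Mbar u" using h u by (simp add: quot_smooth_iff)
    let ?D = "frechet_derivative u (at (uaction x Q) within Mbar)"
    have L: "((\<lambda>y. uaction y Q) has_derivative (\<lambda>y. uaction y Q)) (at x within Mbar)"
      by (rule bounded_linear_imp_has_derivative[OF bounded_linear_uaction])
    have sub: "(\<lambda>y :: ('p, 'k) amb. uaction y Q) ` Mbar \<subseteq> Mbar"
      using uaction_Mbar[OF _ Q] by (auto simp only: image_subset_iff)
    have "(u has_derivative ?D) (at (uaction x Q) within (\<lambda>y. uaction y Q) ` Mbar)"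
      by (rule has_derivative_subset[OF smooth_fun_has_derivative_Mbar[OF s uaction_Mbar[OF x Q]] sub])
    from diff_chain_within[OF L this]
    have "((\<lambda>y. u (uaction y Q)) has_derivative (\<lambda>v. ?D (uaction v Q))) (at x within Mbar)"
      by (simp add: comp_def)
    moreover have "u (uaction y Q) = u y" for y by (simp add: u orbit_uaction[OF Q])
    ultimately have "(u has_derivative (\<lambda>v. ?D (uaction v Q))) (at x within Mbar)" by simp
    from Mbar_deriv_eq[OF x \<xi> this] show ?thesis by (simp add: Mbar_deriv_def)
  qed
  then show ?thesis by (auto simp: Dpi_def fun_eq_iff)
qed

text \<open>Linear functionals of \<open>quot_embed\<close>, as functions of orbits. Invariance
  makes the choice of the representative immaterial.\<close>

definition coord :: "complex^'p^'p \<Rightarrow> ('p::finite, 'k::finite) amb set \<Rightarrow> real" where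
  "coord E \<theta> = E \<bullet> quot_embed (SOME y. y \<in> \<theta>)"

lemma coord_orbit: "coord E \<circ> orbit = (\<lambda>y :: ('p::finite, 'k::finite) amb. E \<bullet> quot_embed y)"
proof
  fix y :: "('p, 'k) amb"
  have "(SOME z. z \<in> orbit y) \<in> orbit y" using orbit_self by (rule someI)
  then obtain Q where "Q \<in> unitary_mats" "(SOME z. z \<in> orbit y) = uaction y Q"
    unfolding orbit_def by blast
  then show "(coord E \<circ> orbit) y = E \<bullet> quot_embed y" by (simp add: coord_def quot_embed_uaction)
qed

lemma coord_smooth: "coord E \<in> quot_smooth"
  unfolding quot_smooth_iff coord_orbit quot_embed_def
  by (intro smooth_on_imp_smooth_fun smooth_intros open_UNIV)

lemma Mbar_deriv_coord:
  assumes "x \<in> Mbar" "\<xi> \<in> Mbar_tan x"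
  shows "Mbar_deriv x \<xi> (coord E \<circ> orbit) = E \<bullet> dquot_embed x \<xi>"
  unfolding coord_orbit
  by (rule Mbar_deriv_eq[OF assms has_derivative_inner_right[OF has_derivative_at_withinI[OF quot_embed_has_derivative]]])

subsection \<open>The quotient metric and its gradients\<close>

context
  fixes \<alpha> \<beta> :: real and k :: "'k::finite itself"
  assumes \<alpha>: "\<alpha> > 0" and \<beta>: "\<beta> > - \<alpha> / real CARD('k)"
begin

lemma horizontal_vertical_zero:
  fixes x :: "('p::finite, 'k) amb"
  assumes x: "x \<in> Mbar" and "v \<in> horizontal \<alpha> \<beta> x" "v \<in> orbit_tan x"
  shows "v = 0"
  using assms Mbar_metric_pos[OF \<alpha> \<beta> x, of v] by (force simp: horizontal_def)

lemma horizontal_decomposition: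
  fixes x :: "('p::finite, 'k) amb"
  assumes x: "x \<in> Mbar" and \<xi>: "\<xi> \<in> Mbar_tan x"
  shows "\<exists>v\<in>orbit_tan x. \<xi> - v \<in> horizontal \<alpha> \<beta> x"
proof -
  obtain v where "v \<in> orbit_tan x" "\<forall>w\<in>orbit_tan x. Mbar_metric \<alpha> \<beta> x (\<xi> - v) w = 0"
    using Mbar_projection[OF \<alpha> \<beta> x \<xi> subspace_orbit_tan(2)[OF x] subspace_orbit_tan(1)[OF x]] by blast
  then show ?thesis
    using Mbar_tan_diff[OF \<xi>] subspace_orbit_tan(2)[OF x] unfolding horizontal_def by blast
qed

lemma horizontal_proj_eqI:
  fixes x :: "('p::finite, 'k) amb"
  assumes x: "x \<in> Mbar" and \<eta>: "\<eta> \<in> horizontal \<alpha> \<beta> x"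
    "\<And>\<zeta>. \<zeta> \<in> horizontal \<alpha> \<beta> x \<Longrightarrow> Mbar_metric \<alpha> \<beta> x \<xi> \<zeta> = Mbar_metric \<alpha> \<beta> x \<eta> \<zeta>"
  shows "horizontal_proj \<alpha> \<beta> x \<xi> = \<eta>"
  unfolding horizontal_proj_def
proof (rule the_equality)
  show "\<eta> \<in> horizontal \<alpha> \<beta> x \<and> (\<forall>\<zeta>\<in>horizontal \<alpha> \<beta> x. Mbar_metric \<alpha> \<beta> x (\<xi> - \<eta>) \<zeta> = 0)"
    using \<eta> by (simp add: Mbar_metric_diff_left)
  fix \<eta>' assume \<eta>': "\<eta>' \<in> horizontal \<alpha> \<beta> x \<and> (\<forall>\<zeta>\<in>horizontal \<alpha> \<beta> x. Mbar_metric \<alpha> \<beta> x (\<xi> - \<eta>') \<zeta> = 0)"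
  show "\<eta>' = \<eta>"
    by (rule Mbar_metric_eqI[OF \<alpha> \<beta> x _ \<eta>(1) horizontal_tan subspace_horizontal])
      (use \<eta>' \<eta>(2) in \<open>auto simp: Mbar_metric_diff_left\<close>)
qed

text \<open>The functions \<open>coord E\<close> recover \<open>dquot_embed\<close> from the
  derivation, so the difference of the two vectors is vertical as well as horizontal.\<close>

lemma Dpi_inj:
  fixes x :: "('p::finite, 'k) amb"
  assumes x: "x \<in> Mbar" and \<xi>: "\<xi> \<in> horizontal \<alpha> \<beta> x" and \<eta>: "\<eta> \<in> horizontal \<alpha> \<beta> x"
    and eq: "Dpi x \<xi> = Dpi x \<eta>"
  shows "\<xi> = \<eta>"
proof -
  have t: "\<xi> \<in> Mbar_tan x" "\<eta> \<in> Mbar_tan x" using \<xi> \<eta> horizontal_tan by blast+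
  note td = Mbar_tan_diff[OF t]
  have "E \<bullet> dquot_embed x (\<xi> - \<eta>) = 0" for E
  proof -
    have "Dpi x (\<xi> - \<eta>) (coord E) = 0" by (simp add: Dpi_diff[OF x t] eq)
    then show ?thesis by (simp add: Dpi_def coord_smooth Mbar_deriv_coord[OF x td])
  qed
  then have "dquot_embed x (\<xi> - \<eta>) = 0" by (metis inner_eq_zero_iff)
  then have "\<xi> - \<eta> \<in> orbit_tan x" using td unfolding orbit_tan_eq(1)[OF x] by simp
  with horizontal_vertical_zero[OF x subspace_diff[OF subspace_horizontal \<xi> \<eta>]] show ?thesis by simp
qed

lemma horizontal_rep_Dpi:
  fixes x :: "('p::finite, 'k) amb"
  assumes "x \<in> Mbar" "\<xi> \<in> horizontal \<alpha> \<beta> x"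
  shows "horizontal_rep \<alpha> \<beta> x (Dpi x \<xi>) = \<xi>"
  unfolding horizontal_rep_def by (rule the_equality) (use assms Dpi_inj[OF assms(1)] in auto)

text \<open>\<open>quot_tan\<close> collects vectors from all points of the fibre. The action brings
  each of them to \<open>x\<close>, and its vertical part is then invisible to
  \<open>Dpi\<close>.\<close>

lemma quot_tan_orbit:
  fixes x :: "('p::finite, 'k) amb"
  assumes x: "x \<in> Mbar"
  shows "quot_tan (orbit x) = Dpi x ` horizontal \<alpha> \<beta> x"
proof
  show "Dpi x ` horizontal \<alpha> \<beta> x \<subseteq> quot_tan (orbit x)"
    unfolding quot_tan_def using orbit_self[of x] horizontal_tan[of \<alpha> \<beta> x] by blast
  show "quot_tan (orbit x) \<subseteq> Dpi x ` horizontal \<alpha> \<beta> x"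
  proof
    fix v assume "v \<in> quot_tan (orbit x)"
    then obtain y \<xi> where y: "y \<in> orbit x" "\<xi> \<in> Mbar_tan y" "v = Dpi y \<xi>" unfolding quot_tan_def by blast
    then obtain Q where Q: "Q \<in> unitary_mats" "y = uaction x Q" unfolding orbit_def by blast
    have Q': "ctrans Q \<in> unitary_mats" by (rule unitary_ctrans[OF Q(1)])
    have x': "uaction y (ctrans Q) = x"
      using Q by (simp add: uaction_uaction unitary_mats_def)
    define \<eta> where "\<eta> = uaction \<xi> (ctrans Q)"
    have \<eta>: "\<eta> \<in> Mbar_tan x" using uaction_tangent[OF y(2), of "ctrans Q"] by (simp add: \<eta>_def x')
    have v: "v = Dpi x \<eta>"
      using Dpi_uaction[OF orbit_Mbar[OF x y(1)] Q' y(2)] by (simp add: \<eta>_def x' y(3))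
    obtain w where w: "w \<in> orbit_tan x" "\<eta> - w \<in> horizontal \<alpha> \<beta> x"
      using horizontal_decomposition[OF x \<eta>] by blast
    have "Dpi x (\<eta> - w) = v"
      using Dpi_diff[OF x \<eta>, of w] Dpi_vertical[OF x w(1)] w(1) subspace_orbit_tan(2)[OF x] v by auto
    then show "v \<in> Dpi x ` horizontal \<alpha> \<beta> x" using w(2) by blast
  qed
qed

text \<open>The definite description is met: at another point of the fibre the horizontal
  representatives are images of those at \<open>x\<close> under an isometry.\<close>

lemma quot_metric_Dpi:
  fixes x :: "('p::finite, 'k) amb"
  assumes x: "x \<in> Mbar" and \<xi>: "\<xi> \<in> horizontal \<alpha> \<beta> x" and \<eta>: "\<eta> \<in> horizontal \<alpha> \<beta> x"
  shows "quot_metric \<alpha> \<beta> (orbit x) (Dpi x \<xi>) (Dpi x \<eta>) = Mbar_metric \<alpha> \<beta> x \<xi> \<eta>"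
  unfolding quot_metric_def
proof (rule the_equality)
  have t: "\<xi> \<in> Mbar_tan x" "\<eta> \<in> Mbar_tan x" using \<xi> \<eta> horizontal_tan by blast+
  show "\<forall>y\<in>orbit x. \<forall>\<xi>'\<in>horizontal \<alpha> \<beta> y. \<forall>\<eta>'\<in>horizontal \<alpha> \<beta> y.
    Dpi y \<xi>' = Dpi x \<xi> \<longrightarrow> Dpi y \<eta>' = Dpi x \<eta> \<longrightarrow> Mbar_metric \<alpha> \<beta> y \<xi>' \<eta>' = Mbar_metric \<alpha> \<beta> x \<xi> \<eta>"
  proof (intro ballI impI)
    fix y \<xi>' \<eta>' assume y: "y \<in> orbit x" and h: "\<xi>' \<in> horizontal \<alpha> \<beta> y" "\<eta>' \<in> horizontal \<alpha> \<beta> y"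
      and e: "Dpi y \<xi>' = Dpi x \<xi>" "Dpi y \<eta>' = Dpi x \<eta>"
    obtain Q where Q: "Q \<in> unitary_mats" "y = uaction x Q" using y unfolding orbit_def by blast
    have y': "y \<in> Mbar" by (rule orbit_Mbar[OF x y])
    have "\<xi>' = uaction \<xi> Q"
      by (rule Dpi_inj[OF y' h(1)]) (use uaction_horizontal[OF x Q(1) \<xi>] Dpi_uaction[OF x Q(1) t(1)] e Q(2) in simp_all)
    moreover have "\<eta>' = uaction \<eta> Q"
      by (rule Dpi_inj[OF y' h(2)]) (use uaction_horizontal[OF x Q(1) \<eta>] Dpi_uaction[OF x Q(1) t(2)] e Q(2) in simp_all)
    ultimately show "Mbar_metric \<alpha> \<beta> y \<xi>' \<eta>' = Mbar_metric \<alpha> \<beta> x \<xi> \<eta>"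
      using uaction_metric[OF x Q(1) t] Q(2) by simp
  qed
  then show "r = Mbar_metric \<alpha> \<beta> x \<xi> \<eta>" if "\<forall>y\<in>orbit x. \<forall>\<xi>'\<in>horizontal \<alpha> \<beta> y. \<forall>\<eta>'\<in>horizontal \<alpha> \<beta> y.
    Dpi y \<xi>' = Dpi x \<xi> \<longrightarrow> Dpi y \<eta>' = Dpi x \<eta> \<longrightarrow> Mbar_metric \<alpha> \<beta> y \<xi>' \<eta>' = r" for r
    using that orbit_self[of x] \<xi> \<eta> by metis
qed

text \<open>Pairing the gradient with a vertical vector differentiates a function along an orbit, on
  which it is constant.\<close>

lemma riem_grad_horizontal:
  fixes x :: "('p::finite, 'k) amb"
  assumes x: "x \<in> Mbar" and h: "h \<in> quot_smooth"
  shows "riem_grad (Mbar_riem \<alpha> \<beta>) (h \<circ> orbit) x \<in> horizontal \<alpha> \<beta> x"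
proof -
  have s: "smooth_fun Mbar (h \<circ> orbit)" using h by (simp add: quot_smooth_iff)
  have "Mbar_metric \<alpha> \<beta> x (riem_grad (Mbar_riem \<alpha> \<beta>) (h \<circ> orbit) x) v = 0" if "v \<in> orbit_tan x" for v
  proof -
    have "v \<in> Mbar_tan x" using that subspace_orbit_tan(2)[OF x] by blast
    then show ?thesis
      using riem_grad_Mbar(2)[OF \<alpha> \<beta> s x] Dpi_vertical[OF x that] h by (simp add: Dpi_def fun_eq_iff) metis
  qed
  then show ?thesis using riem_grad_Mbar(1)[OF \<alpha> \<beta> s x] by (simp add: horizontal_def)
qed

text \<open>The gradients of the functions \<open>coord E\<close> already suffice. A horizontal
  vector orthogonal to all of them is killed by \<open>dquot_embed\<close>, hence vertical, hence
  zero.\<close>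

lemma horizontal_is_gradient:
  fixes x :: "('p::finite, 'k) amb"
  assumes x: "x \<in> Mbar" and \<xi>: "\<xi> \<in> horizontal \<alpha> \<beta> x"
  shows "\<exists>h\<in>quot_smooth. \<xi> = riem_grad (Mbar_riem \<alpha> \<beta>) (h \<circ> orbit) x"
proof -
  define g where "g E = riem_grad (Mbar_riem \<alpha> \<beta>) (coord E \<circ> orbit) x" for E :: "complex^'p^'p"
  have s: "smooth_fun Mbar (coord E \<circ> orbit :: ('p, 'k) amb \<Rightarrow> real)" for E :: "complex^'p^'p"
    using coord_smooth by (simp add: quot_smooth_iff)
  have g: "g E \<in> Mbar_tan x" "w \<in> Mbar_tan x \<Longrightarrow> Mbar_metric \<alpha> \<beta> x (g E) w = E \<bullet> dquot_embed x w" for E w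
    unfolding g_def using riem_grad_Mbar[OF \<alpha> \<beta> s x] Mbar_deriv_coord[OF x] by auto
  have gI: "g E = v" if "v \<in> Mbar_tan x" "\<And>w. w \<in> Mbar_tan x \<Longrightarrow> Mbar_metric \<alpha> \<beta> x v w = E \<bullet> dquot_embed x w" for E v
    by (rule Mbar_metric_eqI[OF \<alpha> \<beta> x g(1) that(1) order.refl subspace_Mbar_tan]) (simp add: g(2) that(2))
  \<comment> \<open>The gradient at \<open>x\<close> depends linearly on \<open>E\<close>, so its
    values form a subspace onto which one can project.\<close>
  have sub: "subspace (range g)"
  proof (rule subspaceI)
    have "g 0 = 0"
      by (rule gI[OF subspace_0[OF subspace_Mbar_tan]])
        (use Mbar_metric_scaleR_left[of \<alpha> \<beta> x 0 0] in simp)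
    then show "0 \<in> range g" by (metis rangeI)
    have "g E + g E' = g (E + E')" for E E'
      by (rule gI[symmetric]) (simp_all add: Mbar_tan_add g Mbar_metric_add_left inner_add_left)
    then show "v + w \<in> range g" if "v \<in> range g" "w \<in> range g" for v w
      using that by (metis (no_types, lifting) imageE rangeI)
    have "r *\<^sub>R g E = g (r *\<^sub>R E)" for r E
      by (rule gI[symmetric]) (simp_all add: Mbar_tan_scale g Mbar_metric_scaleR_left)
    then show "r *\<^sub>R v \<in> range g" if "v \<in> range g" for r v
      using that by (metis (no_types, lifting) imageE rangeI)
  qed
  have gh: "range g \<subseteq> horizontal \<alpha> \<beta> x"
    unfolding g_def using riem_grad_horizontal[OF x coord_smooth] by blast
  have t: "\<xi> \<in> Mbar_tan x" using \<xi> horizontal_tan by blast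
  have "range g \<subseteq> Mbar_tan x" using g(1) by blast
  then obtain v where v: "v \<in> range g" "\<And>w. w \<in> range g \<Longrightarrow> Mbar_metric \<alpha> \<beta> x (\<xi> - v) w = 0"
    using Mbar_projection[OF \<alpha> \<beta> x t _ sub] by blast
  have d: "\<xi> - v \<in> horizontal \<alpha> \<beta> x" using v(1) gh \<xi> subspace_horizontal by (blast intro: subspace_diff)
  then have dt: "\<xi> - v \<in> Mbar_tan x" using horizontal_tan by blast
  have "E \<bullet> dquot_embed x (\<xi> - v) = 0" for E
    using v(2)[of "g E"] g(2)[OF dt, of E] Mbar_metric_sym[OF x dt g(1), of \<alpha> \<beta> E] by simp
  then have "dquot_embed x (\<xi> - v) = 0" by (metis inner_eq_zero_iff)
  then have "\<xi> - v \<in> orbit_tan x" using dt unfolding orbit_tan_eq(1)[OF x] by simp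
  then have "\<xi> = v" using horizontal_vertical_zero[OF x d] by simp
  then show ?thesis using v(1) coord_smooth unfolding g_def by blast
qed

lemma quot_riem_simps [simp]:
  "pts (quot_riem \<alpha> \<beta>) = quot" "smooth_funs (quot_riem \<alpha> \<beta>) = quot_smooth"
  "tan_sp (quot_riem \<alpha> \<beta>) = quot_tan" "act (quot_riem \<alpha> \<beta>) = (\<lambda>\<theta> v h. v h)"
  "metric (quot_riem \<alpha> \<beta>) = quot_metric \<alpha> \<beta>"
  by (simp_all add: quot_riem_def)

lemma riem_grad_quot:
  fixes x :: "('p::finite, 'k) amb"
  assumes x: "x \<in> Mbar" and h: "h \<in> quot_smooth"
  shows "riem_grad (quot_riem \<alpha> \<beta>) h (orbit x) = Dpi x (riem_grad (Mbar_riem \<alpha> \<beta>) (h \<circ> orbit) x)"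
proof -
  let ?g = "riem_grad (Mbar_riem \<alpha> \<beta>) (h \<circ> orbit) x"
  note gh = riem_grad_horizontal[OF x h]
  have s: "smooth_fun Mbar (h \<circ> orbit)" using h by (simp add: quot_smooth_iff)
  have g: "Mbar_metric \<alpha> \<beta> x ?g \<eta> = Dpi x \<eta> h" if "\<eta> \<in> horizontal \<alpha> \<beta> x" for \<eta>
    using riem_grad_Mbar(2)[OF \<alpha> \<beta> s x, of \<eta>] that h horizontal_tan[of \<alpha> \<beta> x] by (auto simp: Dpi_def)
  show ?thesis
    unfolding riem_grad_def[of "quot_riem \<alpha> \<beta>"] quot_riem_simps quot_tan_orbit[OF x]
  proof (rule the_equality)
    show "Dpi x ?g \<in> Dpi x ` horizontal \<alpha> \<beta> x \<and>
        (\<forall>w\<in>Dpi x ` horizontal \<alpha> \<beta> x. quot_metric \<alpha> \<beta> (orbit x) (Dpi x ?g) w = w h)"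
      using gh g by (simp add: quot_metric_Dpi[OF x gh])
    fix v assume v: "v \<in> Dpi x ` horizontal \<alpha> \<beta> x \<and>
        (\<forall>w\<in>Dpi x ` horizontal \<alpha> \<beta> x. quot_metric \<alpha> \<beta> (orbit x) v w = w h)"
    then obtain \<xi> where \<xi>: "\<xi> \<in> horizontal \<alpha> \<beta> x" "v = Dpi x \<xi>" by blast
    have "Mbar_metric \<alpha> \<beta> x \<xi> \<eta> = Mbar_metric \<alpha> \<beta> x ?g \<eta>" if "\<eta> \<in> horizontal \<alpha> \<beta> x" for \<eta>
      using v that by (simp add: \<xi>(2) quot_metric_Dpi[OF x \<xi>(1) that, symmetric] g)
    then have "\<xi> = ?g"
      by (rule Mbar_metric_eqI[OF \<alpha> \<beta> x \<xi>(1) gh horizontal_tan subspace_horizontal])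
    then show "v = Dpi x ?g" by (simp add: \<xi>(2))
  qed
qed

lemma quot_metric_grad:
  fixes x :: "('p::finite, 'k) amb"
  assumes "x \<in> Mbar" "a \<in> quot_smooth" "b \<in> quot_smooth"
  shows "quot_metric \<alpha> \<beta> (orbit x) (riem_grad (quot_riem \<alpha> \<beta>) a (orbit x)) (riem_grad (quot_riem \<alpha> \<beta>) b (orbit x))
    = Mbar_metric \<alpha> \<beta> x (riem_grad (Mbar_riem \<alpha> \<beta>) (a \<circ> orbit) x) (riem_grad (Mbar_riem \<alpha> \<beta>) (b \<circ> orbit) x)"
  using assms by (simp add: riem_grad_quot quot_metric_Dpi riem_grad_horizontal)

lemma riem_grad_quot_vector_field:
  assumes h: "(h :: ('p::finite, 'k) amb set \<Rightarrow> real) \<in> quot_smooth"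
  shows "riem_grad (quot_riem \<alpha> \<beta>) h \<in> vector_fields (quot_riem \<alpha> \<beta>)"
proof -
  have s: "smooth_fun Mbar (h \<circ> orbit)" using h by (simp add: quot_smooth_iff)
  have "(\<lambda>\<theta>. riem_grad (quot_riem \<alpha> \<beta>) h \<theta> a) \<in> quot_smooth" if a: "a \<in> quot_smooth" for a
    unfolding quot_smooth_iff
    by (rule smooth_fun_cong[OF smooth_fun_Mbar_deriv[OF tangent_field_riem_grad[OF \<alpha> \<beta> s], of "a \<circ> orbit"]])
      (use a in \<open>auto simp: quot_smooth_iff[symmetric] riem_grad_quot[OF _ h] Dpi_def\<close>)
  moreover have "riem_grad (quot_riem \<alpha> \<beta>) h \<theta> \<in> quot_tan \<theta>" if "\<theta> \<in> quot" for \<theta> :: "('p, 'k) amb set"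
    using that riem_grad_horizontal[OF _ h] by (auto simp: quot_def riem_grad_quot[OF _ h] quot_tan_orbit)
  ultimately show ?thesis by (simp add: vector_fields_def)
qed

text \<open>\<open>Dpi\<close> is 0 by default on functions that are not smooth, so smoothness of
  the inner product has to come first. It holds because this inner product is the derivative of
  \<open>a\<close> along the gradient of \<open>b\<close>.\<close>

lemma Dpi_quot_metric_grad:
  fixes x :: "('p::finite, 'k) amb"
  assumes x: "x \<in> Mbar" and a: "a \<in> quot_smooth" and b: "b \<in> quot_smooth"
  shows "Dpi x \<xi> (\<lambda>\<theta>. quot_metric \<alpha> \<beta> \<theta> (riem_grad (quot_riem \<alpha> \<beta>) a \<theta>) (riem_grad (quot_riem \<alpha> \<beta>) b \<theta>))
    = Mbar_deriv x \<xi> (\<lambda>y. Mbar_metric \<alpha> \<beta> y (riem_grad (Mbar_riem \<alpha> \<beta>) (a \<circ> orbit) y)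
        (riem_grad (Mbar_riem \<alpha> \<beta>) (b \<circ> orbit) y))"
proof -
  let ?q = "\<lambda>\<theta> :: ('p, 'k) amb set. quot_metric \<alpha> \<beta> \<theta> (riem_grad (quot_riem \<alpha> \<beta>) a \<theta>) (riem_grad (quot_riem \<alpha> \<beta>) b \<theta>)"
  have s: "smooth_fun Mbar (a \<circ> orbit)" "smooth_fun Mbar (b \<circ> orbit)" using a b by (simp_all add: quot_smooth_iff)
  have "?q \<in> quot_smooth"
    unfolding quot_smooth_iff
  proof (rule smooth_fun_cong[OF smooth_fun_Mbar_deriv[OF tangent_field_riem_grad[OF \<alpha> \<beta> s(2)] s(1)]])
    fix y :: "('p, 'k) amb" assume y: "y \<in> Mbar"
    show "Mbar_deriv y (riem_grad (Mbar_riem \<alpha> \<beta>) (b \<circ> orbit) y) (a \<circ> orbit) = (?q \<circ> orbit) y"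
      using riem_grad_Mbar[OF \<alpha> \<beta> s(2) y] riem_grad_Mbar[OF \<alpha> \<beta> s(1) y] by (simp add: quot_metric_grad[OF y a b])
  qed
  then have "Dpi x \<xi> ?q = Mbar_deriv x \<xi> (?q \<circ> orbit)" by (simp add: Dpi_def)
  also have "\<dots> = Mbar_deriv x \<xi> (\<lambda>y. Mbar_metric \<alpha> \<beta> y (riem_grad (Mbar_riem \<alpha> \<beta>) (a \<circ> orbit) y)
        (riem_grad (Mbar_riem \<alpha> \<beta>) (b \<circ> orbit) y))"
    by (rule Mbar_deriv_cong[OF x]) (simp add: quot_metric_grad[OF _ a b])
  finally show ?thesis .
qed

section \<open>The Hessian on the quotient\<close>

lemma riem_hess_quot:
  fixes x :: "('p::finite, 'k) amb" and f :: "('p, 'k) amb set \<Rightarrow> real"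
  assumes LC_bar: "levi_civita (Mbar_riem \<alpha> \<beta>) nabla_bar" and LC: "levi_civita (quot_riem \<alpha> \<beta>) nabla"
    and x: "x \<in> Mbar" and \<xi>: "\<xi> \<in> horizontal \<alpha> \<beta> x"
    and u: "smooth_fun Mbar u" and induced: "\<And>y. y \<in> Mbar \<Longrightarrow> u y = f (orbit y)"
  shows "horizontal_rep \<alpha> \<beta> x (riem_hess (quot_riem \<alpha> \<beta>) nabla f (orbit x) (Dpi x \<xi>))
    = horizontal_proj \<alpha> \<beta> x (riem_hess (Mbar_riem \<alpha> \<beta>) nabla_bar u x \<xi>)"
proof -
  let ?X = "riem_grad (quot_riem \<alpha> \<beta>)" and ?Y = "\<lambda>h. riem_grad (Mbar_riem \<alpha> \<beta>) (h \<circ> orbit)"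
    and ?B = "riem_grad (Mbar_riem \<alpha> \<beta>) u"
  have f: "f \<in> quot_smooth"
    unfolding quot_smooth_iff by (rule smooth_fun_cong[OF u]) (simp add: induced)
  have smooth: "smooth_fun Mbar (h \<circ> orbit)" if "h \<in> quot_smooth" for h :: "('p, 'k) amb set \<Rightarrow> real"
    using that by (simp add: quot_smooth_iff)
  \<comment> \<open>\<open>u\<close> and \<open>f \<circ> orbit\<close> are equal only on
    \<open>Mbar\<close>, so their gradients are compared there through the defining
    property.\<close>
  have B: "?B y = ?Y f y" if y: "y \<in> Mbar" for y
  proof (rule riem_grad_Mbar_eqI[OF \<alpha> \<beta> y])
    show "?Y f y \<in> Mbar_tan y" by (rule riem_grad_Mbar(1)[OF \<alpha> \<beta> smooth[OF f] y])
    show "Mbar_metric \<alpha> \<beta> y (?Y f y) w = Mbar_deriv y w u" if "w \<in> Mbar_tan y" for w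
      using riem_grad_Mbar(2)[OF \<alpha> \<beta> smooth[OF f] y that] Mbar_deriv_cong[OF y, of "f \<circ> orbit" u]
      by (simp add: induced)
  qed
  have quot: "orbit x \<in> quot" using x by (simp add: quot_def)
  \<comment> \<open>The Koszul formula needs a field through \<xi>, and on both levels a gradient of
    the same function.\<close>
  obtain a where a: "a \<in> quot_smooth" "\<xi> = ?Y a x" using horizontal_is_gradient[OF x \<xi>] by blast
  have Dpi_a: "Dpi x \<xi> = ?X a (orbit x)" by (simp add: riem_grad_quot[OF x a(1)] a(2))
  have grad: "quot_metric \<alpha> \<beta> \<theta> (?X h \<theta>) w = w h" if h: "h \<in> quot_smooth" and \<theta>: "\<theta> \<in> quot" "w \<in> quot_tan \<theta>"
    for h and \<theta> :: "('p, 'k) amb set" and w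
  proof -
    obtain y where y: "y \<in> Mbar" "\<theta> = orbit y" using \<theta>(1) by (auto simp: quot_def)
    obtain \<eta> where \<eta>: "\<eta> \<in> horizontal \<alpha> \<beta> y" "w = Dpi y \<eta>" using \<theta>(2) by (auto simp: y quot_tan_orbit)
    have "\<eta> \<in> Mbar_tan y" using \<eta>(1) horizontal_tan by blast
    then have "Mbar_metric \<alpha> \<beta> y (?Y h y) \<eta> = Dpi y \<eta> h"
      using riem_grad_Mbar(2)[OF \<alpha> \<beta> smooth[OF h] y(1)] h by (simp add: Dpi_def)
    then show ?thesis
      by (simp add: y(2) riem_grad_quot[OF y(1) h] \<eta>(2) quot_metric_Dpi[OF y(1) riem_grad_horizontal[OF y(1) h] \<eta>(1)])
  qed
  have sym: "quot_metric \<alpha> \<beta> \<theta> v w = quot_metric \<alpha> \<beta> \<theta> w v" if \<theta>: "\<theta> \<in> quot" "v \<in> quot_tan \<theta>" "w \<in> quot_tan \<theta>"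
    for \<theta> :: "('p, 'k) amb set" and v w
  proof -
    obtain y where y: "y \<in> Mbar" "\<theta> = orbit y" using \<theta>(1) by (auto simp: quot_def)
    obtain \<xi>' \<eta> where h: "\<xi>' \<in> horizontal \<alpha> \<beta> y" "v = Dpi y \<xi>'" "\<eta> \<in> horizontal \<alpha> \<beta> y" "w = Dpi y \<eta>"
      using \<theta>(2,3) by (auto simp: y quot_tan_orbit)
    have "\<xi>' \<in> Mbar_tan y" "\<eta> \<in> Mbar_tan y" using h horizontal_tan by blast+
    then show ?thesis
      using Mbar_metric_sym[OF y(1)] by (simp add: h(2,4) y(2) quot_metric_Dpi[OF y(1)] h(1,3))
  qed
  \<comment> \<open>Derivations depend only on values at actual orbits. This includes the default 0,
    since smoothness too is decided there.\<close>
  have cong: "v g = v h" if \<theta>: "\<theta> \<in> quot" "v \<in> quot_tan \<theta>" and eq: "\<And>z. z \<in> quot \<Longrightarrow> g z = h z"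
    for \<theta> :: "('p, 'k) amb set" and v g h
  proof -
    obtain y where y: "y \<in> Mbar" "\<theta> = orbit y" using \<theta>(1) by (auto simp: quot_def)
    obtain \<eta> where \<eta>: "v = Dpi y \<eta>" using \<theta>(2) by (auto simp: y quot_tan_orbit)
    have gh: "(g \<circ> orbit) z = (h \<circ> orbit) z" if "z \<in> Mbar" for z
      using eq[of "orbit z"] that by (simp add: quot_def)
    have "g \<in> quot_smooth \<longleftrightarrow> h \<in> quot_smooth"
      unfolding quot_smooth_iff using smooth_fun_cong[of Mbar "g \<circ> orbit" "h \<circ> orbit"]
        smooth_fun_cong[of Mbar "h \<circ> orbit" "g \<circ> orbit"] gh by auto
    moreover have "Mbar_deriv y \<eta> (g \<circ> orbit) = Mbar_deriv y \<eta> (h \<circ> orbit)"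
      by (rule Mbar_deriv_cong[OF y(1)]) (rule gh)
    ultimately show ?thesis by (simp add: \<eta> Dpi_def)
  qed
  have quot_tan_hess: "nabla (orbit x) (Dpi x \<xi>) (?X f) \<in> quot_tan (orbit x)"
  proof -
    have "Dpi x \<xi> \<in> quot_tan (orbit x)" using \<xi> by (simp add: quot_tan_orbit[OF x])
    then show ?thesis
      using LC[unfolded levi_civita_def affine_connection_def, THEN conjunct1, THEN conjunct1] quot
        riem_grad_quot_vector_field[OF f] by simp
  qed
  then obtain \<eta> where \<eta>: "\<eta> \<in> horizontal \<alpha> \<beta> x" "nabla (orbit x) (Dpi x \<xi>) (?X f) = Dpi x \<eta>"
    by (auto simp: quot_tan_orbit[OF x])
  \<comment> \<open>It remains to show that \<eta>, the representative of the quotient Hessian, has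
    the same products with horizontal vectors as the Hessian above.\<close>
  have "Mbar_metric \<alpha> \<beta> x (nabla_bar x \<xi> ?B) \<zeta> = Mbar_metric \<alpha> \<beta> x \<eta> \<zeta>" if \<zeta>: "\<zeta> \<in> horizontal \<alpha> \<beta> x" for \<zeta>
  proof -
    obtain c where c: "c \<in> quot_smooth" "\<zeta> = ?Y c x" using horizontal_is_gradient[OF x \<zeta>] by blast
    have Dpi_c: "Dpi x \<zeta> = ?X c (orbit x)" by (simp add: riem_grad_quot[OF x c(1)] c(2))
    have Dpi_f: "Dpi x (?Y f x) = ?X f (orbit x)" by (simp add: riem_grad_quot[OF x f])
    have "2 * quot_metric \<alpha> \<beta> (orbit x) (nabla (orbit x) (?X a (orbit x)) (?X f)) (?X c (orbit x)) =
        ?X a (orbit x) (\<lambda>\<theta>. quot_metric \<alpha> \<beta> \<theta> (?X f \<theta>) (?X c \<theta>))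
        + ?X c (orbit x) (\<lambda>\<theta>. quot_metric \<alpha> \<beta> \<theta> (?X a \<theta>) (?X f \<theta>))
        - ?X f (orbit x) (\<lambda>\<theta>. quot_metric \<alpha> \<beta> \<theta> (?X a \<theta>) (?X c \<theta>))"
    proof (rule koszul_gradients[OF LC, unfolded quot_riem_simps, where a = a and b = f and c = c])
      show "v g = v h" if "\<theta> \<in> quot" "v \<in> quot_tan \<theta>" "\<And>z. z \<in> quot \<Longrightarrow> g z = h z"
        for \<theta> :: "('p, 'k) amb set" and v g h
        using that by (rule cong)
    qed (simp_all add: grad quot a(1) f c(1) riem_grad_quot_vector_field sym)
    also have "\<dots> = Mbar_deriv x \<xi> (\<lambda>y. Mbar_metric \<alpha> \<beta> y (?B y) (?Y c y))
        + Mbar_deriv x \<zeta> (\<lambda>y. Mbar_metric \<alpha> \<beta> y (?Y a y) (?B y))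
        - Mbar_deriv x (?B x) (\<lambda>y. Mbar_metric \<alpha> \<beta> y (?Y a y) (?Y c y))"
      unfolding Dpi_a[symmetric] Dpi_c[symmetric] Dpi_f[symmetric] Dpi_quot_metric_grad[OF x f c(1)]
        Dpi_quot_metric_grad[OF x a(1) f] Dpi_quot_metric_grad[OF x a(1) c(1)] B[OF x]
      by (intro arg_cong2[of _ _ _ _ "(-)"] arg_cong2[of _ _ _ _ "(+)"] Mbar_deriv_cong[OF x] refl) (simp_all add: B)
    also have "\<dots> = 2 * Mbar_metric \<alpha> \<beta> x (nabla_bar x (?Y a x) ?B) (?Y c x)"
      unfolding a(2) c(2)
      by (rule koszul_gradients[OF LC_bar, unfolded Mbar_riem_simps mem_Collect_eq, symmetric,
            where a = "a \<circ> orbit" and b = u and c = "c \<circ> orbit"])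
        (simp_all add: Mbar_metric_sym Mbar_deriv_linear x u smooth[OF a(1)] smooth[OF c(1)]
          tangent_field_vector_field tangent_field_riem_grad[OF \<alpha> \<beta>] riem_grad_Mbar(2)[OF \<alpha> \<beta>] cong: Mbar_deriv_cong)
    finally show ?thesis
      unfolding Dpi_a[symmetric] Dpi_c[symmetric] a(2)[symmetric] c(2)[symmetric] \<eta>(2)
        quot_metric_Dpi[OF x \<eta>(1) \<zeta>] by simp
  qed
  then have "horizontal_proj \<alpha> \<beta> x (nabla_bar x \<xi> ?B) = \<eta>" by (rule horizontal_proj_eqI[OF x \<eta>(1)])
  then show ?thesis unfolding riem_hess_def \<eta>(2) horizontal_rep_Dpi[OF x \<eta>(1)] by simp
qed

end

text \<open>The term \<open>skew (GU ** ctrans \<xi>U) ** U\<close> carries the sign +, where the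
  opening English statement has -. By \<open>hessian_sign_check\<close> the sign - fails already for
  a function that is constant on \<open>Mbar\<close>. Results are stated for any smooth extension
  \<open>F\<close> near the point, and for any Levi-Civita connections on the two manifolds.\<close>

theorem proposition4:
  fixes \<alpha> \<beta> :: real
    and fbar F :: "('p::finite, 'k::finite) amb \<Rightarrow> real"
    and f :: "('p, 'k) amb set \<Rightarrow> real"
    and nabla_bar :: "('p, 'k) amb \<Rightarrow> ('p, 'k) amb \<Rightarrow> (('p, 'k) amb \<Rightarrow> ('p, 'k) amb) \<Rightarrow> ('p, 'k) amb"
    and nabla :: "('p, 'k) amb set \<Rightarrow> ('p, 'k) qtan \<Rightarrow> (('p, 'k) amb set \<Rightarrow> ('p, 'k) qtan) \<Rightarrow> ('p, 'k) qtan"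
    and U GU :: "complex^'k^'p" and S GS :: "complex^'k^'k"
  assumes dims: "CARD('k) < CARD('p)"
    and alpha: "\<alpha> > 0"
    and beta: "\<beta> > - \<alpha> / real CARD('k)"
    and smooth: "smooth_fun Mbar fbar"
    and invariant: "\<And>x Q. x \<in> Mbar \<Longrightarrow> Q \<in> unitary_mats \<Longrightarrow> fbar (uaction x Q) = fbar x"
    and induced: "\<And>x. x \<in> Mbar \<Longrightarrow> fbar x = f (orbit x)"
    and LC_bar: "levi_civita (Mbar_riem \<alpha> \<beta>) nabla_bar"
    and LC: "levi_civita (quot_riem \<alpha> \<beta>) nabla"
    and point: "(U, S) \<in> Mbar"
    and extension: "(U, S) \<in> W" "smooth_extension Mbar fbar W F"
    and gradient: "euclid_grad F (U, S) = (GU, GS)"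
  shows
    "horizontal_rep \<alpha> \<beta> (U, S) (riem_grad (quot_riem \<alpha> \<beta>) f (orbit (U, S)))
        = riem_grad (Mbar_riem \<alpha> \<beta>) fbar (U, S)
     \<and> riem_grad (Mbar_riem \<alpha> \<beta>) fbar (U, S) =
        (GU - U ** ctrans GU ** U,
         (1 / \<alpha>) *\<^sub>R (S ** herm GS ** S)
         - (\<beta> * Re (trace (GS ** S)) / (\<alpha> * (\<alpha> + real CARD('k) * \<beta>))) *\<^sub>R S)
     \<and> (\<forall>\<xi>U \<xi>S HU HS.
          (\<xi>U, \<xi>S) \<in> horizontal \<alpha> \<beta> (U, S) \<longrightarrow>
          euclid_hess F (U, S) (\<xi>U, \<xi>S) = (HU, HS) \<longrightarrow>
            horizontal_rep \<alpha> \<beta> (U, S)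
                (riem_hess (quot_riem \<alpha> \<beta>) nabla f (orbit (U, S)) (Dpi (U, S) (\<xi>U, \<xi>S)))
              = horizontal_proj \<alpha> \<beta> (U, S)
                  (riem_hess (Mbar_riem \<alpha> \<beta>) nabla_bar fbar (U, S) (\<xi>U, \<xi>S))
            \<and> riem_hess (Mbar_riem \<alpha> \<beta>) nabla_bar fbar (U, S) (\<xi>U, \<xi>S) =
              (HU - U ** ctrans HU ** U
               - U ** skew (ctrans GU ** \<xi>U)
               + skew (GU ** ctrans \<xi>U) ** U
               - (1/2) *\<^sub>R ((mat 1 - U ** ctrans U) ** \<xi>U ** ctrans U ** GU),
               (1 / \<alpha>) *\<^sub>R (S ** herm HS ** S + herm (S ** herm GS ** \<xi>S))
               - (\<beta> * Re (trace (HS ** S + GS ** \<xi>S)) / (\<alpha> * (\<alpha> + real CARD('k) * \<beta>))) *\<^sub>R S))"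
proof (intro conjI allI impI)
  have f: "f \<in> quot_smooth"
    unfolding quot_smooth_iff by (rule smooth_fun_cong[OF smooth]) (simp add: induced)
  then have s: "smooth_fun Mbar (f \<circ> orbit)" by (simp add: quot_smooth_iff)
  show grad: "riem_grad (Mbar_riem \<alpha> \<beta>) fbar (U, S) =
        (GU - U ** ctrans GU ** U,
         (1 / \<alpha>) *\<^sub>R (S ** herm GS ** S)
         - (\<beta> * Re (trace (GS ** S)) / (\<alpha> * (\<alpha> + real CARD('k) * \<beta>))) *\<^sub>R S)"
    using tan_grad_extension(2)[OF alpha beta extension(2,1) point] by (simp add: gradient tan_grad_def)
  \<comment> \<open>\<open>fbar\<close> and \<open>f \<circ> orbit\<close> may differ off
    \<open>Mbar\<close>; the defining property of the gradient only sees derivatives within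
    \<open>Mbar\<close>.\<close>
  have "riem_grad (Mbar_riem \<alpha> \<beta>) fbar (U, S) = riem_grad (Mbar_riem \<alpha> \<beta>) (f \<circ> orbit) (U, S)"
  proof (rule riem_grad_Mbar_eqI[OF alpha beta point])
    show "riem_grad (Mbar_riem \<alpha> \<beta>) (f \<circ> orbit) (U, S) \<in> Mbar_tan (U, S)"
      by (rule riem_grad_Mbar(1)[OF alpha beta s point])
    show "Mbar_metric \<alpha> \<beta> (U, S) (riem_grad (Mbar_riem \<alpha> \<beta>) (f \<circ> orbit) (U, S)) w = Mbar_deriv (U, S) w fbar"
      if "w \<in> Mbar_tan (U, S)" for w
      using riem_grad_Mbar(2)[OF alpha beta s point that] Mbar_deriv_cong[OF point, of "f \<circ> orbit" fbar]
      by (simp add: induced)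
  qed
  then show "horizontal_rep \<alpha> \<beta> (U, S) (riem_grad (quot_riem \<alpha> \<beta>) f (orbit (U, S)))
        = riem_grad (Mbar_riem \<alpha> \<beta>) fbar (U, S)"
    by (simp add: riem_grad_quot[OF alpha beta point f]
        horizontal_rep_Dpi[OF alpha beta point riem_grad_horizontal[OF alpha beta point f]])
next
  fix \<xi>U :: "complex^'k^'p" and \<xi>S :: "complex^'k^'k" and HU HS
  assume \<xi>: "(\<xi>U, \<xi>S) \<in> horizontal \<alpha> \<beta> (U, S)" and H: "euclid_hess F (U, S) (\<xi>U, \<xi>S) = (HU, HS)"
  show "horizontal_rep \<alpha> \<beta> (U, S) (riem_hess (quot_riem \<alpha> \<beta>) nabla f (orbit (U, S)) (Dpi (U, S) (\<xi>U, \<xi>S)))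
      = horizontal_proj \<alpha> \<beta> (U, S) (riem_hess (Mbar_riem \<alpha> \<beta>) nabla_bar fbar (U, S) (\<xi>U, \<xi>S))"
    by (rule riem_hess_quot[OF alpha beta LC_bar LC point \<xi> smooth induced])
  have "(\<xi>U, \<xi>S) \<in> Mbar_tan (U, S)" using \<xi> horizontal_tan by blast
  then show "riem_hess (Mbar_riem \<alpha> \<beta>) nabla_bar fbar (U, S) (\<xi>U, \<xi>S) =
      (HU - U ** ctrans HU ** U - U ** skew (ctrans GU ** \<xi>U) + skew (GU ** ctrans \<xi>U) ** U
         - (1/2) *\<^sub>R ((mat 1 - U ** ctrans U) ** \<xi>U ** ctrans U ** GU),
       (1 / \<alpha>) *\<^sub>R (S ** herm HS ** S + herm (S ** herm GS ** \<xi>S))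
         - (\<beta> * Re (trace (HS ** S + GS ** \<xi>S)) / (\<alpha> * (\<alpha> + real CARD('k) * \<beta>))) *\<^sub>R S)"
    by (rule hessian_Mbar[OF alpha beta LC_bar point _ smooth extension(2,1) gradient H])
qed

end
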